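(* Let $A=(A_{i,j})_{i,j\in\mathbb Z}$ be a complex matrix such that for every $i\in\mathbb Z$, $A_{i,j}=0$ for $j\ll0$. Let $\tilde\Gamma_i=\sum_{j\in\mathbb Z}A_{i,j}\Gamma_j$, where $\Gamma(u)=\sum_{j\in\mathbb Z}\Gamma_ju^{-j}=E(u)H(u)E^\perp(-u)$ acts on $\Lambda$, and for $\lambda\in\mathbb Z^l$ let $\tilde Q_\lambda=\tilde\Gamma_{-\lambda_1}\cdots\tilde\Gamma_{-\lambda_l}(1)$. (a) For any $\lambda\in\mathbb Z^l$, $\tilde Q_\lambda=\sum_{\alpha\in\mathbb Z^l}A_{-\lambda_1,-\alpha_1}\cdots A_{-\lambda_l,-\alpha_l}Q_\alpha$. If $A$ is invertible, then $Q_\alpha=\sum_{\lambda\in\mathbb Z^l}(A^{-1})_{-\alpha_1,-\lambda_1}\cdots(A^{-1})_{-\alpha_l,-\lambda_l}\tilde Q_\lambda$. (b) (Analogue of the Pfaffian formula) For any integer vector $\lambda\in\mathbb Z^{2l}$, $$\tilde Q_{(\lambda_1,\dots,\lambda_{2l})}=\mathrm{Pf}\left[\sum_{k,r\in\mathbb Z}A_{-\lambda_i,-k}A_{-\lambda_j,-r}\,q_{k,r}\right]_{i,j=1,\dots,2l}.$$ (c) The symmetric polynomials $\{\tilde Q_\lambda\}_{\lambda\in\mathbb Z^l}$ satisfy the stability property $\tilde Q_\lambda(x_1,\dots,x_n,0)=\tilde Q_\lambda(x_1,\dots,x_n)$. (d) Let $A$ be invertible, and consider $g_k(u)=\sum_{s\in\mathbb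 Z}(A^{-1})_{-s,-k}u^s$. Then $\mathcal Q(u_1,\dots,u_l)=\sum_{\lambda\in\mathbb Z^l}\tilde Q_\lambda\,g_{\lambda_1}(u_1)\cdots g_{\lambda_l}(u_l)$. (e) Assume that $A_{i,j}=0$ for all $i<0$, $j\ge0$, and that $A_{0,j}=\delta_{0,j}$. Let $\lambda\in\mathbb N^l$, let $n\ge l$, and set $\lambda_{l+1}=\dots=\lambda_n=0$. Then $\tilde Q_\lambda\in\Lambda$ can be identified with the symmetric polynomial in $(x_1,\dots,x_n)$ $$\tilde Q_\lambda(x_1,\dots,x_n)=2^l\sum_{\sigma\in S_n}\sigma\left(f_{\lambda_1}(x_1)\cdots f_{\lambda_n}(x_n)\prod_{i=1}^{n}\prod_{i<j}\frac{x_i+x_j}{x_i-x_j}\right),$$ where $f_k(x)=\sum_{j=1}^{-M(-k)}A_{-k,-j}x^j$ ($k\in\mathbb N$) are complex-valued polynomials with zero constant coefficient, $f_0(x)=1$, and $M(i)=\max\{k\in\mathbb Z: A_{i,r}=0\text{ for all }r<k\}$ is the position of the first non-zero entry in the $i$-th row of $A$.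
   Context: $\mathbb N=\{1,2,\dots\}$. $\Lambda=\mathbb C[p_1,p_2,\dots]$ is the ring of symmetric functions in $x_1,x_2,\dots$; $h_k,e_k$ are the complete and elementary symmetric functions; $f^\perp$ is the adjoint of multiplication by $f$ for the scalar product in which Schur functions are orthonormal ($p_n^\perp=n\,\partial/\partial p_n$). $H(u)=\sum_{k\ge0}h_ku^k$, $E(u)=\sum_{k\ge0}e_ku^k$, $E^\perp(u)=\sum_{k\ge0}e_k^\perp u^{-k}$. For each $f\in\Lambda$, $\Gamma_k(f)=0$ for $k\gg0$, so $\tilde\Gamma_i$ is well defined. ($\Gamma(u)$ is the $t=-1$ specialization of the Hall–Littlewood vertex operator $E(-tu)H(u)E^\perp(-u)$.) Put $Q(u)=E(u)H(u)=\sum_{k\in\mathbb Z}q_ku^k$ (so $q_k=0$ for $k<0$) and $$\mathcal Q(u_1,\dots,u_l)=\Gamma(u_1)\cdots\Gamma(u_l)(1)=\prod_{1\le i<j\le l}\Big(1+2\sum_{s\ge1}(-1)^s\big(\tfrac{u_j}{u_i}\big)^s\Big)\prod_{i=1}^lQ(u_i)=\sum_{\alpha\in\mathbb Z^l}Q_\alpha u_1^{\alpha_1}\cdots u_l^{\alpha_l}.$$ Put $q_{a,b}=q_aq_b+2\sum_{i\ge1}(-1)^iq_{a+i}q_{b-i}$. The Pfaffian of a skew-symmetric matrix $M=[M_{ij}]$ of size $2l\times2l$ is $\mathrm{Pf}[M]=\sum_\sigma\mathrm{sgn}(\sigma)M_{\sigma(1)\sigma(2)}\cdots M_{\sigma(2l-1)\sigma(2l)}$,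 summed over $\sigma\in S_{2l}$ with $\sigma(2k-1)<\sigma(2k)$ for $1\le k\le l$ and $\sigma(2k-1)<\sigma(2k+1)$ for $1\le k\le l-1$. For $f\in\Lambda$, $f(x_1,\dots,x_n)$ denotes the result of setting $x_{n+1}=x_{n+2}=\dots=0$. $S_n$ acts by permuting $x_1,\dots,x_n$; in (e) the inner product is over $j$ with $i<j\le n$. $B=(B_{i,j})_{i,j\in\mathbb Z}$ is the (left) inverse of $A$, written $B=A^{-1}$, if $\sum_{k\in\mathbb Z}B_{i,k}A_{k,j}=\delta_{i,j}$; $A$ is invertible if it has such an inverse.
   Formalization: In (e) the printed formula (false for n≥l+2, e.g. l=0, n=2) is kept for n=l, l+1; for all n≥l the factor is 2^l/(n-l)! with product over i≤l. In (a), (d) the sums over λ, which may diverge, are iterated coefficientwise sums, and unordered sums wherever these converge. *)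

theory Defs
  imports
    "HOL-Analysis.Infinite_Sum"
    "HOL-Library.Poly_Mapping"
    "HOL-Combinatorics.Permutations"
    "HOL-Computational_Algebra.Formal_Power_Series"
    "HOL-Computational_Algebra.Polynomial"
    "HOL-Computational_Algebra.Fraction_Field"
begin

section \<open>Polynomial rings in countably many variables\<close>

text \<open>
  \<open>cpoly\<close> is the polynomial ring over the complex numbers in variables numbered \<open>0, 1, 2, \<dots>\<close>; a
  monomial is its finitely supported exponent vector. The ring is used twice. As \<open>Lam\<close> it is the
  ring of symmetric functions \<open>\<complex>[p\<^sub>1, p\<^sub>2, \<dots>]\<close>, and variable \<open>i\<close> is the power sum of degree \<open>i + 1\<close>. As
  \<open>xpoly\<close> it is \<open>\<complex>[x\<^sub>1, x\<^sub>2, \<dots>]\<close>, and variable \<open>i\<close> is \<open>x\<close> with index \<open>i + 1\<close>.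
\<close>

type_synonym cpoly = "(nat \<Rightarrow>\<^sub>0 nat) \<Rightarrow>\<^sub>0 complex"
type_synonym Lam = cpoly
type_synonym xpoly = cpoly

definition cst :: "complex \<Rightarrow> cpoly" where
  "cst c = Poly_Mapping.single 0 c"

definition var :: "nat \<Rightarrow> cpoly" where
  "var i = Poly_Mapping.single (Poly_Mapping.single i 1) 1"

definition psubst :: "(nat \<Rightarrow> cpoly) \<Rightarrow> cpoly \<Rightarrow> cpoly" where
  "psubst \<phi> f = (\<Sum>m\<in>Poly_Mapping.keys f. cst (Poly_Mapping.lookup f m) *
     (\<Prod>i\<in>Poly_Mapping.keys m. \<phi> i ^ Poly_Mapping.lookup m i))"

section \<open>Symmetric functions\<close>

definition psym :: "nat \<Rightarrow> Lam" where
  "psym n = var (n - 1)" \<comment> \<open>meant for \<open>n \<ge> 1\<close>\<close>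

text \<open>
  The complete and elementary symmetric functions are given by Newton's identities; see
  \<open>lam_spec_esym\<close> and \<open>lam_spec_hsym\<close> below for their usual description in the variables \<open>x\<close>.
\<close>

fun hsym :: "nat \<Rightarrow> Lam" where
  "hsym 0 = 1"
| "hsym (Suc k) = cst (1 / of_nat (Suc k)) * (\<Sum>i\<le>k. psym (Suc i) * hsym (k - i))"

fun esym :: "nat \<Rightarrow> Lam" where
  "esym 0 = 1"
| "esym (Suc k) = cst (1 / of_nat (Suc k)) * (\<Sum>i\<le>k. (-1) ^ i * psym (Suc i) * esym (k - i))"

text \<open>\<open>lam_spec n f\<close> is \<open>f(x\<^sub>1, \<dots>, x\<^sub>n)\<close>, obtained by setting the remaining variables to 0.\<close>

definition lam_spec :: "nat \<Rightarrow> Lam \<Rightarrow> xpoly" where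
  "lam_spec n = psubst (\<lambda>i. \<Sum>j<n. var j ^ Suc i)"

text \<open>
  The scalar product that makes Schur functions orthonormal, written in the power sum basis: products
  of power sums are orthogonal, and the one indexed by a partition with \<open>m\<^sub>r\<close> parts equal to \<open>r\<close> has
  square norm \<open>\<Prod>r. r ^ m\<^sub>r * m\<^sub>r!\<close>. Equivalently, the adjoint of \<open>p\<^sub>n\<close> is \<open>n \<partial>/\<partial>p\<^sub>n\<close>
  (\<open>perp_psym\<close> below).
\<close>

definition zee :: "(nat \<Rightarrow>\<^sub>0 nat) \<Rightarrow> complex" where
  "zee m = (\<Prod>i\<in>Poly_Mapping.keys m. of_nat (Suc i) ^ Poly_Mapping.lookup m i * fact (Poly_Mapping.lookup m i))"

definition lam_scalar :: "Lam \<Rightarrow> Lam \<Rightarrow> complex" where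
  "lam_scalar f g = (\<Sum>m\<in>Poly_Mapping.keys f. Poly_Mapping.lookup f m * Poly_Mapping.lookup g m * zee m)"

definition perp :: "Lam \<Rightarrow> Lam \<Rightarrow> Lam" where
  "perp f g = (THE h. \<forall>k. lam_scalar h k = lam_scalar g (f * k))"

section \<open>Vertex operators\<close>

definition qsym :: "int \<Rightarrow> Lam" where
  "qsym k = (if k < 0 then 0 else fps_nth (Abs_fps esym * Abs_fps hsym) (nat k))"

definition qsym2 :: "int \<Rightarrow> int \<Rightarrow> Lam" where
  "qsym2 a b = qsym a * qsym b +
     2 * (\<Sum>i::nat. if i \<ge> 1 then (-1) ^ i * qsym (a + int i) * qsym (b - int i) else 0)"

text \<open>
  \<open>Gamma_ser f m\<close> is the coefficient of \<open>u ^ m\<close> in \<open>E(u) H(u) E\<^sup>\<bottom>(-u) f\<close>, where \<open>E\<^sup>\<bottom>(u)\<close> is a series in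
  \<open>u ^ (-1)\<close>. The sum is finite because the adjoint of \<open>esym k\<close> lowers the degree by \<open>k\<close>.
\<close>

definition Gamma_ser :: "Lam \<Rightarrow> int \<Rightarrow> Lam" where
  "Gamma_ser f m = (\<Sum>k::nat. (-1) ^ k * qsym (m + int k) * perp (esym k) f)"

definition Gamma :: "int \<Rightarrow> Lam \<Rightarrow> Lam" where
  "Gamma j f = Gamma_ser f (- j)"

definition Gamma_tilde :: "(int \<Rightarrow> int \<Rightarrow> complex) \<Rightarrow> int \<Rightarrow> Lam \<Rightarrow> Lam" where
  "Gamma_tilde A i f = (\<Sum>j. cst (A i j) * Gamma j f)"

text \<open>Integer vectors are lists, so the entry with index \<open>i\<close> is \<open>v ! (i - 1)\<close>.\<close>

definition Zvec :: "nat \<Rightarrow> int list set" where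
  "Zvec l = {v. length v = l}"

definition Q_tilde :: "(int \<Rightarrow> int \<Rightarrow> complex) \<Rightarrow> int list \<Rightarrow> Lam" where
  "Q_tilde A lam = foldr (\<lambda>a. Gamma_tilde A (- a)) lam 1"

section \<open>Formal distributions\<close>

text \<open>
  A formal distribution in \<open>u\<^sub>1, \<dots>, u\<^sub>l\<close> is represented by its coefficient function on \<open>Zvec l\<close>.
  \<open>calQ\<close> is \<open>\<Gamma>(u\<^sub>1) \<dots> \<Gamma>(u\<^sub>l) (1)\<close>, and its value at \<open>\<alpha>\<close> is the coefficient \<open>Q\<^sub>\<alpha>\<close>.
\<close>

fun calQ :: "int list \<Rightarrow> Lam" where
  "calQ [] = 1"
| "calQ (a # as) = Gamma_ser (calQ as) a"

text \<open>The series \<open>g\<^sub>k\<close> as a coefficient function (\<open>B\<close> stands for the inverse matrix), and the product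
  \<open>g\<^sub>\<lambda>\<^sub>1(u\<^sub>1) \<dots> g\<^sub>\<lambda>\<^sub>l(u\<^sub>l)\<close>.\<close>

definition g_ser :: "(int \<Rightarrow> int \<Rightarrow> complex) \<Rightarrow> int \<Rightarrow> int \<Rightarrow> complex" where
  "g_ser B k s = B (- s) (- k)"

definition g_prod :: "(int \<Rightarrow> int \<Rightarrow> complex) \<Rightarrow> int list \<Rightarrow> int list \<Rightarrow> complex" where
  "g_prod B lam \<alpha> = (\<Prod>i<length lam. g_ser B (lam ! i) (\<alpha> ! i))"

section \<open>Infinite sums and inverse matrices\<close>

definition has_finite_sum :: "('a \<Rightarrow> 'b::comm_monoid_add) \<Rightarrow> 'a set \<Rightarrow> 'b \<Rightarrow> bool" where
  "has_finite_sum F S s \<longleftrightarrow> finite {x \<in> S. F x \<noteq> 0} \<and> s = sum F {x \<in> S. F x \<noteq> 0}"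

definition is_left_inverse :: "(int \<Rightarrow> int \<Rightarrow> complex) \<Rightarrow> (int \<Rightarrow> int \<Rightarrow> complex) \<Rightarrow> bool" where
  "is_left_inverse B A \<longleftrightarrow>
     (\<forall>i j. ((\<lambda>k. B i k * A k j) has_sum (if i = j then 1 else 0)) UNIV)"

text \<open>
  Sums over all of \<open>\<int>\<^sup>l\<close> with values in \<open>\<Lambda>\<close>, taken coefficientwise. The rows of a left inverse may have
  infinitely many nonzero entries, and then the family summed in the inversion formulas need not be
  unconditionally summable (not even coefficientwise) for \<open>l \<ge> 2\<close>. What always converges is the
  iterated sum in which \<open>\<lambda>\<^sub>1\<close> is summed first and \<open>\<lambda>\<^sub>l\<close> last. \<open>has_formal_sum\<close> asks for the value of
  that iterated sum, and for the same value of the unordered sum at every coefficient where the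
  latter exists. For a family with finite support both are the ordinary sum.
\<close>

primrec has_iterated_sum :: "nat \<Rightarrow> (int list \<Rightarrow> Lam) \<Rightarrow> Lam \<Rightarrow> bool" where
  "has_iterated_sum 0 F s \<longleftrightarrow> F [] = s"
| "has_iterated_sum (Suc l) F s \<longleftrightarrow>
     (\<exists>G. (\<forall>k. has_iterated_sum l (\<lambda>v. F (v @ [k])) (G k)) \<and>
          (\<forall>m. ((\<lambda>k. Poly_Mapping.lookup (G k) m) has_sum Poly_Mapping.lookup s m) UNIV))"

definition has_formal_sum :: "nat \<Rightarrow> (int list \<Rightarrow> Lam) \<Rightarrow> Lam \<Rightarrow> bool" where
  "has_formal_sum l F s \<longleftrightarrow> has_iterated_sum l F s \<and>
     (\<forall>m. (\<lambda>v. Poly_Mapping.lookup (F v) m) summable_on Zvec l \<longrightarrow>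
          ((\<lambda>v. Poly_Mapping.lookup (F v) m) has_sum Poly_Mapping.lookup s m) (Zvec l))"

section \<open>The Pfaffian\<close>

text \<open>
  Rows and columns are numbered from 0. Only entries above the diagonal occur, so the formula also
  makes sense for matrices that are not skew-symmetric: it is the Pfaffian of the skew-symmetric
  matrix with the same entries above the diagonal.
\<close>

definition Pfaffian :: "nat \<Rightarrow> (nat \<Rightarrow> nat \<Rightarrow> 'a::comm_ring_1) \<Rightarrow> 'a" where
  "Pfaffian l M =
     (\<Sum>\<sigma> | \<sigma> permutes {..<2 * l} \<and> (\<forall>k<l. \<sigma> (2 * k) < \<sigma> (2 * k + 1)) \<and>
            (\<forall>k. k + 1 < l \<longrightarrow> \<sigma> (2 * k) < \<sigma> (2 * k + 2)).
        of_int (sign \<sigma>) * (\<Prod>k<l. M (\<sigma> (2 * k)) (\<sigma> (2 * k + 1))))"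

section \<open>Rational functions in \<open>x\<^sub>1, x\<^sub>2, \<dots>\<close>\<close>

type_synonym xrat = "xpoly fract"

definition to_xrat :: "xpoly \<Rightarrow> xrat" where
  "to_xrat f = Fract f 1"

definition eval_xrat :: "complex poly \<Rightarrow> xrat \<Rightarrow> xrat" where
  "eval_xrat f y = poly (map_poly (\<lambda>c. to_xrat (cst c)) f) y"

text \<open>For a zero row the value of \<open>first_pos\<close> is unspecified; then \<open>f_poly\<close> is 0 all the same.\<close>

definition first_pos :: "(int \<Rightarrow> int \<Rightarrow> complex) \<Rightarrow> int \<Rightarrow> int" where
  "first_pos A i = (GREATEST k. \<forall>r<k. A i r = 0)"

definition f_poly :: "(int \<Rightarrow> int \<Rightarrow> complex) \<Rightarrow> int \<Rightarrow> complex poly" where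
  "f_poly A k = (if k = 0 then 1
     else (\<Sum>j\<in>{1..- first_pos A (- k)}. monom (A (- k) (- j)) (nat j)))"

section \<open>Consistency of the definitions with the usual ones\<close>


lemma psubst_superset:
  assumes "finite S" "Poly_Mapping.keys f \<subseteq> S"
  shows "psubst \<phi> f = (\<Sum>m\<in>S. cst (Poly_Mapping.lookup f m) *
           (\<Prod>i\<in>Poly_Mapping.keys m. \<phi> i ^ Poly_Mapping.lookup m i))"
  unfolding psubst_def
  by (rule sum.mono_neutral_left) (use assms in \<open>auto simp: in_keys_iff cst_def\<close>)

lemma cst_add: "cst (a + b) = cst a + cst b"
  and cst_mult: "cst (a * b) = cst a * cst b"
  and cst_0 [simp]: "cst 0 = 0"
  and cst_1 [simp]: "cst 1 = 1"
  by (simp_all add: cst_def single_add mult_single)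

lemma psubst_add: "psubst \<phi> (f + g) = psubst \<phi> f + psubst \<phi> g"
proof -
  let ?S = "Poly_Mapping.keys f \<union> Poly_Mapping.keys g"
  have "Poly_Mapping.keys (f + g) \<subseteq> ?S" by (rule Poly_Mapping.keys_add)
  thus ?thesis
    by (simp add: psubst_superset[of ?S] lookup_add cst_add distrib_right sum.distrib)
qed

lemma psubst_0 [simp]: "psubst \<phi> 0 = 0"
  by (simp add: psubst_def)

lemma psubst_sum: "psubst \<phi> (sum f S) = (\<Sum>x\<in>S. psubst \<phi> (f x))"
  by (induction S rule: infinite_finite_induct) (simp_all add: psubst_add)

lemma psubst_single:
  "psubst \<phi> (Poly_Mapping.single m c) =
     cst c * (\<Prod>i\<in>Poly_Mapping.keys m. \<phi> i ^ Poly_Mapping.lookup m i)"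
  by (simp add: psubst_superset[of "{m}"])

lemma psubst_monomial_add:
  fixes \<phi> :: "nat \<Rightarrow> cpoly"
  shows "(\<Prod>i\<in>Poly_Mapping.keys (m + n). \<phi> i ^ Poly_Mapping.lookup (m + n) i) =
     (\<Prod>i\<in>Poly_Mapping.keys m. \<phi> i ^ Poly_Mapping.lookup m i) *
     (\<Prod>i\<in>Poly_Mapping.keys n. \<phi> i ^ Poly_Mapping.lookup n i)"
proof -
  let ?S = "Poly_Mapping.keys m \<union> Poly_Mapping.keys n"
  have *: "(\<Prod>i\<in>Poly_Mapping.keys p. \<phi> i ^ Poly_Mapping.lookup p i) =
           (\<Prod>i\<in>?S. \<phi> i ^ Poly_Mapping.lookup p i)" if "Poly_Mapping.keys p \<subseteq> ?S" for p
    by (rule prod.mono_neutral_left) (use that in \<open>auto simp: in_keys_iff\<close>)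
  show ?thesis
    by (subst (1 2 3) *) (auto simp: Poly_Mapping.keys_add lookup_add power_add prod.distrib)
qed

lemma sum_single: "(f :: cpoly) = (\<Sum>m\<in>Poly_Mapping.keys f. Poly_Mapping.single m (Poly_Mapping.lookup f m))"
  by (rule poly_mapping_eqI)
    (auto simp: lookup_sum lookup_single when_def in_keys_iff)

lemma psubst_mult: "psubst \<phi> (f * g) = psubst \<phi> f * psubst \<phi> g"
proof -
  have *: "psubst \<phi> (Poly_Mapping.single m c * Poly_Mapping.single n d) =
        psubst \<phi> (Poly_Mapping.single m c) * psubst \<phi> (Poly_Mapping.single n d)" for m n c d
    by (simp add: mult_single psubst_single psubst_monomial_add cst_mult mult_ac)
  let ?F = "\<lambda>f m. Poly_Mapping.single m (Poly_Mapping.lookup f m) :: cpoly"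
  have "psubst \<phi> ((\<Sum>m\<in>Poly_Mapping.keys f. ?F f m) * (\<Sum>m\<in>Poly_Mapping.keys g. ?F g m)) =
        psubst \<phi> (\<Sum>m\<in>Poly_Mapping.keys f. ?F f m) * psubst \<phi> (\<Sum>m\<in>Poly_Mapping.keys g. ?F g m)"
    by (simp only: psubst_sum sum_product *)
  thus ?thesis by (simp only: sum_single[symmetric])
qed

lemma psubst_cst [simp]: "psubst \<phi> (cst c) = cst c"
  unfolding cst_def by (simp add: psubst_single cst_def)

lemma psubst_1 [simp]: "psubst \<phi> 1 = 1"
  using psubst_cst[of \<phi> 1] by simp

lemma psubst_var [simp]: "psubst \<phi> (var i) = \<phi> i"
  by (simp add: var_def psubst_single)

lemma psubst_uminus: "psubst \<phi> (- f) = - psubst \<phi> f"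
  using psubst_add[of \<phi> f "- f"] by (simp add: eq_neg_iff_add_eq_0 add.commute)

lemma psubst_power: "psubst \<phi> (f ^ n) = psubst \<phi> f ^ n"
  by (induction n) (simp_all add: psubst_mult)

lemma lam_spec_psym: "lam_spec n (psym (Suc k)) = (\<Sum>j<n. var j ^ Suc k)"
  by (simp add: lam_spec_def psym_def)

lemmas lam_spec_hom =
  psubst_mult[of "\<lambda>i. \<Sum>j<n. var j ^ Suc i" for n, folded lam_spec_def]
  psubst_sum[of "\<lambda>i. \<Sum>j<n. var j ^ Suc i" for n, folded lam_spec_def]
  psubst_power[of "\<lambda>i. \<Sum>j<n. var j ^ Suc i" for n, folded lam_spec_def]
  psubst_uminus[of "\<lambda>i. \<Sum>j<n. var j ^ Suc i" for n, folded lam_spec_def]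
  psubst_cst[of "\<lambda>i. \<Sum>j<n. var j ^ Suc i" for n, folded lam_spec_def]
  psubst_1[of "\<lambda>i. \<Sum>j<n. var j ^ Suc i" for n, folded lam_spec_def]

lemma newton_unique:
  fixes a b p :: "nat \<Rightarrow> cpoly"
  assumes "a 0 = b 0"
    and "\<And>k. a (Suc k) = cst (1 / of_nat (Suc k)) * (\<Sum>i\<le>k. p i * a (k - i))"
    and "\<And>k. of_nat (Suc k) * b (Suc k) = (\<Sum>i\<le>k. p i * b (k - i))"
  shows "a k = b k"
proof (induction k rule: less_induct)
  case (less k)
  show ?case
  proof (cases k)
    case (Suc n)
    have c: "cst (1 / of_nat (Suc n)) * of_nat (Suc n) = 1"
      by (simp add: cst_def of_nat_single mult_single del: of_nat_Suc single_of_nat)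
    have "a k = cst (1 / of_nat (Suc n)) * (\<Sum>i\<le>n. p i * b (n - i))"
      unfolding Suc assms(2) using less.IH Suc by (intro arg_cong2[of _ _ _ _ times] sum.cong refl) auto
    also have "\<dots> = b k"
      unfolding assms(3)[symmetric] Suc by (simp add: mult.assoc[symmetric] c del: of_nat_Suc)
    finally show ?thesis .
  qed (use assms in simp)
qed

lemma fps_newton:
  fixes F P :: "cpoly fps"
  assumes "fps_deriv F = F * P"
  shows "of_nat (Suc k) * fps_nth F (Suc k) = (\<Sum>i\<le>k. fps_nth P i * fps_nth F (k - i))"
proof -
  have "of_nat (Suc k) * fps_nth F (Suc k) = fps_nth (P * F) k"
    using arg_cong[OF assms, of "\<lambda>F. fps_nth F k"] by (simp add: mult.commute del: of_nat_Suc)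
  thus ?thesis by (simp add: fps_mult_nth atLeast0AtMost)
qed

lemma lam_spec_esym:
  "Abs_fps (\<lambda>k. lam_spec n (esym k)) = (\<Prod>j<n. 1 + fps_const (var j) * fps_X)"
proof -
  let ?E = "\<lambda>n. (\<Prod>j<n. 1 + fps_const (var j) * fps_X)"
  let ?P = "\<lambda>n. \<Sum>j<n. Abs_fps (\<lambda>k. (-1) ^ k * var j ^ Suc k)"
  have geo: "(1 + fps_const x * fps_X) * Abs_fps (\<lambda>k. (-1) ^ k * x ^ Suc k) = fps_const x"
    for x :: cpoly
    by (rule fps_ext) (auto simp: distrib_right mult.assoc gr0_conv_Suc)
  have d: "fps_deriv (?E n) = ?E n * ?P n" for n
  proof (induction n)
    case (Suc n)
    let ?x = "fps_const (var n)" and ?g = "Abs_fps (\<lambda>k. (-1) ^ k * var n ^ Suc k)"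
    have "fps_deriv (?E (Suc n)) = ?E n * ?x + ?E n * ?P n * (1 + ?x * fps_X)"
      using Suc.IH by simp
    also have "\<dots> = ?E n * ((1 + ?x * fps_X) * ?g) + ?E n * ?P n * (1 + ?x * fps_X)"
      by (simp only: geo)
    also have "\<dots> = ?E (Suc n) * ?P (Suc n)"
      by (simp add: algebra_simps)
    finally show ?case .
  qed simp
  have "lam_spec n (esym k) = fps_nth (?E n) k" for k
  proof (rule newton_unique)
    show "lam_spec n (esym 0) = fps_nth (?E n) 0"
      by (induction n) (simp_all add: lam_spec_def)
  next
    fix k
    show "lam_spec n (esym (Suc k)) = cst (1 / of_nat (Suc k)) *
            (\<Sum>i\<le>k. fps_nth (?P n) i * lam_spec n (esym (k - i)))"
      by (simp add: lam_spec_hom lam_spec_psym fps_sum_nth sum_distrib_left del: of_nat_Suc power_Suc)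
  next
    fix k
    show "of_nat (Suc k) * fps_nth (?E n) (Suc k) =
            (\<Sum>i\<le>k. fps_nth (?P n) i * fps_nth (?E n) (k - i))"
      by (rule fps_newton[OF d])
  qed
  thus ?thesis by (intro fps_ext) simp
qed

lemma lam_spec_hsym:
  "Abs_fps (\<lambda>k. lam_spec n (hsym k)) = (\<Prod>j<n. Abs_fps (\<lambda>k. var j ^ k))"
proof -
  let ?H = "\<lambda>n. (\<Prod>j<n. Abs_fps (\<lambda>k. var j ^ k))"
  let ?P = "\<lambda>n. \<Sum>j<n. Abs_fps (\<lambda>k. var j ^ Suc k)"
  have geo: "fps_deriv (Abs_fps (\<lambda>k. x ^ k)) = Abs_fps (\<lambda>k. x ^ k) * Abs_fps (\<lambda>k. x ^ Suc k)"
    for x :: cpoly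
    by (rule fps_ext) (simp add: fps_mult_nth power_add[symmetric] flip: power_Suc)
  have d: "fps_deriv (?H n) = ?H n * ?P n" for n
  proof (induction n)
    case (Suc n)
    show ?case using Suc.IH
      by (simp add: geo algebra_simps del: power_Suc)
  qed simp
  have "lam_spec n (hsym k) = fps_nth (?H n) k" for k
  proof (rule newton_unique)
    show "lam_spec n (hsym 0) = fps_nth (?H n) 0"
      by (induction n) (simp_all add: lam_spec_def)
  next
    fix k
    show "lam_spec n (hsym (Suc k)) = cst (1 / of_nat (Suc k)) *
            (\<Sum>i\<le>k. fps_nth (?P n) i * lam_spec n (hsym (k - i)))"
      by (simp add: lam_spec_hom lam_spec_psym fps_sum_nth del: of_nat_Suc power_Suc)
  next
    fix k
    show "of_nat (Suc k) * fps_nth (?H n) (Suc k) =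
            (\<Sum>i\<le>k. fps_nth (?P n) i * fps_nth (?H n) (k - i))"
      by (rule fps_newton[OF d])
  qed
  thus ?thesis by (intro fps_ext) simp
qed


lemma lam_scalar_superset:
  assumes "finite S" "Poly_Mapping.keys f \<subseteq> S"
  shows "lam_scalar f g = (\<Sum>m\<in>S. Poly_Mapping.lookup f m * Poly_Mapping.lookup g m * zee m)"
  unfolding lam_scalar_def
  by (rule sum.mono_neutral_left) (use assms in \<open>auto simp: in_keys_iff\<close>)

lemma lam_scalar_add_left: "lam_scalar (f + g) k = lam_scalar f k + lam_scalar g k"
proof -
  let ?S = "Poly_Mapping.keys f \<union> Poly_Mapping.keys g"
  have "Poly_Mapping.keys (f + g) \<subseteq> ?S" by (rule Poly_Mapping.keys_add)
  thus ?thesis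
    by (simp add: lam_scalar_superset[of ?S] lookup_add distrib_right sum.distrib)
qed

lemma lam_scalar_commute: "lam_scalar f g = lam_scalar g f"
  using lam_scalar_superset[of "Poly_Mapping.keys f \<union> Poly_Mapping.keys g" f g]
    lam_scalar_superset[of "Poly_Mapping.keys f \<union> Poly_Mapping.keys g" g f]
  by (simp add: mult_ac)

lemma lam_scalar_sum_left: "lam_scalar (sum f S) k = (\<Sum>x\<in>S. lam_scalar (f x) k)"
  by (induction S rule: infinite_finite_induct)
    (simp_all add: lam_scalar_add_left, simp_all add: lam_scalar_def)

lemma lam_scalar_sum_right: "lam_scalar k (sum f S) = (\<Sum>x\<in>S. lam_scalar k (f x))"
  using lam_scalar_sum_left[of f S k] by (simp add: lam_scalar_commute[of k])

lemma lam_scalar_single: "lam_scalar f (Poly_Mapping.single n d) = Poly_Mapping.lookup f n * d * zee n"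
  by (subst lam_scalar_commute) (simp add: lam_scalar_superset[of "{n}"])

lemma zee_nonzero: "zee m \<noteq> 0"
  by (simp add: zee_def del: of_nat_Suc)

lemma perp_eqI:
  assumes "\<And>n. lam_scalar h (Poly_Mapping.single n 1) = lam_scalar g (f * Poly_Mapping.single n 1)"
  shows "perp f g = h"
  unfolding perp_def
proof (rule the_equality)
  have cs: "Poly_Mapping.single n c = cst c * Poly_Mapping.single n (1::complex)" for n c
    by (simp add: cst_def mult_single)
  have sc: "lam_scalar k (cst c * r) = c * lam_scalar k r" for k c r
  proof -
    have "Poly_Mapping.lookup (cst c * r) m = c * Poly_Mapping.lookup r m" for m
      by (simp add: cst_def flip: mult_map_scale_conv_mult) (simp add: map.rep_eq when_def)
    thus ?thesis by (simp add: lam_scalar_def sum_distrib_left mult_ac)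
  qed
  show "\<forall>k. lam_scalar h k = lam_scalar g (f * k)"
  proof
    fix k
    have "lam_scalar h (\<Sum>m\<in>Poly_Mapping.keys k. Poly_Mapping.single m (Poly_Mapping.lookup k m)) =
          lam_scalar g (f * (\<Sum>m\<in>Poly_Mapping.keys k. Poly_Mapping.single m (Poly_Mapping.lookup k m)))"
      unfolding sum_distrib_left lam_scalar_sum_right
      by (intro sum.cong refl, subst (1 2) cs) (simp add: sc assms mult.left_commute[of f])
    thus "lam_scalar h k = lam_scalar g (f * k)"
      by (simp only: sum_single[symmetric])
  qed
next
  fix h' assume h': "\<forall>k. lam_scalar h' k = lam_scalar g (f * k)"
  show "h' = h"
  proof (rule poly_mapping_eqI)
    fix n
    have "lam_scalar h' (Poly_Mapping.single n 1) = lam_scalar h (Poly_Mapping.single n 1)"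
      using h' assms by simp
    thus "Poly_Mapping.lookup h' n = Poly_Mapping.lookup h n"
      by (simp add: lam_scalar_single zee_nonzero)
  qed
qed

lemma zee_add_single:
  "zee (n + Poly_Mapping.single i 1) = of_nat (Suc i) * of_nat (Suc (Poly_Mapping.lookup n i)) * zee n"
proof -
  let ?S = "insert i (Poly_Mapping.keys n)"
  let ?z = "\<lambda>m i. of_nat (Suc i) ^ Poly_Mapping.lookup m i * fact (Poly_Mapping.lookup m i) :: complex"
  have z: "zee m = prod (?z m) ?S" if "Poly_Mapping.keys m \<subseteq> ?S" for m
    unfolding zee_def by (rule prod.mono_neutral_left) (use that in \<open>auto simp: in_keys_iff\<close>)
  have "zee (n + Poly_Mapping.single i 1) = prod (?z (n + Poly_Mapping.single i 1)) ?S"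
    by (rule z) (use Poly_Mapping.keys_add[of n "Poly_Mapping.single i 1"] in auto)
  also have "\<dots> = ?z (n + Poly_Mapping.single i 1) i * prod (?z (n + Poly_Mapping.single i 1)) (?S - {i})"
    by (subst prod.remove[of _ i]) auto
  also have "prod (?z (n + Poly_Mapping.single i 1)) (?S - {i}) = prod (?z n) (?S - {i})"
    by (intro prod.cong refl) (auto simp: lookup_add lookup_single when_def)
  also have "?z (n + Poly_Mapping.single i 1) i =
      of_nat (Suc i) * of_nat (Suc (Poly_Mapping.lookup n i)) * ?z n i"
    by (simp add: lookup_add algebra_simps)
  finally have "zee (n + Poly_Mapping.single i 1) =
      of_nat (Suc i) * of_nat (Suc (Poly_Mapping.lookup n i)) * (?z n i * prod (?z n) (?S - {i}))"
    by (simp only: mult.assoc)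
  also have "?z n i * prod (?z n) (?S - {i}) = prod (?z n) ?S"
    by (rule prod.remove[symmetric]) auto
  also have "\<dots> = zee n"
    by (rule z[symmetric]) auto
  finally show ?thesis .
qed

text \<open>The adjoint of multiplication by \<open>p\<^sub>n\<close> is \<open>n \<partial>/\<partial>p\<^sub>n\<close>.\<close>

lemma perp_psym:
  "perp (psym (Suc i)) g = (\<Sum>m\<in>Poly_Mapping.keys g.
     Poly_Mapping.single (m - Poly_Mapping.single i 1)
       (of_nat (Suc i) * of_nat (Poly_Mapping.lookup m i) * Poly_Mapping.lookup g m))"
  (is "_ = ?h")
proof (rule perp_eqI)
  fix n
  let ?e = "Poly_Mapping.single i 1 :: nat \<Rightarrow>\<^sub>0 nat"
  have iff: "m - ?e = n \<longleftrightarrow> m = n + ?e" if "Poly_Mapping.lookup m i \<noteq> 0" for m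
    using that by (auto simp: poly_mapping_eq_iff fun_eq_iff lookup_add lookup_minus lookup_single when_def)
  have "Poly_Mapping.lookup ?h n = (\<Sum>m\<in>Poly_Mapping.keys g. if m = n + ?e then
      of_nat (Suc i) * of_nat (Suc (Poly_Mapping.lookup n i)) * Poly_Mapping.lookup g (n + ?e) else 0)"
    unfolding lookup_sum
    by (intro sum.cong refl) (use iff in \<open>auto simp: lookup_single when_def lookup_add\<close>)
  also have "\<dots> = of_nat (Suc i) * of_nat (Suc (Poly_Mapping.lookup n i)) * Poly_Mapping.lookup g (n + ?e)"
    by (auto simp: in_keys_iff)
  finally show "lam_scalar ?h (Poly_Mapping.single n 1) =
      lam_scalar g (psym (Suc i) * Poly_Mapping.single n 1)"
    by (simp add: lam_scalar_single psym_def var_def mult_single add.commute[of _ n]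
          zee_add_single[unfolded One_nat_def]
        del: of_nat_Suc)
qed

end

theory Submission
  imports Defs "HOL-Combinatorics.Multiset_Permutations"
begin

text \<open>
  Write \<open>f \<mapsto> f[w]\<close> for the ring homomorphism \<open>p\<^sub>n \<mapsto> p\<^sub>n - w\<^sup>n\<close>. Since \<open>E\<^sup>\<bottom>(-u) f = f[1/u]\<close>, the vertex
  operator is \<open>\<Gamma>(u) f = Q(u) f[1/u]\<close>, and any linear combination of its coefficients is \<open>f \<mapsto> L(f[w])\<close>
  for a \<open>\<Lambda>\<close>-linear functional \<open>L\<close> on \<open>\<Lambda>[w]\<close>.

  Pfaffian formula: let \<open>L\<^sub>1, L\<^sub>2, \<dots>\<close> be such functionals and \<open>Q\<^sub>S\<close> the result of applying the operators
  in the list \<open>S\<close> to 1. Then \<open>Q\<^sub>S[w] - Q\<^sub>S = \<Sum>\<^sub>j \<plusminus> (Q\<^sub>j[w] - Q\<^sub>j) Q\<^bsub>S - j\<^esub>\<close>, by induction on \<open>S\<close>: the terms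
  quadratic in the differences cancel by antisymmetry, and the case of two operators follows from the
  recursion \<open>q\<^sub>a[w] + w q\<^bsub>a-1\<^esub>[w] = q\<^sub>a - w q\<^bsub>a-1\<^esub>\<close>. Applying one more functional
  expands \<open>Q\<^sub>S\<close> along its first entry, like a Pfaffian.

  Symmetrization formula: in finitely many variables the shift at \<open>w = x\<^sub>i\<close> removes the variable \<open>x\<^sub>i\<close>, and
  the partial fraction decomposition of \<open>Q(u) = \<Prod>\<^sub>i (1 + x\<^sub>i u) / (1 - x\<^sub>i u)\<close> turns \<open>\<Gamma>\<^bsub>-a\<^esub> f\<close>, \<open>a \<ge> 1\<close>, into
  \<open>2 \<Sum>\<^sub>i x\<^sub>i\<^sup>a \<Prod>\<^bsub>j \<noteq> i\<^esub> (x\<^sub>i + x\<^sub>j) / (x\<^sub>i - x\<^sub>j) f(x without x\<^sub>i)\<close>, which is iterated.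

  Inversion: the operators \<open>\<Gamma>\<^sub>j\<close> lower weights by \<open>j\<close>, so only finitely many \<open>j\<close> matter for a given
  monomial, and the infinite sum over a row of the inverse matrix may be exchanged with the sum over \<open>j\<close>.
\<close>

section \<open>Weights and induction over monomials\<close>

text \<open>Degree of a monomial in the variables x, since variable \<open>i\<close> is the power
  sum of degree \<open>i + 1\<close>. It is an induction measure here and later bounds which
  operators can reach a given monomial.\<close>

definition wt :: "(nat \<Rightarrow>\<^sub>0 nat) \<Rightarrow> nat" where
  "wt m = (\<Sum>i\<in>Poly_Mapping.keys m. Suc i * Poly_Mapping.lookup m i)"

lemma wt_superset:
  assumes "finite S" "Poly_Mapping.keys m \<subseteq> S"
  shows "wt m = (\<Sum>i\<in>S. Suc i * Poly_Mapping.lookup m i)"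
  unfolding wt_def by (rule sum.mono_neutral_left) (use assms in \<open>auto simp: in_keys_iff\<close>)

lemma wt_add: "wt (m + n) = wt m + wt n"
proof -
  let ?S = "Poly_Mapping.keys m \<union> Poly_Mapping.keys n"
  have "Poly_Mapping.keys (m + n) \<subseteq> ?S" by (rule Poly_Mapping.keys_add)
  thus ?thesis
    by (simp add: wt_superset[of ?S] lookup_add distrib_left sum.distrib del: mult_Suc)
qed

lemma wt_single [simp]: "wt (Poly_Mapping.single i k) = Suc i * k"
  by (simp add: wt_superset[of "{i}"] del: mult_Suc)

lemma wt_0 [simp]: "wt 0 = 0"
  by (simp add: wt_def)

text \<open>Monomials are built up one variable at a time, by induction on \<open>wt\<close>. With
  this rule, ring homomorphisms and derivations are compared by looking only at multiplication by
  one variable.\<close>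

lemma cpoly_induct [case_names cst var add]:
  assumes cst: "\<And>c. P (cst c)"
    and var: "\<And>i f. P f \<Longrightarrow> P (var i * f)"
    and add: "\<And>f g. P f \<Longrightarrow> P g \<Longrightarrow> P (f + g)"
  shows "P f"
proof -
  have single: "P (Poly_Mapping.single m c)" for m c
  proof (induction "wt m" arbitrary: m rule: less_induct)
    case less
    show ?case
    proof (cases "m = 0")
      case True
      thus ?thesis using cst[of c] by (simp add: cst_def)
    next
      case False
      then obtain i where i: "Poly_Mapping.lookup m i \<noteq> 0"
        by (metis poly_mapping_eqI lookup_zero)
      define n where "n = m - Poly_Mapping.single i 1"
      have m: "m = Poly_Mapping.single i 1 + n"
        by (rule poly_mapping_eqI)
          (use i in \<open>auto simp: n_def lookup_add lookup_minus lookup_single when_def\<close>)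
      have "wt n < wt m" by (simp add: m wt_add)
      hence "P (var i * Poly_Mapping.single n c)" by (intro var less)
      thus ?thesis by (simp add: var_def mult_single m)
    qed
  qed
  have "P (\<Sum>m\<in>S. Poly_Mapping.single m (Poly_Mapping.lookup f m))" if "finite S" for S
    using that by (induction S) (use cst[of 0] in \<open>auto intro: add single\<close>)
  from this[OF finite_keys[of f]] show ?thesis by (simp only: sum_single[symmetric])
qed

lemma lookup_cst_mult [simp]: "Poly_Mapping.lookup (cst c * f) m = c * Poly_Mapping.lookup f m"
  by (simp add: cst_def flip: mult_map_scale_conv_mult) (simp add: map.rep_eq when_def)

lemma cst_of_nat: "cst (of_nat n) = of_nat n"
  by (induction n) (simp_all add: cst_add)

lemma cst_uminus: "cst (- c) = - cst c"
  by (rule poly_mapping_eqI) (simp add: cst_def lookup_single when_def)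

lemma cst_eq_0_iff [simp]: "cst c = 0 \<longleftrightarrow> c = 0"
proof
  assume "cst c = 0"
  hence "Poly_Mapping.lookup (cst c) 0 = 0" by simp
  thus "c = 0" by (simp add: cst_def)
qed simp

lemma cpoly_of_nat_cancel:
  assumes "of_nat (Suc k) * f = of_nat (Suc k) * (g :: cpoly)"
  shows "f = g"
proof -
  have "cst (1 / of_nat (Suc k)) * (cst (of_nat (Suc k)) * f) =
        cst (1 / of_nat (Suc k)) * (cst (of_nat (Suc k)) * g)"
    using assms by (simp only: cst_of_nat)
  thus ?thesis
    by (simp add: mult.assoc[symmetric] del: of_nat_Suc flip: cst_mult)
qed

section \<open>The shift of the power sums\<close>

definition shift_var :: "nat \<Rightarrow> Lam poly" where
  "shift_var i = [:var i:] - monom 1 (Suc i)"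

text \<open>The variable of the polynomial \<open>shift f\<close> is \<open>w = 1/u\<close>; see \<open>perp_esym\<close>.\<close>

definition shift :: "Lam \<Rightarrow> Lam poly" where
  "shift f = (\<Sum>m\<in>Poly_Mapping.keys f. [:cst (Poly_Mapping.lookup f m):] *
     (\<Prod>i\<in>Poly_Mapping.keys m. shift_var i ^ Poly_Mapping.lookup m i))"

lemma shift_superset:
  assumes "finite S" "Poly_Mapping.keys f \<subseteq> S"
  shows "shift f = (\<Sum>m\<in>S. [:cst (Poly_Mapping.lookup f m):] *
     (\<Prod>i\<in>Poly_Mapping.keys m. shift_var i ^ Poly_Mapping.lookup m i))"
  unfolding shift_def
  by (rule sum.mono_neutral_left) (use assms in \<open>auto simp: in_keys_iff\<close>)

lemma shift_add: "shift (f + g) = shift f + shift g"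
proof -
  let ?S = "Poly_Mapping.keys f \<union> Poly_Mapping.keys g"
  have "Poly_Mapping.keys (f + g) \<subseteq> ?S" by (rule Poly_Mapping.keys_add)
  thus ?thesis
    by (simp add: shift_superset[of ?S] lookup_add cst_add smult_add_left sum.distrib)
qed

lemma shift_single:
  "shift (Poly_Mapping.single m c) =
     [:cst c:] * (\<Prod>i\<in>Poly_Mapping.keys m. shift_var i ^ Poly_Mapping.lookup m i)"
  by (simp add: shift_superset[of "{m}"])

lemma shift_cst [simp]: "shift (cst c) = [:cst c:]"
  by (simp add: cst_def shift_single)

lemma shift_0 [simp]: "shift 0 = 0"
  using shift_cst[of 0] by simp

lemma shift_1 [simp]: "shift 1 = 1"
  using shift_cst[of 1] by (simp add: one_pCons)

lemma shift_var [simp]: "shift (var i) = shift_var i"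
  by (simp add: var_def shift_single)

lemma shift_sum: "shift (sum f S) = (\<Sum>x\<in>S. shift (f x))"
  by (induction S rule: infinite_finite_induct) (simp_all add: shift_add)

text \<open>\<open>psubst_mult\<close> does not apply, because \<open>shift\<close> takes values in
  \<open>Lam poly\<close> instead of \<open>cpoly\<close>; the argument is the same.\<close>

lemma shift_mult: "shift (f * g) = shift f * shift g"
proof -
  have mon: "(\<Prod>i\<in>Poly_Mapping.keys (m + n). shift_var i ^ Poly_Mapping.lookup (m + n) i) =
     (\<Prod>i\<in>Poly_Mapping.keys m. shift_var i ^ Poly_Mapping.lookup m i) *
     (\<Prod>i\<in>Poly_Mapping.keys n. shift_var i ^ Poly_Mapping.lookup n i)" for m n
  proof -
    let ?S = "Poly_Mapping.keys m \<union> Poly_Mapping.keys n"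
    have *: "(\<Prod>i\<in>Poly_Mapping.keys p. shift_var i ^ Poly_Mapping.lookup p i) =
             (\<Prod>i\<in>?S. shift_var i ^ Poly_Mapping.lookup p i)" if "Poly_Mapping.keys p \<subseteq> ?S" for p
      by (rule prod.mono_neutral_left) (use that in \<open>auto simp: in_keys_iff\<close>)
    show ?thesis
      by (subst (1 2 3) *) (auto simp: Poly_Mapping.keys_add lookup_add power_add prod.distrib)
  qed
  have *: "shift (Poly_Mapping.single m c * Poly_Mapping.single n d) =
        shift (Poly_Mapping.single m c) * shift (Poly_Mapping.single n d)" for m n c d
    by (simp add: mult_single shift_single mon cst_mult mult_ac)
  let ?F = "\<lambda>f m. Poly_Mapping.single m (Poly_Mapping.lookup f m) :: cpoly"
  have "shift ((\<Sum>m\<in>Poly_Mapping.keys f. ?F f m) * (\<Sum>m\<in>Poly_Mapping.keys g. ?F g m)) =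
        shift (\<Sum>m\<in>Poly_Mapping.keys f. ?F f m) * shift (\<Sum>m\<in>Poly_Mapping.keys g. ?F g m)"
    by (simp only: shift_sum sum_product *)
  thus ?thesis by (simp only: sum_single[symmetric])
qed

lemma shift_cst_mult: "shift (cst c * f) = smult (cst c) (shift f)"
  by (simp add: shift_mult)

lemma shift_uminus: "shift (- f) = - shift f"
  using shift_add[of f "- f"] by (simp add: eq_neg_iff_add_eq_0 add.commute)

lemma shift_diff: "shift (f - g) = shift f - shift g"
  using shift_add[of f "- g"] by (simp add: shift_uminus)

section \<open>The adjoints of the power sums\<close>

text \<open>Only one monomial of \<open>f\<close> contributes to \<open>n\<close>. In this form the
  linearity of \<open>perp\<close>, hidden by its definition with \<open>THE\<close>, becomes
  visible.\<close>

lemma lookup_perp_psym: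
  "Poly_Mapping.lookup (perp (psym (Suc i)) f) n =
     of_nat (Suc i) * of_nat (Suc (Poly_Mapping.lookup n i)) *
     Poly_Mapping.lookup f (n + Poly_Mapping.single i 1)"
proof -
  let ?e = "Poly_Mapping.single i 1 :: nat \<Rightarrow>\<^sub>0 nat"
  have iff: "m - ?e = n \<longleftrightarrow> m = n + ?e" if "Poly_Mapping.lookup m i \<noteq> 0" for m
    using that by (auto simp: poly_mapping_eq_iff fun_eq_iff lookup_add lookup_minus lookup_single when_def)
  have "Poly_Mapping.lookup (perp (psym (Suc i)) f) n = (\<Sum>m\<in>Poly_Mapping.keys f. if m = n + ?e then
      of_nat (Suc i) * of_nat (Suc (Poly_Mapping.lookup n i)) * Poly_Mapping.lookup f (n + ?e) else 0)"
    unfolding lookup_sum perp_psym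
    by (intro sum.cong refl) (use iff in \<open>auto simp: lookup_single when_def lookup_add\<close>)
  thus ?thesis by (auto simp: in_keys_iff)
qed

lemma perp_psym_add: "perp (psym (Suc i)) (f + g) = perp (psym (Suc i)) f + perp (psym (Suc i)) g"
  by (rule poly_mapping_eqI) (simp add: lookup_perp_psym lookup_add distrib_left)

lemma perp_psym_single:
  "perp (psym (Suc i)) (Poly_Mapping.single m c) =
     Poly_Mapping.single (m - Poly_Mapping.single i 1)
       (of_nat (Suc i) * of_nat (Poly_Mapping.lookup m i) * c)"
  by (cases "c = 0") (simp_all add: perp_psym)

lemma perp_psym_cst [simp]: "perp (psym (Suc i)) (cst c) = 0"
  unfolding cst_def perp_psym_single by simp

text \<open>Leibniz rule for the derivation (i + 1) d/dp_(i+1), checked on monomials.\<close>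

lemma perp_psym_var_mult:
  "perp (psym (Suc i)) (var j * f) =
     (if i = j then of_nat (Suc i) * f else 0) + var j * perp (psym (Suc i)) f"
proof -
  have s: "perp (psym (Suc i)) (var j * Poly_Mapping.single m c) =
     (if i = j then of_nat (Suc i) * Poly_Mapping.single m c else 0) +
     var j * perp (psym (Suc i)) (Poly_Mapping.single m c)" for m c
  proof -
    let ?e = "\<lambda>i. Poly_Mapping.single i 1 :: nat \<Rightarrow>\<^sub>0 nat"
    have eq: "?e j + m - ?e i = (if i = j then m else ?e j + (m - ?e i))"
      if "i = j \<or> Poly_Mapping.lookup m i \<noteq> 0"
      using that by (intro poly_mapping_eqI) (auto simp: lookup_add lookup_minus lookup_single when_def)
    have eq': "?e j + (m - ?e j) = m" if "Poly_Mapping.lookup m j \<noteq> 0"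
      using that by (intro poly_mapping_eqI) (auto simp: lookup_add lookup_minus lookup_single when_def)
    have v: "var j * Poly_Mapping.single n d = Poly_Mapping.single (?e j + n) d" for n and d :: complex
      by (simp add: var_def mult_single)
    have o: "of_nat (Suc i) * Poly_Mapping.single m c = Poly_Mapping.single m (of_nat (Suc i) * c)"
      unfolding cst_of_nat[symmetric] cst_def mult_single by simp
    show ?thesis
    proof (cases "i = j")
      case True
      show ?thesis
      proof (cases "Poly_Mapping.lookup m j = 0")
        case l: True
        thus ?thesis unfolding v perp_psym_single o using True eq
          by (simp add: lookup_add v)
      next
        case l: False
        thus ?thesis unfolding v perp_psym_single o using True eq eq'
          by (simp add: lookup_add distrib_right distrib_left flip: single_add)
      qed
    next
      case False
      show ?thesis
      proof (cases "Poly_Mapping.lookup m i = 0")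
        case l: True
        thus ?thesis unfolding v perp_psym_single using False
          by (simp add: lookup_add lookup_single v)
      next
        case l: False
        thus ?thesis unfolding v perp_psym_single using False eq
          by (simp add: lookup_add lookup_single v)
      qed
    qed
  qed
  have "perp (psym (Suc i)) (var j * (\<Sum>m\<in>S. Poly_Mapping.single m (Poly_Mapping.lookup f m))) =
     (if i = j then of_nat (Suc i) * (\<Sum>m\<in>S. Poly_Mapping.single m (Poly_Mapping.lookup f m)) else 0) +
     var j * perp (psym (Suc i)) (\<Sum>m\<in>S. Poly_Mapping.single m (Poly_Mapping.lookup f m))"
    if "finite S" for S
    using that
  proof induction
    case empty
    thus ?case using perp_psym_cst[of i 0] by simp
  next
    case (insert x F)
    thus ?case
      by (simp add: perp_psym_add distrib_left s del: of_nat_Suc)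
  qed
  from this[OF finite_keys[of f]] show ?thesis by (simp only: sum_single[symmetric])
qed

lemma lam_scalar_cst_right: "lam_scalar k (cst c * r) = c * lam_scalar k r"
  by (simp add: lam_scalar_def sum_distrib_left mult.assoc mult.left_commute[of _ c])

lemma lam_scalar_cst_left: "lam_scalar (cst c * r) k = c * lam_scalar r k"
  by (simp add: lam_scalar_commute[of _ k] lam_scalar_cst_right)

lemma lam_scalar_perp_psym:
  "lam_scalar (perp (psym (Suc i)) f) h = lam_scalar f (psym (Suc i) * h)"
proof -
  have s: "lam_scalar (perp (psym (Suc i)) f) (Poly_Mapping.single n c) =
           lam_scalar f (psym (Suc i) * Poly_Mapping.single n c)" for n c
    unfolding lam_scalar_single lookup_perp_psym
    by (simp add: lam_scalar_single psym_def var_def mult_single add.commute[of _ n]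
          zee_add_single[unfolded One_nat_def] del: of_nat_Suc)
  have "lam_scalar (perp (psym (Suc i)) f) (\<Sum>m\<in>Poly_Mapping.keys h. Poly_Mapping.single m (Poly_Mapping.lookup h m)) =
      lam_scalar f (psym (Suc i) * (\<Sum>m\<in>Poly_Mapping.keys h. Poly_Mapping.single m (Poly_Mapping.lookup h m)))"
    unfolding sum_distrib_left lam_scalar_sum_right by (intro sum.cong refl s)
  thus ?thesis by (simp only: sum_single[symmetric])
qed

section \<open>The shift and the adjoints of the elementary symmetric functions\<close>

lemma coeff_shift_0: "coeff (shift f) 0 = f"
  by (induction f rule: cpoly_induct)
    (simp_all add: shift_add shift_mult shift_var_def coeff_mult)

lemma coeff_shift_var_mult:
  "coeff (shift (var j * f)) k =
     var j * coeff (shift f) k - (if Suc j \<le> k then coeff (shift f) (k - Suc j) else 0)"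
  by (simp add: shift_mult shift_var_def left_diff_distrib coeff_monom_mult)

lemma coeff_shift_of_nat_mult: "coeff (shift (of_nat n * f)) k = of_nat n * coeff (shift f) k"
  by (simp add: shift_cst_mult flip: cst_of_nat)

text \<open>Formally the shift is the exponential of minus the sum over n of w^n / n times the
  adjoint of p_n. Taking the coefficient of w^k in its derivative with respect to w gives this
  recursion.\<close>

lemma coeff_shift_Suc:
  "of_nat (Suc k) * coeff (shift f) (Suc k) =
     - (\<Sum>i\<le>k. coeff (shift (perp (psym (Suc i)) f)) (k - i))"
proof (induction f arbitrary: k rule: cpoly_induct)
  case (add f g)
  thus ?case by (simp add: shift_add perp_psym_add sum.distrib distrib_left del: of_nat_Suc)
next
  case (var j f)
  let ?c = "coeff (shift f)" and ?d = "\<lambda>i. coeff (shift (perp (psym (Suc i)) f))"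
  let ?S = "\<Sum>i\<le>k. if Suc j \<le> k - i then ?d i (k - i - Suc j) else 0"
  \<comment> \<open>Only the indices i with i + Suc j at most k contribute, and their sum is the
    induction hypothesis at \<open>k - Suc j\<close>.\<close>
  have S: "?S = - (if Suc j \<le> k then of_nat (k - j) * ?c (k - j) else 0)"
  proof (cases "Suc j \<le> k")
    case True
    have "?S = (\<Sum>i\<le>k - Suc j. ?d i (k - Suc j - i))"
      using True by (intro sum.mono_neutral_cong_right) (auto intro!: arg_cong2[of _ _ _ _ coeff])
    also have "\<dots> = - (of_nat (Suc (k - Suc j)) * ?c (Suc (k - Suc j)))"
      by (simp add: var del: of_nat_Suc)
    also have "Suc (k - Suc j) = k - j" using True by simp
    finally show ?thesis using True by simp
  next
    case False
    thus ?thesis by (simp) (auto intro!: sum.neutral)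
  qed
  have "(\<Sum>i\<le>k. coeff (shift (perp (psym (Suc i)) (var j * f))) (k - i)) =
        (\<Sum>i\<le>k. (if i = j then of_nat (Suc i) * ?c (k - i) else 0) +
              (var j * ?d i (k - i) - (if Suc j \<le> k - i then ?d i (k - i - Suc j) else 0)))"
    by (intro sum.cong refl)
      (simp add: perp_psym_var_mult shift_add coeff_shift_var_mult coeff_shift_of_nat_mult del: of_nat_Suc)
  also have "\<dots> = (if j \<le> k then of_nat (Suc j) * ?c (k - j) else 0) +
      (var j * (\<Sum>i\<le>k. ?d i (k - i)) - ?S)"
    by (simp add: sum.distrib sum_subtractf sum_distrib_left del: of_nat_Suc)
  also have "\<dots> = (if j \<le> k then of_nat (Suc k) * ?c (k - j) else 0) -
      var j * (of_nat (Suc k) * ?c (Suc k))"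
  proof -
    \<comment> \<open>The factors \<open>Suc j\<close> and \<open>k - j\<close> add up to
      \<open>Suc k\<close>. For \<open>j = k\<close> the second factor is 0, which fits the stricter
      condition of the second term.\<close>
    have "(if j \<le> k then of_nat (Suc j) * ?c (k - j) else 0) +
          (if Suc j \<le> k then of_nat (k - j) * ?c (k - j) else 0) =
          (if j \<le> k then of_nat (Suc k) * ?c (k - j) else 0)"
      by (auto simp: algebra_simps not_le not_less_eq_eq of_nat_diff)
    thus ?thesis unfolding S var by (simp add: algebra_simps)
  qed
  finally have *: "(\<Sum>i\<le>k. coeff (shift (perp (psym (Suc i)) (var j * f))) (k - i)) = \<dots>" .
  show ?case unfolding * coeff_shift_var_mult by (auto simp: algebra_simps)
qed simp

lemma esym_newton: "of_nat (Suc k) * esym (Suc k) = (\<Sum>i\<le>k. (-1) ^ i * psym (Suc i) * esym (k - i))"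
proof -
  have "of_nat (Suc k) * cst (1 / of_nat (Suc k)) = 1"
    by (simp flip: cst_of_nat cst_mult del: of_nat_Suc)
  thus ?thesis by (simp add: mult.assoc[symmetric] del: of_nat_Suc)
qed

lemma hsym_newton: "of_nat (Suc k) * hsym (Suc k) = (\<Sum>i\<le>k. psym (Suc i) * hsym (k - i))"
proof -
  have "of_nat (Suc k) * cst (1 / of_nat (Suc k)) = 1"
    by (simp flip: cst_of_nat cst_mult del: of_nat_Suc)
  thus ?thesis by (simp add: mult.assoc[symmetric] del: of_nat_Suc)
qed

lemma lam_scalar_uminus_left: "lam_scalar (- f) k = - lam_scalar f k"
  using lam_scalar_cst_left[of "-1" f k] by (simp add: cst_uminus)

lemma lam_scalar_of_nat_left: "lam_scalar (of_nat n * f) k = of_nat n * lam_scalar f k"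
  using lam_scalar_cst_left[of "of_nat n" f k] by (simp add: cst_of_nat)

lemma lam_scalar_of_nat_right: "lam_scalar k (of_nat n * f) = of_nat n * lam_scalar k f"
  using lam_scalar_cst_right[of k "of_nat n" f] by (simp add: cst_of_nat)

lemma lam_scalar_sign_right: "lam_scalar k ((-1) ^ n * f) = (-1) ^ n * lam_scalar k f"
proof -
  have "cst ((-1) ^ n) = (-1) ^ n" by (induction n) (simp_all add: cst_mult cst_uminus)
  thus ?thesis using lam_scalar_cst_right[of k "(-1) ^ n" f] by simp
qed

text \<open>Both sides satisfy the same recursion in \<open>k\<close>:
  \<open>coeff_shift_Suc\<close> on the left and \<open>esym_newton\<close> on the right, with each
  power sum moved across the scalar product. \<open>f\<close> varies in the induction because the
  recursion replaces it by its images under the adjoints.\<close>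

lemma lam_scalar_coeff_shift:
  "lam_scalar (coeff (shift f) k) h = (-1) ^ k * lam_scalar f (esym k * h)"
proof (induction k arbitrary: f h rule: less_induct)
  case (less k)
  show ?case
  proof (cases k)
    case 0
    thus ?thesis by (simp add: coeff_shift_0)
  next
    case (Suc n)
    let ?p = "\<lambda>i. psym (Suc i)"
    have "of_nat (Suc n) * lam_scalar (coeff (shift f) (Suc n)) h =
          - (\<Sum>i\<le>n. lam_scalar (coeff (shift (perp (?p i) f)) (n - i)) h)"
      by (simp only: lam_scalar_of_nat_left[symmetric] coeff_shift_Suc lam_scalar_uminus_left
          lam_scalar_sum_left)
    also have "\<dots> = - (\<Sum>i\<le>n. (-1) ^ (n - i) * lam_scalar f (?p i * (esym (n - i) * h)))"
      using Suc by (simp add: less.IH lam_scalar_perp_psym)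
    also have "\<dots> = (\<Sum>i\<le>n. (-1) ^ Suc n * lam_scalar f ((-1) ^ i * ?p i * esym (n - i) * h))"
      unfolding sum_negf[symmetric]
    proof (intro sum.cong refl)
      fix i assume "i \<in> {..n}"
      hence "(-1) ^ Suc n * (-1 :: complex) ^ i = - ((-1) ^ (n - i))"
        by (auto simp: minus_one_power_iff)
      thus "- ((-1) ^ (n - i) * lam_scalar f (?p i * (esym (n - i) * h))) =
            (-1) ^ Suc n * lam_scalar f ((-1) ^ i * ?p i * esym (n - i) * h)"
        by (simp only: mult.assoc lam_scalar_sign_right) (simp add: mult.assoc[symmetric])
    qed
    also have "\<dots> = (-1) ^ Suc n * lam_scalar f (of_nat (Suc n) * esym (Suc n) * h)"
      unfolding esym_newton by (simp only: sum_distrib_left sum_distrib_right lam_scalar_sum_right)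
    also have "\<dots> = of_nat (Suc n) * ((-1) ^ Suc n * lam_scalar f (esym (Suc n) * h))"
      by (simp only: mult.assoc lam_scalar_of_nat_right) (simp only: mult.left_commute)
    finally show ?thesis
      unfolding Suc by (simp only: mult_cancel_left of_nat_eq_0_iff) simp
  qed
qed

lemma perp_esym: "perp (esym k) f = (-1) ^ k * coeff (shift f) k"
proof (rule perp_eqI)
  fix n
  have "lam_scalar ((-1) ^ k * coeff (shift f) k) (Poly_Mapping.single n 1) =
        (-1) ^ k * lam_scalar (coeff (shift f) k) (Poly_Mapping.single n 1)"
    by (simp only: lam_scalar_commute[of _ "Poly_Mapping.single n 1"] lam_scalar_sign_right)
  also have "\<dots> = ((-1) ^ k * (-1) ^ k) * lam_scalar f (esym k * Poly_Mapping.single n 1)"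
    by (simp only: lam_scalar_coeff_shift mult.assoc)
  also have "(-1) ^ k * (-1) ^ k = (1 :: complex)"
    by (simp flip: power_mult_distrib)
  finally show "lam_scalar ((-1) ^ k * coeff (shift f) k) (Poly_Mapping.single n 1) =
      lam_scalar f (esym k * Poly_Mapping.single n 1)" by simp
qed

section \<open>Linear functionals\<close>

text \<open>The module homomorphism that sends w^k to \<open>s k\<close>; every linear functional on
  the polynomials in w has this form.\<close>

definition lin :: "(nat \<Rightarrow> 'a::comm_ring_1) \<Rightarrow> 'a poly \<Rightarrow> 'a" where
  "lin s p = (\<Sum>k\<le>degree p. s k * coeff p k)"

lemma lin_superset:
  assumes "degree p \<le> N"
  shows "lin s p = (\<Sum>k\<le>N. s k * coeff p k)"
  unfolding lin_def
  by (rule sum.mono_neutral_left) (use assms in \<open>auto simp: coeff_eq_0\<close>)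

lemma lin_add: "lin s (p + q) = lin s p + lin s q"
  by (simp add: lin_superset[of _ "max (degree p) (degree q)"] degree_add_le_max distrib_left sum.distrib)

lemma lin_smult: "lin s (smult c p) = c * lin s p"
  by (simp add: lin_superset[of _ "degree p"] degree_smult_le sum_distrib_left mult_ac)

lemma lin_0 [simp]: "lin s 0 = 0"
  by (simp add: lin_def)

lemma lin_uminus: "lin s (- p) = - lin s p"
  using lin_add[of s p "- p"] by (simp add: eq_neg_iff_add_eq_0 add.commute)

lemma lin_diff: "lin s (p - q) = lin s p - lin s q"
  using lin_add[of s p "- q"] by (simp add: lin_uminus)

lemma lin_sum: "lin s (sum f S) = (\<Sum>x\<in>S. lin s (f x))"
  by (induction S rule: infinite_finite_induct) (simp_all add: lin_add)

lemma lin_pCons: "lin s (pCons a p) = s 0 * a + lin (\<lambda>k. s (Suc k)) p"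
  by (simp add: lin_superset[of "pCons a p" "Suc (degree p)"] lin_superset[of p "degree p"] degree_pCons_le
      sum.atMost_Suc_shift del: sum.atMost_Suc)

lemma lin_1 [simp]: "lin s 1 = s 0"
  by (simp add: lin_def)

text \<open>\<open>gam a p\<close> is the coefficient of \<open>u ^ a\<close> in \<open>Q(u) p(1/u)\<close>.\<close>

definition gam :: "int \<Rightarrow> Lam poly \<Rightarrow> Lam" where
  "gam a = lin (\<lambda>k. qsym (a + int k))"

text \<open>The sign (-1)^k from the argument -u cancels against the one in
  \<open>perp_esym\<close>.\<close>

lemma Gamma_ser_eq_gam: "Gamma_ser f m = gam m (shift f)"
proof -
  have "Gamma_ser f m = Sum_any (\<lambda>k. qsym (m + int k) * coeff (shift f) k)"
    unfolding Gamma_ser_def perp_esym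
    by (intro arg_cong[of _ _ Sum_any] ext)
      (simp add: minus_one_power_iff)
  also have "\<dots> = gam m (shift f)"
    unfolding gam_def lin_def
    by (rule Sum_any.expand_superset) (auto intro: le_degree)
  finally show ?thesis .
qed

lemma gam_pCons_0: "gam a (pCons 0 p) = gam (a + 1) p"
  by (simp add: gam_def lin_pCons algebra_simps)

section \<open>The shift of \<open>qsym\<close>\<close>

lemma lam_poly_of_nat_cancel:
  assumes "of_nat (Suc k) * f = of_nat (Suc k) * (g :: Lam poly)"
  shows "f = g"
proof (rule poly_eqI)
  fix n
  have c: "coeff (of_nat m * h) n = of_nat m * coeff h n" for m and h :: "Lam poly"
    by (simp add: of_nat_poly)
  show "coeff f n = coeff g n"
    by (rule cpoly_of_nat_cancel[of k]) (simp only: c[symmetric] assms)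
qed

lemma fps_newton_general:
  fixes F P :: "'a :: comm_ring_1 fps"
  assumes "fps_deriv F = F * P"
  shows "of_nat (Suc k) * fps_nth F (Suc k) = (\<Sum>i\<le>k. fps_nth P i * fps_nth F (k - i))"
proof -
  have "of_nat (Suc k) * fps_nth F (Suc k) = fps_nth (P * F) k"
    using arg_cong[OF assms, of "\<lambda>F. fps_nth F k"] by (simp add: mult.commute del: of_nat_Suc)
  thus ?thesis by (simp add: fps_mult_nth atLeast0AtMost)
qed

lemma fps_newtonI:
  fixes F P :: "'a :: comm_ring_1 fps"
  assumes "\<And>k. of_nat (Suc k) * fps_nth F (Suc k) = (\<Sum>i\<le>k. fps_nth P i * fps_nth F (k - i))"
  shows "fps_deriv F = F * P"
proof (rule fps_ext)
  fix k
  have "fps_nth (fps_deriv F) k = fps_nth (P * F) k"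
    using assms[of k] by (simp add: fps_mult_nth atLeast0AtMost del: of_nat_Suc)
  thus "fps_nth (fps_deriv F) k = fps_nth (F * P) k" by (simp add: mult.commute)
qed

text \<open>The equation F' = F P determines every coefficient of F from the constant one, because
  positive integers can be cancelled in \<open>Lam poly\<close>.\<close>

lemma fps_deriv_eq_unique:
  fixes F G P :: "Lam poly fps"
  assumes "fps_deriv F = F * P" "fps_deriv G = G * P" "fps_nth F 0 = fps_nth G 0"
  shows "F = G"
proof (rule fps_ext)
  show "fps_nth F k = fps_nth G k" for k
  proof (induction k rule: less_induct)
    case (less k)
    show ?case
    proof (cases k)
      case (Suc n)
      have "of_nat (Suc n) * fps_nth F (Suc n) = of_nat (Suc n) * fps_nth G (Suc n)"
        unfolding fps_newton_general[OF assms(1)] fps_newton_general[OF assms(2)]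
        using less Suc by (intro sum.cong refl) auto
      thus ?thesis unfolding Suc by (rule lam_poly_of_nat_cancel)
    qed (use assms(3) in simp)
  qed
qed

definition ww :: "Lam poly" where "ww = [:0, 1:]"

lemma ww_mult: "ww * p = pCons 0 p"
  by (simp add: ww_def)

definition cfps :: "Lam fps \<Rightarrow> Lam poly fps" where
  "cfps F = Abs_fps (\<lambda>k. [:fps_nth F k:])"

definition sfps :: "Lam fps \<Rightarrow> Lam poly fps" where
  "sfps F = Abs_fps (\<lambda>k. shift (fps_nth F k))"

lemma sum_const_poly: "(\<Sum>x\<in>S. [:f x:]) = [:\<Sum>x\<in>S. f x:]"
  by (induction S rule: infinite_finite_induct) simp_all

lemma cfps_mult: "cfps (F * G) = cfps F * cfps G"
  by (rule fps_ext) (simp add: cfps_def fps_mult_nth sum_const_poly[symmetric] mult.commute[of "fps_nth G _"])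

lemma sfps_mult: "sfps (F * G) = sfps F * sfps G"
  by (rule fps_ext) (simp add: sfps_def fps_mult_nth shift_sum shift_mult)

lemma cfps_deriv: "fps_deriv (cfps F) = cfps (fps_deriv F)"
  by (rule fps_ext) (simp add: cfps_def of_nat_poly del: of_nat_Suc)

lemma shift_of_nat: "shift (of_nat n) = of_nat n"
  by (simp flip: cst_of_nat) (simp add: cst_of_nat of_nat_poly)

lemma sfps_deriv: "fps_deriv (sfps F) = sfps (fps_deriv F)"
  by (rule fps_ext) (simp add: sfps_def shift_mult shift_of_nat del: of_nat_Suc)

lemma shift_psym: "shift (psym (Suc i)) = [:psym (Suc i):] - ww ^ Suc i"
proof -
  have "monom 1 n = ww ^ n" for n
    by (induction n) (simp_all add: monom_Suc one_pCons monom_0 ww_mult)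
  thus ?thesis by (simp add: psym_def shift_var_def)
qed

text \<open>Under the shift the logarithmic derivative of H(u) loses w / (1 - w u), which is minus
  the logarithmic derivative of 1 - w u. Hence both sides solve the same equation F' = F *
  \<open>sfps P\<close>.\<close>

lemma sfps_hsym: "sfps (Abs_fps hsym) = (1 - fps_const ww * fps_X) * cfps (Abs_fps hsym)"
proof -
  define P where "P = Abs_fps (\<lambda>i. psym (Suc i))"
  define W where "W = Abs_fps (\<lambda>i. ww ^ Suc i)"
  have H: "fps_deriv (Abs_fps hsym) = Abs_fps hsym * P"
    by (rule fps_newtonI) (simp only: fps_nth_Abs_fps hsym_newton P_def)
  have sP: "sfps P = cfps P - W"
    by (rule fps_ext) (simp only: sfps_def cfps_def P_def W_def fps_nth_Abs_fps fps_sub_nth shift_psym)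
  have W: "(1 - fps_const ww * fps_X) * W = fps_const ww"
    unfolding W_def
    by (rule fps_ext) (auto simp: left_diff_distrib mult.assoc gr0_conv_Suc)
  let ?H = "cfps (Abs_fps hsym)"
  show ?thesis
  proof (rule fps_deriv_eq_unique)
    show "fps_deriv (sfps (Abs_fps hsym)) = sfps (Abs_fps hsym) * sfps P"
      by (simp add: sfps_deriv H sfps_mult)
    have "fps_deriv ((1 - fps_const ww * fps_X) * ?H) =
          (1 - fps_const ww * fps_X) * (?H * cfps P) - ?H * fps_const ww"
      by (simp add: cfps_deriv H cfps_mult mult.commute flip: fps_const_neg)
    also have "\<dots> = (1 - fps_const ww * fps_X) * (?H * cfps P) -
         ?H * ((1 - fps_const ww * fps_X) * W)"
      unfolding W ..
    also have "\<dots> = (1 - fps_const ww * fps_X) * ?H * sfps P"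
      unfolding sP by (simp only: right_diff_distrib mult.assoc mult.left_commute[of "cfps (Abs_fps hsym)"])
    finally show "fps_deriv ((1 - fps_const ww * fps_X) * ?H) =
      (1 - fps_const ww * fps_X) * ?H * sfps P" .
  qed (simp add: sfps_def cfps_def one_pCons)
qed

text \<open>The shift divides E(u) by 1 + w u; keeping this factor on the left avoids inverse
  series. Both sides solve F' = F * \<open>cfps P\<close>.\<close>

lemma sfps_esym: "(1 + fps_const ww * fps_X) * sfps (Abs_fps esym) = cfps (Abs_fps esym)"
proof -
  define P where "P = Abs_fps (\<lambda>i. (-1) ^ i * psym (Suc i))"
  define W where "W = Abs_fps (\<lambda>i. (-1) ^ i * ww ^ Suc i)"
  have E: "fps_deriv (Abs_fps esym) = Abs_fps esym * P"
    by (rule fps_newtonI) (simp only: fps_nth_Abs_fps esym_newton P_def)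
  have sgn1: "shift ((-1) ^ i) = (-1) ^ i" for i
    by (cases "even i") (simp_all add: shift_uminus)
  have "[:- 1:] = (- 1 :: Lam poly)" by (simp add: one_pCons)
  hence sgn2: "[:(-1) ^ i:] = (-1 :: Lam poly) ^ i" for i
    by (cases "even i") (simp_all add: pCons_one)
  have sP: "sfps P = cfps P - W"
  proof (rule fps_ext)
    fix i
    have "[:(-1) ^ i * psym (Suc i):] = (-1 :: Lam poly) ^ i * [:psym (Suc i):]"
      unfolding sgn2[symmetric] by simp
    thus "fps_nth (sfps P) i = fps_nth (cfps P - W) i"
      by (simp only: sfps_def cfps_def P_def W_def fps_nth_Abs_fps fps_sub_nth shift_psym shift_mult
          sgn1 right_diff_distrib)
  qed
  have W: "(1 + fps_const ww * fps_X) * W = fps_const ww"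
    unfolding W_def
    by (rule fps_ext) (auto simp: distrib_right mult.assoc gr0_conv_Suc)
  let ?E = "sfps (Abs_fps esym)"
  show ?thesis
  proof (rule fps_deriv_eq_unique)
    show "fps_deriv (cfps (Abs_fps esym)) = cfps (Abs_fps esym) * cfps P"
      by (simp add: cfps_deriv E cfps_mult)
    have "fps_deriv ((1 + fps_const ww * fps_X) * ?E) =
          (1 + fps_const ww * fps_X) * (?E * sfps P) + ?E * fps_const ww"
      by (simp add: sfps_deriv E sfps_mult mult.commute)
    also have "\<dots> = (1 + fps_const ww * fps_X) * (?E * sfps P) +
         ?E * ((1 + fps_const ww * fps_X) * W)"
      unfolding W ..
    also have "\<dots> = (1 + fps_const ww * fps_X) * ?E * cfps P"
      unfolding sP by (simp only: right_diff_distrib mult.assoc mult.left_commute[of ?E] diff_add_cancel)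
    finally show "fps_deriv ((1 + fps_const ww * fps_X) * ?E) =
      (1 + fps_const ww * fps_X) * ?E * cfps P" .
  qed (simp add: sfps_def cfps_def one_pCons)
qed

text \<open>Coefficient of u^a in (1 + w u) Q(u)[w] = (1 - w u) Q(u).\<close>

lemma shift_qsym:
  "shift (qsym a) + ww * shift (qsym (a - 1)) = [:qsym a:] - ww * [:qsym (a - 1):]"
proof -
  let ?Q = "Abs_fps esym * Abs_fps hsym"
  have "(1 + fps_const ww * fps_X) * sfps ?Q =
        (1 - fps_const ww * fps_X) * cfps ?Q"
    unfolding sfps_mult sfps_hsym cfps_mult sfps_esym[symmetric] by (simp only: mult_ac)
  hence *: "fps_nth ((1 + fps_const ww * fps_X) * sfps ?Q) n =
        fps_nth ((1 - fps_const ww * fps_X) * cfps ?Q) n" for n by simp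
  show ?thesis
  proof (cases "a < 0")
    case False
    show ?thesis
    proof (cases "nat a")
      case 0
      thus ?thesis using *[of 0] False
        by (simp add: qsym_def sfps_def cfps_def)
    next
      case (Suc n)
      hence a: "a = int (Suc n)" "nat (a - 1) = n" by auto
      show ?thesis using *[of "Suc n"] a
        by (simp add: distrib_right left_diff_distrib mult.assoc qsym_def sfps_def cfps_def nat_add_distrib)
    qed
  qed (simp add: qsym_def)
qed

lemma qsym_neg: "a < 0 \<Longrightarrow> qsym a = 0"
  by (simp add: qsym_def)

lemma qsym_0 [simp]: "qsym 0 = 1"
  by (simp add: qsym_def)

text \<open>The quotient (1 - w u) / (1 + w u) is 1 plus twice the sum of (-1)^i (w u)^i over
  positive i; here this appears through the recursion in \<open>r\<close>.\<close>

lemma coeff_shift_qsym: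
  "coeff (shift (qsym r)) i = (if i = 0 then qsym r else 2 * (-1) ^ i * qsym (r - int i))"
proof (induction i arbitrary: r)
  case (Suc i)
  have "coeff (shift (qsym r)) (Suc i) + coeff (shift (qsym (r - 1))) i =
        - (if i = 0 then qsym (r - 1) else 0)"
    using arg_cong[OF shift_qsym[of r], of "\<lambda>p. coeff p (Suc i)"]
    by (auto simp: coeff_pCons ww_def split: nat.splits)
  hence "coeff (shift (qsym r)) (Suc i) =
        - (if i = 0 then qsym (r - 1) else 0) - coeff (shift (qsym (r - 1))) i"
    by (simp add: eq_diff_eq)
  thus ?case unfolding Suc.IH by (auto simp: diff_diff_eq)
qed (simp add: coeff_shift_0)

text \<open>The coefficients of \<open>shift (qsym r)\<close> are exactly the weights in the
  definition of \<open>qsym2\<close>, so a vertex operator applied to q_r gives q_(k,r).\<close>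

lemma gam_shift_qsym: "gam k (shift (qsym r)) = qsym2 k r"
proof -
  have deg: "degree (shift (qsym r)) \<le> nat r"
    by (rule degree_le) (auto simp: coeff_shift_qsym qsym_neg)
  have "gam k (shift (qsym r)) = (\<Sum>i\<le>nat r. qsym (k + int i) * coeff (shift (qsym r)) i)"
    unfolding gam_def by (rule lin_superset[OF deg])
  also have "\<dots> = qsym k * qsym r + (\<Sum>i\<in>{1..nat r}. qsym (k + int i) * (2 * (-1) ^ i * qsym (r - int i)))"
  proof -
    have "{..nat r} = insert 0 {1..nat r}" by auto
    thus ?thesis by (simp add: coeff_shift_qsym)
  qed
  also have "(\<Sum>i\<in>{1..nat r}. qsym (k + int i) * (2 * (-1) ^ i * qsym (r - int i))) =
      2 * (\<Sum>i\<in>{1..nat r}. (if i \<ge> 1 then (-1) ^ i * qsym (k + int i) * qsym (r - int i) else 0))"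
    unfolding sum_distrib_left by (intro sum.cong) (auto simp: mult_ac)
  also have "(\<Sum>i\<in>{1..nat r}. (if i \<ge> 1 then (-1) ^ i * qsym (k + int i) * qsym (r - int i) else 0)) =
      Sum_any (\<lambda>i. if i \<ge> 1 then (-1) ^ i * qsym (k + int i) * qsym (r - int i) else 0)"
  proof (rule Sum_any.expand_superset[symmetric])
    show "{i. (if i \<ge> 1 then (-1) ^ i * qsym (k + int i) * qsym (r - int i) else 0) \<noteq> 0} \<subseteq> {1..nat r}"
    proof
      fix i assume "i \<in> {i. (if i \<ge> 1 then (-1) ^ i * qsym (k + int i) * qsym (r - int i) else 0) \<noteq> 0}"
      hence "i \<ge> 1" "qsym (r - int i) \<noteq> 0" by (auto split: if_splits)
      thus "i \<in> {1..nat r}" using qsym_neg[of "r - int i"] by (cases "r - int i < 0") auto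
    qed
  qed simp
  finally show ?thesis by (simp add: qsym2_def)
qed

section \<open>Alternating sums and the Pfaffian recursion\<close>

text \<open>Alternating sum over the ways to remove one entry: \<open>\<phi>\<close> receives the
  removed entry and the remaining list. The recursion puts \<open>x\<close> back in front of that
  list; \<open>altsum_conv_sum\<close> gives the closed form.\<close>

fun altsum :: "('b \<Rightarrow> 'b list \<Rightarrow> 'a :: comm_ring_1) \<Rightarrow> 'b list \<Rightarrow> 'a" where
  "altsum \<phi> [] = 0"
| "altsum \<phi> (x # xs) = \<phi> x xs - altsum (\<lambda>y ys. \<phi> y (x # ys)) xs"

lemma altsum_add: "altsum (\<lambda>x xs. \<phi> x xs + \<psi> x xs) S = altsum \<phi> S + altsum \<psi> S"
  by (induction S arbitrary: \<phi> \<psi>) simp_all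

lemma altsum_diff: "altsum (\<lambda>x xs. \<phi> x xs - \<psi> x xs) S = altsum \<phi> S - altsum \<psi> S"
  by (induction S arbitrary: \<phi> \<psi>) simp_all

lemma altsum_mult: "altsum (\<lambda>x xs. c * \<phi> x xs) S = c * altsum \<phi> S"
  by (induction S arbitrary: \<phi>) (simp_all add: right_diff_distrib)

lemma altsum_hom:
  assumes "\<And>a b. g (a - b) = g a - g b"
  shows "g (altsum \<phi> S) = altsum (\<lambda>x xs. g (\<phi> x xs)) S"
proof -
  have "g 0 = 0" using assms[of 0 0] by simp
  thus ?thesis by (induction S arbitrary: \<phi>) (simp_all add: assms)
qed

lemma altsum_cong:
  assumes "\<And>x xs. Suc (length xs) = length S \<Longrightarrow> \<phi> x xs = \<psi> x xs"
  shows "altsum \<phi> S = altsum \<psi> S"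
  using assms
proof (induction S arbitrary: \<phi> \<psi>)
  case (Cons x S)
  have "altsum (\<lambda>y ys. \<phi> y (x # ys)) S = altsum (\<lambda>y ys. \<psi> y (x # ys)) S"
    by (rule Cons.IH) (simp add: Cons.prems)
  thus ?case by (simp add: Cons.prems)
qed simp

text \<open>Removing two entries in either order leaves the same list, with opposite signs.\<close>

lemma altsum_altsum_swap:
  "altsum (\<lambda>x. altsum (\<lambda>y ys. \<psi> x y ys)) S = - altsum (\<lambda>x. altsum (\<lambda>y ys. \<psi> y x ys)) S"
proof (induction S arbitrary: \<psi>)
  case (Cons z S)
  show ?case
    using Cons.IH[of "\<lambda>x y ys. \<psi> x y (z # ys)"] by (simp add: altsum_diff)
qed simp

text \<open>\<open>altsum_altsum_swap\<close> only shows that twice the sum is 0, so over an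
  arbitrary commutative ring the vanishing has its own induction.\<close>

lemma altsum_altsum_sym:
  assumes "\<And>x y ys. \<psi> x y ys = \<psi> y x ys"
  shows "altsum (\<lambda>x. altsum (\<lambda>y ys. \<psi> x y ys)) S = 0"
  using assms
proof (induction S arbitrary: \<psi>)
  case (Cons z S)
  have "(\<lambda>y ys. \<psi> z y ys) = (\<lambda>y ys. \<psi> y z ys)" using Cons.prems by auto
  hence "altsum (\<psi> z) S = altsum (\<lambda>x. \<psi> x z) S" by simp
  moreover have "altsum (\<lambda>x. altsum (\<lambda>y ys. \<psi> x y (z # ys))) S = 0"
    by (rule Cons.IH) (rule Cons.prems)
  ultimately show ?case by (simp add: altsum_diff)
qed simp

lemma const_altsum_mult:
  fixes f g :: "'b \<Rightarrow> 'b list \<Rightarrow> 'a :: comm_ring_1"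
  shows "[:altsum (\<lambda>y ys. f y ys * g y ys) S:] = altsum (\<lambda>y ys. [:f y ys:] * [:g y ys:]) S"
proof -
  have "[:altsum (\<lambda>y ys. f y ys * g y ys) S:] = altsum (\<lambda>y ys. [:f y ys * g y ys:]) S"
    by (rule altsum_hom) simp
  moreover have "[:a * b:] = [:a:] * [:b:]" for a b :: 'a by simp
  ultimately show ?thesis by (simp only:)
qed

lemma const_mult_add: "[:a * b + d:] = [:a:] * [:b:] + [:d :: 'a :: comm_ring_1:]"
  by simp

text \<open>
  \<open>lin (s x)\<close> is the functional \<open>L\<^sub>x\<close> of the introduction, and \<open>shift_pair\<close> is \<open>shift_Qf\<close> below for lists
  of length 2.
\<close>

locale vertex_family =
  fixes s :: "'b \<Rightarrow> nat \<Rightarrow> Lam"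
  assumes shift_pair: "shift (lin (s x) (shift (s y 0))) = [:lin (s x) (shift (s y 0)):] +
     (shift (s x 0) - [:s x 0:]) * [:s y 0:] - (shift (s y 0) - [:s y 0:]) * [:s x 0:]"
begin

definition vac :: "'b \<Rightarrow> Lam" where
  "vac x = s x 0"

definition incr :: "'b \<Rightarrow> Lam poly" where
  "incr x = shift (vac x) - [:vac x:]"

text \<open>A contraction as in Wick's theorem: what is left of \<open>Qf [x, y]\<close> after the
  product \<open>vac x * vac y\<close> is subtracted; see \<open>Qf_pair\<close>.\<close>

definition contr :: "'b \<Rightarrow> 'b \<Rightarrow> Lam" where
  "contr x y = lin (s x) (incr y)"

fun Qf :: "'b list \<Rightarrow> Lam" where
  "Qf [] = 1"
| "Qf (x # xs) = lin (s x) (shift (Qf xs))"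

lemma lin_const: "lin (s x) [:a:] = vac x * a"
  by (simp add: lin_pCons vac_def)

lemma lin_mult_const: "lin (s x) (p * [:a:]) = lin (s x) p * a"
  by (simp add: lin_smult mult.commute)

lemma Qf_pair: "Qf [x, y] = contr x y + vac x * vac y"
  by (simp add: contr_def incr_def lin_diff lin_const) (simp add: vac_def)

text \<open>The shift of \<open>vac x * vac y\<close> is subtracted from \<open>shift_pair\<close>.
  The terms linear in \<open>incr x\<close> cancel, and the quadratic term is symmetric in
  \<open>x\<close> and \<open>y\<close>.\<close>

lemma shift_contr: "shift (contr x y) = [:contr x y:] - 2 * incr y * [:vac x:] - incr x * incr y"
proof -
  have "contr x y = lin (s x) (shift (vac y)) - vac x * vac y"
    by (simp add: contr_def incr_def lin_diff lin_const)
  hence contr: "[:contr x y:] = [:lin (s x) (shift (vac y)):] - [:vac x:] * [:vac y:]"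
    and "shift (contr x y) = shift (lin (s x) (shift (vac y))) - shift (vac x) * shift (vac y)"
    by (simp_all add: shift_diff shift_mult)
  note this(2)
  also have "shift (lin (s x) (shift (vac y))) =
      [:lin (s x) (shift (vac y)):] + incr x * [:vac y:] - incr y * [:vac x:]"
    using shift_pair[of x y] unfolding incr_def vac_def .
  also have "[:lin (s x) (shift (vac y)):] = [:contr x y:] + [:vac x:] * [:vac y:]"
    unfolding contr by (simp only: diff_add_cancel)
  also have "shift (vac x) = [:vac x:] + incr x" by (simp add: incr_def)
  also have "shift (vac y) = [:vac y:] + incr y" by (simp add: incr_def)
  finally have *: "shift (contr x y) = [:contr x y:] + [:vac x:] * [:vac y:] + incr x * [:vac y:] - incr y * [:vac x:] -
      ([:vac x:] + incr x) * ([:vac y:] + incr y)" .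
  have "C + a * b + t * b - u * a - (a + t) * (b + u) = C - 2 * u * a - t * u"
    for C a b t u :: "Lam poly"
    by (simp add: algebra_simps)
  thus ?thesis unfolding * .
qed

text \<open>Applying \<open>lin (s x)\<close> to the expansion of \<open>shift (Qf S)\<close>
  expands \<open>Qf (x # S)\<close>; that identity in \<open>Lam\<close> can be shifted in turn. The
  two statements therefore feed each other in an induction on the length.\<close>

lemma shift_Qf: "shift (Qf S) = [:Qf S:] + altsum (\<lambda>x xs. incr x * [:Qf xs:]) S"
  and Qf_Cons: "Qf (x # S) = vac x * Qf S + altsum (\<lambda>y ys. contr x y * Qf ys) S"
proof -
  have Qf_Cons': "Qf (x # S) = vac x * Qf S + altsum (\<lambda>y ys. contr x y * Qf ys) S"
    if "shift (Qf S) = [:Qf S:] + altsum (\<lambda>x xs. incr x * [:Qf xs:]) S" for x S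
    by (simp add: that lin_add lin_const altsum_hom[where g = "lin (s x)"] lin_diff lin_mult_const contr_def
        del: mult_pCons_right)
  show main: "shift (Qf S) = [:Qf S:] + altsum (\<lambda>x xs. incr x * [:Qf xs:]) S"
  proof (induction "length S" arbitrary: S rule: less_induct)
    case less
    show ?case
    proof (cases S)
      case Nil
      thus ?thesis by (simp add: one_pCons)
    next
      case (Cons x R)
      define a1 where "a1 = altsum (\<lambda>y ys. incr y * [:Qf ys:]) R"
      define a2 where "a2 = altsum (\<lambda>y ys. [:contr x y:] * [:Qf ys:]) R"
      define a3 where "a3 = altsum (\<lambda>y ys. incr y * [:Qf (x # ys):]) R"
      have IH: "shift (Qf ys) = [:Qf ys:] + altsum (\<lambda>x xs. incr x * [:Qf xs:]) ys"
        if "length ys \<le> length R" for ys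
        using less that Cons by simp
      have QR: "shift (Qf R) = [:Qf R:] + a1"
        unfolding a1_def by (rule IH) simp
      have QS: "Qf S = vac x * Qf R + altsum (\<lambda>y ys. contr x y * Qf ys) R"
        unfolding Cons by (rule Qf_Cons'[OF IH]) simp
      have constS: "[:Qf S:] = [:vac x:] * [:Qf R:] + a2"
        unfolding QS a2_def const_mult_add const_altsum_mult ..
      have tm: "shift (contr x y) * shift (Qf ys) =
           ([:contr x y:] * [:Qf ys:] - (2 * [:vac x:] + incr x) * (incr y * [:Qf ys:])) +
           (altsum (\<lambda>z zs. [:contr x y:] * (incr z * [:Qf zs:])) ys -
            (2 * [:vac x:] + incr x) * altsum (\<lambda>z zs. incr y * incr z * [:Qf zs:]) ys)"
        if "length ys \<le> length R" for y ys
      proof -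
        have "altsum (\<lambda>z zs. incr y * incr z * [:Qf zs:]) ys = incr y * altsum (\<lambda>z zs. incr z * [:Qf zs:]) ys"
          unfolding altsum_mult[symmetric] by (simp only: mult.assoc)
        note e = this
        have "(C - 2 * t * a - b * t) * (Q + D) =
          (C * Q - (2 * a + b) * (t * Q)) + (C * D - (2 * a + b) * (t * D))" for C t a b Q D :: "Lam poly"
          by (simp add: algebra_simps)
        thus ?thesis unfolding IH[OF that] shift_contr altsum_mult e .
      qed
      have "altsum (\<lambda>y ys. shift (contr x y) * shift (Qf ys)) R =
          altsum (\<lambda>y ys. ([:contr x y:] * [:Qf ys:] - (2 * [:vac x:] + incr x) * (incr y * [:Qf ys:])) +
           (altsum (\<lambda>z zs. [:contr x y:] * (incr z * [:Qf zs:])) ys -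
            (2 * [:vac x:] + incr x) * altsum (\<lambda>z zs. incr y * incr z * [:Qf zs:]) ys)) R"
        by (intro altsum_cong tm) simp
      also have "\<dots> = a2 - (2 * [:vac x:] + incr x) * a1 +
           (altsum (\<lambda>y ys. [:contr x y:] * altsum (\<lambda>z zs. incr z * [:Qf zs:]) ys) R -
            (2 * [:vac x:] + incr x) * altsum (\<lambda>y. altsum (\<lambda>z zs. incr y * incr z * [:Qf zs:])) R)"
        by (simp only: altsum_add altsum_diff altsum_mult a1_def a2_def)
      \<comment> \<open>The quadratic terms are symmetric in the two removed entries.\<close>
      also have "altsum (\<lambda>y. altsum (\<lambda>z zs. incr y * incr z * [:Qf zs:])) R = 0"
        by (rule altsum_altsum_sym) (simp only: mult.commute)
      \<comment> \<open>After the two removals are exchanged, the inner sum becomes the contraction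
        part of \<open>Qf_Cons'\<close> for the list \<open>x # ys\<close>, which is shorter than
        \<open>S\<close>.\<close>
      also have "altsum (\<lambda>y ys. [:contr x y:] * altsum (\<lambda>z zs. incr z * [:Qf zs:]) ys) R =
          - altsum (\<lambda>y ys. incr y * altsum (\<lambda>z zs. [:contr x z:] * [:Qf zs:]) ys) R"
        unfolding altsum_mult[symmetric]
        by (subst altsum_altsum_swap) (simp only: mult.left_commute)
      also have "altsum (\<lambda>y ys. incr y * altsum (\<lambda>z zs. [:contr x z:] * [:Qf zs:]) ys) R =
          altsum (\<lambda>y ys. incr y * [:Qf (x # ys):] - [:vac x:] * (incr y * [:Qf ys:])) R"
      proof (rule altsum_cong)
        fix y and ys :: "'b list" assume "Suc (length ys) = length R"
        hence "Qf (x # ys) = vac x * Qf ys + altsum (\<lambda>y ys. contr x y * Qf ys) ys"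
          by (intro Qf_Cons' IH) simp
        hence "[:Qf (x # ys):] =
            [:vac x:] * [:Qf ys:] + altsum (\<lambda>z zs. [:contr x z:] * [:Qf zs:]) ys"
          by (simp only: const_mult_add const_altsum_mult)
        thus "incr y * altsum (\<lambda>z zs. [:contr x z:] * [:Qf zs:]) ys =
            incr y * [:Qf (x # ys):] - [:vac x:] * (incr y * [:Qf ys:])"
          by (simp only: distrib_left mult.left_commute[of "incr y" "[:vac x:]"] add_diff_cancel_left')
      qed
      also have "\<dots> = a3 - [:vac x:] * a1"
        by (simp only: altsum_diff altsum_mult a3_def a1_def)
      finally have A: "altsum (\<lambda>y ys. shift (contr x y) * shift (Qf ys)) R =
          a2 - (2 * [:vac x:] + incr x) * a1 + (- (a3 - [:vac x:] * a1) - (2 * [:vac x:] + incr x) * 0)" .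
      have "shift (Qf S) = shift (vac x) * shift (Qf R) + altsum (\<lambda>y ys. shift (contr x y) * shift (Qf ys)) R"
        unfolding QS
        by (simp add: shift_add shift_mult altsum_hom[where g = shift] shift_diff)
      also have "\<dots> = ([:vac x:] + incr x) * ([:Qf R:] + a1) +
          (a2 - (2 * [:vac x:] + incr x) * a1 + (- (a3 - [:vac x:] * a1) - (2 * [:vac x:] + incr x) * 0))"
        unfolding A QR by (simp add: incr_def)
      \<comment> \<open>All multiples of \<open>a1\<close> cancel, and \<open>a2\<close> completes
        the constant term.\<close>
      also have "\<dots> = [:Qf S:] + (incr x * [:Qf R:] - a3)"
      proof -
        have "(a + t) * (Q + b) + (d - (2 * a + t) * b + (- (e - a * b) - (2 * a + t) * 0)) =
              (a * Q + d) + (t * Q - e)" for a t Q b d e :: "Lam poly"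
          by (simp add: algebra_simps)
        thus ?thesis unfolding constS .
      qed
      also have "incr x * [:Qf R:] - a3 = altsum (\<lambda>x xs. incr x * [:Qf xs:]) S"
        unfolding Cons a3_def by simp
      finally show ?thesis .
    qed
  qed
  show "Qf (x # S) = vac x * Qf S + altsum (\<lambda>y ys. contr x y * Qf ys) S"
    by (rule Qf_Cons'[OF main])
qed

text \<open>Expanding \<open>Qf (x # ys)\<close> by \<open>Qf_Cons\<close> and exchanging the
  removals expresses the sum over \<open>x # R\<close> by the sums over \<open>R\<close> and over
  lists one entry shorter than \<open>R\<close>, so that parity decides.\<close>

lemma altsum_vac_Qf: "altsum (\<lambda>x xs. vac x * Qf xs) S = (if odd (length S) then Qf S else 0)"
proof (induction "length S" arbitrary: S rule: less_induct)
  case less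
  show ?case
  proof (cases S)
    case (Cons x R)
    have "altsum (\<lambda>y ys. vac y * Qf (x # ys)) R =
        altsum (\<lambda>y ys. vac x * (vac y * Qf ys) + altsum (\<lambda>z zs. contr x z * (vac y * Qf zs)) ys) R"
      unfolding Qf_Cons by (simp only: distrib_left altsum_mult[symmetric] mult.left_commute)
    also have "\<dots> = vac x * altsum (\<lambda>y ys. vac y * Qf ys) R -
        altsum (\<lambda>y ys. contr x y * altsum (\<lambda>z zs. vac z * Qf zs) ys) R"
    proof -
      have "altsum (\<lambda>y. altsum (\<lambda>z zs. contr x z * (vac y * Qf zs))) R =
          - altsum (\<lambda>y ys. contr x y * altsum (\<lambda>z zs. vac z * Qf zs) ys) R"
        by (subst altsum_altsum_swap) (simp only: altsum_mult[symmetric])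
      thus ?thesis by (simp only: altsum_add altsum_mult add_uminus_conv_diff)
    qed
    also have "altsum (\<lambda>y ys. vac y * Qf ys) R = (if odd (length R) then Qf R else 0)"
      using less Cons by simp
    also have "altsum (\<lambda>y ys. contr x y * altsum (\<lambda>z zs. vac z * Qf zs) ys) R =
        altsum (\<lambda>y ys. (if even (length R) then 1 else 0) * (contr x y * Qf ys)) R"
    proof (rule altsum_cong)
      fix y and ys :: "'b list" assume len: "Suc (length ys) = length R"
      hence "even (length R) \<longleftrightarrow> odd (length ys)" by (metis even_Suc)
      thus "contr x y * altsum (\<lambda>z zs. vac z * Qf zs) ys =
          (if even (length R) then 1 else 0) * (contr x y * Qf ys)"
        using less Cons len by simp
    qed
    finally show ?thesis
      unfolding Cons by (auto simp: Qf_Cons altsum_mult simp del: Qf.simps)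
  qed simp
qed

text \<open>In odd length \<open>altsum_vac_Qf\<close> turns \<open>vac x * Qf S\<close> into an
  alternating sum, which merges with the contractions into the values
  \<open>Qf [x, y]\<close>.\<close>

lemma Qf_Cons_odd:
  assumes "odd (length S)"
  shows "Qf (x # S) = altsum (\<lambda>y ys. Qf [x, y] * Qf ys) S"
proof -
  have "altsum (\<lambda>y ys. Qf [x, y] * Qf ys) S =
        altsum (\<lambda>y ys. contr x y * Qf ys + vac x * (vac y * Qf ys)) S"
    unfolding Qf_pair by (simp only: distrib_right mult.assoc)
  thus ?thesis using assms
    by (simp add: altsum_add altsum_mult altsum_vac_Qf Qf_Cons del: Qf.simps)
qed

end

section \<open>Expansion of the Pfaffian along the first row\<close>

text \<open>Increasing enumeration of the positive indices other than \<open>j + 1\<close>.\<close>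

definition skip :: "nat \<Rightarrow> nat \<Rightarrow> nat" where
  "skip j a = (if a < j then Suc a else Suc (Suc a))"

lemma skip_less_iff: "skip j a < skip j b \<longleftrightarrow> a < b"
  by (auto simp: skip_def)

lemma skip_eq_iff: "skip j a = skip j b \<longleftrightarrow> a = b"
  by (auto simp: skip_def)

text \<open>The cycle that takes \<open>1\<close> to \<open>j + 1\<close> and keeps the order of the
  larger indices. Its construction from \<open>j\<close> adjacent transpositions gives the
  sign.\<close>

primrec rot :: "nat \<Rightarrow> nat \<Rightarrow> nat" where
  "rot 0 = id"
| "rot (Suc j) = transpose (Suc j) (Suc (Suc j)) \<circ> rot j"

lemma rot_apply: "rot j 0 = 0" "rot j (Suc 0) = Suc j" "rot j (Suc (Suc a)) = skip j a"
  by (induction j) (auto simp: skip_def transpose_def)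

lemma rot_permutes: "rot j permutes {..Suc j}"
proof (induction j)
  case (Suc j)
  have "rot j permutes {..Suc (Suc j)}"
    by (rule permutes_subset[OF Suc]) auto
  moreover have "transpose (Suc j) (Suc (Suc j)) permutes {..Suc (Suc j)}"
    by (rule permutes_swap_id) auto
  ultimately show ?case unfolding rot.simps by (rule permutes_compose)
qed (auto simp: permutes_def)

lemma permutation_rot: "permutation (rot j)"
  using rot_permutes by (rule permutation_permutes[THEN iffD2, OF exI, OF conjI, rotated]) simp

lemma sign_rot: "sign (rot j) = (-1) ^ j"
proof (induction j)
  case (Suc j)
  thus ?case unfolding rot.simps
    by (subst sign_compose) (simp_all add: permutation_rot permutation_swap_id sign_swap_id)
qed (simp flip: id_def)

definition lift2 :: "nat \<Rightarrow> (nat \<Rightarrow> nat) \<Rightarrow> nat \<Rightarrow> nat" where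
  "lift2 n \<tau> = map_permutation {..<n} (\<lambda>i. Suc (Suc i)) \<tau>"

lemma lift2_permutes:
  assumes "\<tau> permutes {..<n}"
  shows "lift2 n \<tau> permutes {2..<Suc (Suc n)}"
proof -
  have "bij_betw (\<lambda>i. Suc (Suc i)) {..<n} {2..<Suc (Suc n)}"
    by (rule bij_betwI[where g = "\<lambda>i. i - 2"]) auto
  from map_permutation_permutes[OF this assms] show ?thesis by (simp add: lift2_def)
qed

lemma sign_lift2: "\<tau> permutes {..<n} \<Longrightarrow> sign (lift2 n \<tau>) = sign \<tau>"
  unfolding lift2_def by (rule sign_map_permutation) (auto intro: inj_onI)

lemma lift2_apply:
  assumes "\<tau> permutes {..<n}"
  shows "lift2 n \<tau> 0 = 0" "lift2 n \<tau> (Suc 0) = Suc 0"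
    "lift2 n \<tau> (Suc (Suc a)) = Suc (Suc (\<tau> a))"
proof -
  note p = permutes_not_in[OF lift2_permutes[OF assms]]
  show "lift2 n \<tau> 0 = 0" "lift2 n \<tau> (Suc 0) = Suc 0" by (rule p; simp)+
  show "lift2 n \<tau> (Suc (Suc a)) = Suc (Suc (\<tau> a))"
  proof (cases "a < n")
    case True
    thus ?thesis using map_permutation_apply[of "\<lambda>i. Suc (Suc i)" "{..<n}" a \<tau>]
      by (simp add: lift2_def inj_on_def)
  next
    case False
    thus ?thesis using p[of "Suc (Suc a)"] permutes_not_in[OF assms, of a] by simp
  qed
qed

text \<open>Perfect matchings of \<open>2 * l\<close> points, each encoded by the permutation that
  lists its pairs in increasing order of their smaller elements.\<close>

definition matchings :: "nat \<Rightarrow> (nat \<Rightarrow> nat) set" where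
  "matchings l = {\<sigma>. \<sigma> permutes {..<2 * l} \<and> (\<forall>k<l. \<sigma> (2 * k) < \<sigma> (2 * k + 1)) \<and>
            (\<forall>k. k + 1 < l \<longrightarrow> \<sigma> (2 * k) < \<sigma> (2 * k + 2))}"

lemma rot_lift2_apply:
  assumes "\<tau> permutes {..<n}"
  shows "(rot j \<circ> lift2 n \<tau>) 0 = 0" "(rot j \<circ> lift2 n \<tau>) (Suc 0) = Suc j"
    "(rot j \<circ> lift2 n \<tau>) (Suc (Suc a)) = skip j (\<tau> a)"
  by (simp_all add: lift2_apply[OF assms] rot_apply)

lemma rot_lift2_matchings:
  assumes j: "j < 2 * l + 1" and \<tau>: "\<tau> \<in> matchings l"
  shows "rot j \<circ> lift2 (2 * l) \<tau> \<in> matchings (Suc l)"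
proof -
  let ?\<sigma> = "rot j \<circ> lift2 (2 * l) \<tau>"
  have p: "\<tau> permutes {..<2 * l}" using \<tau> by (simp add: matchings_def)
  note app = rot_lift2_apply[OF p, of j]
  have "lift2 (2 * l) \<tau> permutes {..<2 * Suc l}"
    by (rule permutes_subset[OF lift2_permutes[OF p]]) auto
  moreover have "rot j permutes {..<2 * Suc l}"
    by (rule permutes_subset[OF rot_permutes]) (use j in auto)
  ultimately have "?\<sigma> permutes {..<2 * Suc l}" by (rule permutes_compose)
  moreover have "?\<sigma> (2 * k) < ?\<sigma> (2 * k + 1)" if "k < Suc l" for k
    using that \<tau> app by (cases k) (auto simp: skip_less_iff matchings_def simp del: comp_apply)
  moreover have "?\<sigma> (2 * k) < ?\<sigma> (2 * k + 2)" if "k + 1 < Suc l" for k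
    using that \<tau> app by (cases k) (auto simp: skip_less_iff skip_def[of _ "\<tau> 0"] matchings_def simp del: comp_apply)
  ultimately show ?thesis by (simp only: matchings_def mem_Collect_eq) blast
qed

text \<open>The value \<open>0\<close> cannot stand at an odd position, where its partner would be
  smaller, and the values at even positions increase.\<close>

lemma matchings_zero:
  assumes "\<sigma> \<in> matchings (Suc l)"
  shows "\<sigma> 0 = 0"
proof -
  have p: "\<sigma> permutes {..<2 * Suc l}" and lt: "\<And>k. k < Suc l \<Longrightarrow> \<sigma> (2 * k) < \<sigma> (2 * k + 1)"
    and step: "\<And>k. k + 1 < Suc l \<Longrightarrow> \<sigma> (2 * k) < \<sigma> (2 * k + 2)"
    using assms by (simp_all add: matchings_def)
  have le: "k < Suc l \<Longrightarrow> \<sigma> 0 \<le> \<sigma> (2 * k)" for k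
  proof (induction k)
    case (Suc k)
    thus ?case using step[of k] by simp
  qed simp
  obtain i where i: "\<sigma> i = 0" using permutes_surj[OF p] by (metis surjD)
  have "i < 2 * Suc l"
  proof (rule ccontr)
    assume "\<not> i < 2 * Suc l"
    hence "\<sigma> i = i" by (intro permutes_not_in[OF p]) auto
    thus False using i \<open>\<not> i < 2 * Suc l\<close> by simp
  qed
  hence k: "i div 2 < Suc l" by auto
  have "even i"
  proof (rule ccontr)
    assume "odd i"
    hence "2 * (i div 2) + 1 = i" by simp
    thus False using lt[OF k] i by simp
  qed
  hence "2 * (i div 2) = i" by simp
  thus ?thesis using le[OF k] i by simp
qed

text \<open>\<open>0\<close> is paired with some \<open>j + 1\<close>. Undoing \<open>rot j\<close>
  leaves a permutation that fixes \<open>0\<close> and \<open>1\<close>, hence a matching of the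
  other points.\<close>

lemma matchings_surj:
  assumes \<sigma>: "\<sigma> \<in> matchings (Suc l)"
  obtains j \<tau> where "j < 2 * l + 1" "\<tau> \<in> matchings l" "\<sigma> = rot j \<circ> lift2 (2 * l) \<tau>"
proof -
  have p: "\<sigma> permutes {..<2 * Suc l}" and lt: "\<And>k. k < Suc l \<Longrightarrow> \<sigma> (2 * k) < \<sigma> (2 * k + 1)"
    and step: "\<And>k. k + 1 < Suc l \<Longrightarrow> \<sigma> (2 * k) < \<sigma> (2 * k + 2)"
    using \<sigma> by (simp_all add: matchings_def)
  have \<sigma>0: "\<sigma> 0 = 0" by (rule matchings_zero[OF \<sigma>])
  define j where "j = \<sigma> 1 - 1"
  have \<sigma>1: "\<sigma> (Suc 0) = Suc j" using lt[of 0] by (simp add: j_def)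
  have "\<sigma> (Suc 0) < 2 * Suc l" using permutes_in_image[OF p, of "Suc 0"] by simp
  hence j: "j < 2 * l + 1" using \<sigma>1 by simp
  have rp: "rot j permutes {..<2 * Suc l}"
    by (rule permutes_subset[OF rot_permutes]) (use j in auto)
  define \<rho> where "\<rho> = inv (rot j) \<circ> \<sigma>"
  have \<rho>p: "\<rho> permutes {..<2 * Suc l}"
    unfolding \<rho>_def by (rule permutes_compose[OF p permutes_inv[OF rp]])
  have rot\<rho>: "rot j (\<rho> i) = \<sigma> i" for i
    by (simp add: \<rho>_def permutes_inverses[OF rp])
  have inj_rot: "rot j a = rot j b \<Longrightarrow> a = b" for a b
    using permutes_inj[OF rp] by (auto dest: injD)
  have \<rho>01: "\<rho> 0 = 0" "\<rho> (Suc 0) = Suc 0"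
    by (rule inj_rot, simp add: rot\<rho> rot_apply \<sigma>0 \<sigma>1)+
  have inj\<rho>: "\<rho> a = \<rho> b \<longleftrightarrow> a = b" for a b
    using permutes_inj[OF \<rho>p] by (auto dest: injD)
  have ge2: "\<rho> (Suc (Suc a)) \<ge> 2" for a
    using inj\<rho>[of "Suc (Suc a)" 0] inj\<rho>[of "Suc (Suc a)" "Suc 0"] unfolding \<rho>01 by linarith
  define \<tau> where "\<tau> a = \<rho> (Suc (Suc a)) - 2" for a
  have \<tau>: "\<rho> (Suc (Suc a)) = Suc (Suc (\<tau> a))" for a
    using ge2[of a] by (simp add: \<tau>_def)
  have \<tau>p: "\<tau> permutes {..<2 * l}"
  proof (rule bij_imp_permutes)
    have inj: "inj_on \<tau> {..<2 * l}"
      by (rule inj_onI) (use \<tau> inj\<rho> in \<open>metis Suc_inject\<close>)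
    moreover have "\<tau> ` {..<2 * l} \<subseteq> {..<2 * l}"
    proof (rule image_subsetI)
      fix a assume "a \<in> {..<2 * l}"
      hence "\<rho> (Suc (Suc a)) \<in> {..<2 * Suc l}" using permutes_in_image[OF \<rho>p] by simp
      thus "\<tau> a \<in> {..<2 * l}" by (simp add: \<tau>)
    qed
    ultimately show "bij_betw \<tau> {..<2 * l} {..<2 * l}"
      by (simp add: bij_betw_def endo_inj_surj)
  next
    fix a assume "a \<notin> {..<2 * l}"
    hence "\<rho> (Suc (Suc a)) = Suc (Suc a)" by (intro permutes_not_in[OF \<rho>p]) auto
    thus "\<tau> a = a" by (simp add: \<tau>)
  qed
  have eq: "\<sigma> = rot j \<circ> lift2 (2 * l) \<tau>"
  proof
    fix i
    consider "i = 0" | "i = Suc 0" | a where "i = Suc (Suc a)" by (metis not0_implies_Suc)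
    thus "\<sigma> i = (rot j \<circ> lift2 (2 * l) \<tau>) i"
    proof cases
      case 3
      thus ?thesis using rot\<rho>[of i] by (simp add: lift2_apply[OF \<tau>p] \<tau>)
    qed (simp_all only: rot_lift2_apply[OF \<tau>p] \<sigma>0 \<sigma>1)
  qed
  have s: "\<sigma> (Suc (Suc a)) = skip j (\<tau> a)" for a
    unfolding eq by (rule rot_lift2_apply[OF \<tau>p])
  have "\<tau> (2 * k) < \<tau> (2 * k + 1)" if "k < l" for k
    using lt[of "Suc k"] that by (simp add: s skip_less_iff)
  moreover have "\<tau> (2 * k) < \<tau> (2 * k + 2)" if "k + 1 < l" for k
    using step[of "Suc k"] that by (simp add: s skip_less_iff)
  ultimately have "\<tau> \<in> matchings l" using \<tau>p by (simp add: matchings_def)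
  from that[OF j this eq] show thesis .
qed

text \<open>A matching is determined by the partner \<open>Suc j\<close> of \<open>0\<close> and a
  matching \<open>\<tau>\<close> of the remaining points; \<open>rot j\<close> contributes the sign
  (-1)^j.\<close>

lemma Pfaffian_Suc:
  "Pfaffian (Suc l) M =
     (\<Sum>j<2 * l + 1. (-1) ^ j * M 0 (Suc j) * Pfaffian l (\<lambda>a b. M (skip j a) (skip j b)))"
proof -
  let ?f = "\<lambda>(j, \<tau>). rot j \<circ> lift2 (2 * l) \<tau>"
  let ?t = "\<lambda>l M \<sigma>. of_int (sign \<sigma>) * (\<Prod>k<l. M (\<sigma> (2 * k)) (\<sigma> (2 * k + 1)))"
  have Pf: "Pfaffian l M = (\<Sum>\<sigma>\<in>matchings l. ?t l M \<sigma>)" for l and M :: "nat \<Rightarrow> nat \<Rightarrow> 'a"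
    by (simp add: Pfaffian_def matchings_def)
  have perm: "\<tau> permutes {..<2 * l}" if "\<tau> \<in> matchings l" for \<tau>
    using that by (simp add: matchings_def)
  have "bij_betw ?f ({..<2 * l + 1} \<times> matchings l) (matchings (Suc l))"
    unfolding bij_betw_def
  proof
    show "inj_on ?f ({..<2 * l + 1} \<times> matchings l)"
    proof (rule inj_onI, clarify)
      fix i \<tau> j \<tau>'
      assume "\<tau> \<in> matchings l" "\<tau>' \<in> matchings l"
        and eq: "rot i \<circ> lift2 (2 * l) \<tau> = rot j \<circ> lift2 (2 * l) \<tau>'"
      note a = rot_lift2_apply[OF perm[OF this(1)]] rot_lift2_apply[OF perm[OF this(2)]]
      have "i = j" using fun_cong[OF eq, of "Suc 0"] unfolding a by simp
      moreover have "\<tau> a = \<tau>' a" for a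
        using fun_cong[OF eq, of "Suc (Suc a)"] unfolding a \<open>i = j\<close> skip_eq_iff .
      ultimately show "i = j \<and> \<tau> = \<tau>'" by blast
    qed
    show "?f ` ({..<2 * l + 1} \<times> matchings l) = matchings (Suc l)"
    proof (intro equalityI subsetI)
      fix \<sigma> assume "\<sigma> \<in> matchings (Suc l)"
      then obtain j \<tau> where "j < 2 * l + 1" "\<tau> \<in> matchings l" "\<sigma> = rot j \<circ> lift2 (2 * l) \<tau>"
        by (rule matchings_surj)
      thus "\<sigma> \<in> ?f ` ({..<2 * l + 1} \<times> matchings l)"
        by (intro image_eqI[of _ _ "(j, \<tau>)"]) auto
    qed (use rot_lift2_matchings in auto)
  qed
  hence "Pfaffian (Suc l) M = (\<Sum>x\<in>{..<2 * l + 1} \<times> matchings l. ?t (Suc l) M (?f x))"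
    unfolding Pf by (rule sum.reindex_bij_betw[symmetric])
  also have "\<dots> = (\<Sum>(j, \<tau>)\<in>{..<2 * l + 1} \<times> matchings l.
      (-1) ^ j * M 0 (Suc j) * ?t l (\<lambda>a b. M (skip j a) (skip j b)) \<tau>)"
  proof (rule sum.cong, safe)
    fix j \<tau> assume "\<tau> \<in> matchings l"
    note p = perm[OF this]
    let ?\<sigma> = "rot j \<circ> lift2 (2 * l) \<tau>"
    have "permutation (lift2 (2 * l) \<tau>)"
      using lift2_permutes[OF p] permutation_permutes by blast
    hence "sign ?\<sigma> = (-1) ^ j * sign \<tau>"
      by (simp add: sign_compose permutation_rot sign_rot sign_lift2[OF p])
    moreover have "(\<Prod>k<Suc l. M (?\<sigma> (2 * k)) (?\<sigma> (2 * k + 1))) =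
        M 0 (Suc j) * (\<Prod>k<l. M (skip j (\<tau> (2 * k))) (skip j (\<tau> (2 * k + 1))))"
      unfolding prod.lessThan_Suc_shift using rot_lift2_apply[OF p, of j]
      by (simp del: comp_apply)
    ultimately show "?t (Suc l) M ?\<sigma> =
        (-1) ^ j * M 0 (Suc j) * ?t l (\<lambda>a b. M (skip j a) (skip j b)) \<tau>"
      by (simp add: mult_ac del: comp_apply)
  qed
  also have "\<dots> = (\<Sum>j<2 * l + 1. (-1) ^ j * M 0 (Suc j) * Pfaffian l (\<lambda>a b. M (skip j a) (skip j b)))"
    unfolding Pf sum_distrib_left by (simp only: sum.cartesian_product)
  finally show ?thesis .
qed

lemma Pfaffian_0: "Pfaffian 0 M = 1"
  by (simp add: Pfaffian_def)

lemma Pfaffian_cong: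
  assumes "\<And>i j. i < 2 * l \<Longrightarrow> j < 2 * l \<Longrightarrow> M i j = N i j"
  shows "Pfaffian l M = Pfaffian l N"
  unfolding Pfaffian_def
proof (rule sum.cong, rule refl, rule arg_cong2[of _ _ _ _ times], rule refl, rule prod.cong, rule refl)
  fix \<sigma> k assume \<sigma>: "\<sigma> \<in> {\<sigma>. \<sigma> permutes {..<2 * l} \<and> (\<forall>k<l. \<sigma> (2 * k) < \<sigma> (2 * k + 1)) \<and>
            (\<forall>k. k + 1 < l \<longrightarrow> \<sigma> (2 * k) < \<sigma> (2 * k + 2))}" and k: "k \<in> {..<l}"
  hence p: "\<sigma> permutes {..<2 * l}" by simp
  show "M (\<sigma> (2 * k)) (\<sigma> (2 * k + 1)) = N (\<sigma> (2 * k)) (\<sigma> (2 * k + 1))"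
    using k permutes_in_image[OF p] by (intro assms) auto
qed

lemma altsum_conv_sum:
  "altsum \<phi> S = (\<Sum>j<length S. (-1) ^ j * \<phi> (S ! j) (take j S @ drop (Suc j) S))"
proof (induction S arbitrary: \<phi>)
  case (Cons x S)
  show ?case
    by (simp add: Cons.IH sum_negf sum.lessThan_Suc_shift del: sum.lessThan_Suc)
qed simp

text \<open>Deleting entry \<open>j\<close> of the tail corresponds to deleting rows and columns
  \<open>0\<close> and \<open>j + 1\<close> of the matrix.\<close>

lemma nth_skip:
  assumes "j < length S" "Suc a < length S"
  shows "(take j S @ drop (Suc j) S) ! a = (x # S) ! skip j a"
  using assms by (auto simp: nth_append skip_def min_def)

context vertex_family
begin

text \<open>\<open>Qf_Cons_odd\<close> and \<open>Pfaffian_Suc\<close> are the same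
  recursion.\<close>

lemma Qf_Pfaffian:
  assumes "length S = 2 * l"
  shows "Qf S = Pfaffian l (\<lambda>i j. Qf [S ! i, S ! j])"
  using assms
proof (induction l arbitrary: S)
  case 0
  thus ?case by (simp add: Pfaffian_0)
next
  case (Suc l)
  then obtain x R where S: "S = x # R" and len: "length R = 2 * l + 1" by (cases S) auto
  have "Qf S = altsum (\<lambda>y ys. Qf [x, y] * Qf ys) R"
    unfolding S by (rule Qf_Cons_odd) (simp add: len)
  also have "\<dots> = (\<Sum>j<2 * l + 1. (-1) ^ j * (Qf [x, R ! j] * Qf (take j R @ drop (Suc j) R)))"
    unfolding altsum_conv_sum len ..
  also have "\<dots> = (\<Sum>j<2 * l + 1. (-1) ^ j * Qf [S ! 0, S ! Suc j] *
      Pfaffian l (\<lambda>a b. Qf [S ! skip j a, S ! skip j b]))"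
  proof (rule sum.cong)
    fix j assume j: "j \<in> {..<2 * l + 1}"
    have "Qf (take j R @ drop (Suc j) R) = Pfaffian l (\<lambda>a b.
        Qf [(take j R @ drop (Suc j) R) ! a, (take j R @ drop (Suc j) R) ! b])"
      using len j by (intro Suc.IH) auto
    also have "\<dots> = Pfaffian l (\<lambda>a b. Qf [S ! skip j a, S ! skip j b])"
    proof (rule Pfaffian_cong)
      fix a b assume "a < 2 * l" "b < 2 * l"
      thus "Qf [(take j R @ drop (Suc j) R) ! a, (take j R @ drop (Suc j) R) ! b] =
          Qf [S ! skip j a, S ! skip j b]"
        using nth_skip[of j R a x] nth_skip[of j R b x] len j unfolding S by simp
    qed
    finally show "(-1) ^ j * (Qf [x, R ! j] * Qf (take j R @ drop (Suc j) R)) =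
        (-1) ^ j * Qf [S ! 0, S ! Suc j] * Pfaffian l (\<lambda>a b. Qf [S ! skip j a, S ! skip j b])"
      by (simp add: S mult.assoc del: Qf.simps)
  qed simp
  also have "\<dots> = Pfaffian (Suc l) (\<lambda>i j. Qf [S ! i, S ! j])"
    unfolding Pfaffian_Suc ..
  finally show ?case .
qed

end

section \<open>The shift of \<open>qsym2\<close>\<close>

lemma gam_add: "gam a (p + q) = gam a p + gam a q"
  by (simp add: gam_def lin_add)

lemma gam_smult: "gam a (smult c p) = c * gam a p"
  by (simp add: gam_def lin_smult)

lemma gam_diff: "gam a (p - q) = gam a p - gam a q"
  by (simp add: gam_def lin_diff)

lemma gam_sum: "gam a (sum f S) = (\<Sum>x\<in>S. gam a (f x))"
  by (simp add: gam_def lin_sum)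

lemma gam_0 [simp]: "gam a 0 = 0"
  by (simp add: gam_def)

lemma gam_const: "gam a [:c:] = qsym a * c"
  by (simp add: gam_def lin_pCons)

lemma gam_eq_0: "a + int (degree p) < 0 \<Longrightarrow> gam a p = 0"
  unfolding gam_def lin_def by (intro sum.neutral) (auto simp: qsym_neg)

text \<open>\<open>gam (a - 1)\<close> is applied to \<open>shift_qsym\<close>; multiplication by w
  raises the index by one.\<close>

lemma qsym2_rec:
  "qsym2 (a - 1) b + qsym2 a (b - 1) = qsym (a - 1) * qsym b - qsym a * qsym (b - 1)"
proof -
  have "qsym2 (a - 1) b + qsym2 a (b - 1) =
        gam (a - 1) (shift (qsym b) + ww * shift (qsym (b - 1)))"
    by (simp add: gam_add ww_mult gam_pCons_0 gam_shift_qsym)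
  also have "\<dots> = qsym (a - 1) * qsym b - qsym a * qsym (b - 1)"
    unfolding shift_qsym unfolding ww_mult gam_diff gam_pCons_0 gam_const by simp
  finally show ?thesis .
qed

lemma qsym2_neg: "b < 0 \<Longrightarrow> qsym2 a b = 0"
  by (simp add: gam_shift_qsym[symmetric] qsym_neg)

definition tsh :: "int \<Rightarrow> Lam poly" where
  "tsh a = shift (qsym a) - [:qsym a:]"

lemma tsh_rec: "ww * (2 * [:qsym (a - 1):] + tsh (a - 1)) = - tsh a"
proof -
  have "w * (2 * c + (s' - c)) = - (s - d)" if "s + w * s' = d - w * c" for w c s s' d :: "Lam poly"
  proof -
    from that have "s = d - w * c - w * s'" by (simp add: algebra_simps)
    thus ?thesis by (simp add: algebra_simps)
  qed
  from this[OF shift_qsym] show ?thesis unfolding tsh_def .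
qed

text \<open>The defect \<open>Z\<close> changes sign when one unit moves from the first index to the
  second, and it vanishes for negative second index; hence it is 0. This is
  \<open>shift_pair\<close> for single coefficients of the vertex operator.\<close>

lemma shift_qsym2:
  "shift (qsym2 a b) = [:qsym2 a b:] + tsh a * [:qsym b:] - tsh b * [:qsym a:]"
proof -
  define Z where "Z a b = shift (qsym2 a b) - [:qsym2 a b:] - tsh a * [:qsym b:] + tsh b * [:qsym a:]" for a b
  have step: "Z (a - 1) b + Z a (b - 1) = 0" for a b
  proof -
    let ?q = "\<lambda>a. [:qsym a:]"
    have sh: "shift (qsym a) = ?q a + tsh a" for a by (simp add: tsh_def)
    have "shift (qsym2 (a - 1) b) + shift (qsym2 a (b - 1)) =
        (?q (a - 1) + tsh (a - 1)) * (?q b + tsh b) - (?q a + tsh a) * (?q (b - 1) + tsh (b - 1))"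
      unfolding sh[symmetric] shift_mult[symmetric] shift_diff[symmetric] qsym2_rec[symmetric] shift_add ..
    moreover have "[:qsym2 (a - 1) b:] + [:qsym2 a (b - 1):] = ?q (a - 1) * ?q b - ?q a * ?q (b - 1)"
    proof -
      have "[:qsym2 (a - 1) b:] + [:qsym2 a (b - 1):] = [:qsym (a - 1) * qsym b - qsym a * qsym (b - 1):]"
        unfolding qsym2_rec[symmetric] by simp
      thus ?thesis by simp
    qed
    \<comment> \<open>\<open>tsh_rec\<close> becomes applicable after multiplication by w, so the
      identity is first shown with this factor, which is then cancelled.\<close>
    moreover have "w * ((S1 - c1 - ta' * qb + tb * qa') + (S2 - c2 - ta * qb' + tb' * qa)) = 0"
      if "S1 + S2 = (qa' + ta') * (qb + tb) - (qa + ta) * (qb' + tb')" "c1 + c2 = qa' * qb - qa * qb'"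
        "w * (2 * qa' + ta') = - ta" "w * (2 * qb' + tb') = - tb"
      for w S1 S2 c1 c2 qa qa' qb qb' ta ta' tb tb' :: "Lam poly"
    proof -
      have "(S1 - c1 - ta' * qb + tb * qa') + (S2 - c2 - ta * qb' + tb' * qa) =
          (S1 + S2) - (c1 + c2) - ta' * qb + tb * qa' - ta * qb' + tb' * qa"
        by (simp add: algebra_simps)
      also have "\<dots> = (2 * qa' + ta') * tb - ta * (2 * qb' + tb')"
        unfolding that(1,2) by (simp add: algebra_simps)
      finally have "w * ((S1 - c1 - ta' * qb + tb * qa') + (S2 - c2 - ta * qb' + tb' * qa)) =
          w * ((2 * qa' + ta') * tb - ta * (2 * qb' + tb'))"
        by (rule arg_cong)
      also have "\<dots> = (w * (2 * qa' + ta')) * tb - ta * (w * (2 * qb' + tb'))"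
        by (simp only: right_diff_distrib mult_ac)
      finally show ?thesis unfolding that(3,4) by simp
    qed
    ultimately have "ww * (Z (a - 1) b + Z a (b - 1)) = 0"
      unfolding Z_def using tsh_rec by blast
    thus ?thesis by (simp add: ww_def)
  qed
  have neg: "Z a b = 0" if "b < 0" for a b
    using that by (simp add: Z_def qsym2_neg qsym_neg tsh_def)
  have "Z a (int n - 1) = 0" for n a
  proof (induction n arbitrary: a)
    case (Suc n)
    have "Z a (int n) = - Z (a + 1) (int n - 1)"
      using step[of "a + 1" "int n"] by (simp add: add_eq_0_iff2)
    thus ?case using Suc.IH by simp
  qed (simp add: neg)
  from this[of a "nat (b + 1)"] neg[of b a] have "Z a b = 0"
    by (cases "b < 0") auto
  thus ?thesis unfolding Z_def by (simp add: algebra_simps)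
qed

section \<open>The operators \<open>Gamma_tilde\<close>\<close>

text \<open>The value at w^k of the functional that represents \<open>Gamma_tilde A (- a)\<close>;
  see \<open>Gamma_tilde_eq_lin\<close>. If row \<open>- a\<close> vanishes far to the left, the sum
  is finite because \<open>qsym\<close> vanishes at negative arguments.\<close>

definition rowq :: "(int \<Rightarrow> int \<Rightarrow> complex) \<Rightarrow> int \<Rightarrow> nat \<Rightarrow> Lam" where
  "rowq A a k = Sum_any (\<lambda>j. cst (A (- a) j) * qsym (int k - j))"

lemma rowq_eq:
  assumes "\<And>j. j < N \<Longrightarrow> A (- a) j = 0" "int k \<le> D"
  shows "rowq A a k = (\<Sum>j\<in>{N..D}. cst (A (- a) j) * qsym (int k - j))"
  unfolding rowq_def
proof (rule Sum_any.expand_superset)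
  show "{j. cst (A (- a) j) * qsym (int k - j) \<noteq> 0} \<subseteq> {N..D}"
  proof
    fix j assume "j \<in> {j. cst (A (- a) j) * qsym (int k - j) \<noteq> 0}"
    hence "A (- a) j \<noteq> 0" "qsym (int k - j) \<noteq> 0" by auto
    thus "j \<in> {N..D}" using assms qsym_neg[of "int k - j"] by (cases "j < N"; cases "int k - j < 0") auto
  qed
qed simp

text \<open>Any bound \<open>D\<close> on the degree is allowed, so that several polynomials can
  share one range of summation.\<close>

lemma lin_rowq:
  assumes "\<And>j. j < N \<Longrightarrow> A (- a) j = 0" "int (degree p) \<le> D"
  shows "lin (rowq A a) p = (\<Sum>j\<in>{N..D}. cst (A (- a) j) * gam (- j) p)"
proof -
  have "lin (rowq A a) p =
      (\<Sum>k\<le>degree p. (\<Sum>j\<in>{N..D}. cst (A (- a) j) * qsym (int k - j)) * coeff p k)"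
    unfolding lin_def
    by (intro sum.cong refl arg_cong2[of _ _ _ _ times] rowq_eq) (use assms in auto)
  also have "\<dots> = (\<Sum>j\<in>{N..D}. cst (A (- a) j) * gam (- j) p)"
    unfolding sum_distrib_right gam_def lin_def sum_distrib_left
    by (subst sum.swap) (simp add: algebra_simps)
  finally show ?thesis .
qed

lemma Gamma_tilde_eq_lin:
  assumes "\<And>j. j < N \<Longrightarrow> A (- a) j = 0"
  shows "Gamma_tilde A (- a) f = lin (rowq A a) (shift f)"
proof -
  have "Gamma_tilde A (- a) f = (\<Sum>j\<in>{N..int (degree (shift f))}. cst (A (- a) j) * gam (- j) (shift f))"
    unfolding Gamma_tilde_def Gamma_def Gamma_ser_eq_gam
  proof (rule Sum_any.expand_superset)
    show "{j. cst (A (- a) j) * gam (- j) (shift f) \<noteq> 0} \<subseteq> {N..int (degree (shift f))}"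
    proof
      fix j assume "j \<in> {j. cst (A (- a) j) * gam (- j) (shift f) \<noteq> 0}"
      hence "A (- a) j \<noteq> 0" "gam (- j) (shift f) \<noteq> 0" by auto
      thus "j \<in> {N..int (degree (shift f))}"
        using assms gam_eq_0[of "- j" "shift f"] by force
    qed
  qed simp
  thus ?thesis using lin_rowq[of N A a "shift f", OF assms order_refl] by simp
qed

locale row_finite =
  fixes A :: "int \<Rightarrow> int \<Rightarrow> complex"
  assumes rows: "\<forall>i. \<exists>N. \<forall>j<N. A i j = 0"
begin

lemma Gamma_tilde_lin: "Gamma_tilde A (- a) f = lin (rowq A a) (shift f)"
  using rows Gamma_tilde_eq_lin by meson

lemma degree_shift_qsym: "degree (shift (qsym r)) \<le> nat r"
  by (rule degree_le) (auto simp: coeff_shift_qsym qsym_neg)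

text \<open>\<open>shift_pair\<close> is bilinear in the two rows, which reduces it to
  \<open>shift_qsym2\<close>.\<close>

sublocale vertex_family "rowq A"
proof
  fix x y
  obtain N where N: "\<And>j. j < N \<Longrightarrow> A (- x) j = 0" using rows by blast
  obtain N' where N': "\<And>j. j < N' \<Longrightarrow> A (- y) j = 0" using rows by blast
  \<comment> \<open>One bound for everything: for \<open>j \<ge> N'\<close> the degree of
    \<open>shift (qsym (- j))\<close> is at most \<open>max 0 (- N')\<close>, and 0 is the index in
    \<open>rowq A x 0\<close>.\<close>
  define D where "D = max 0 (- N')"
  let ?I = "{N..D}" and ?J = "{N'..D}"
  let ?c = "\<lambda>j. cst (A (- x) j)" and ?d = "\<lambda>j. cst (A (- y) j)"
  have x: "rowq A x 0 = (\<Sum>i\<in>?I. ?c i * qsym (- i))"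
    by (subst rowq_eq[of N A x _ D, OF N]) (auto simp: D_def)
  have y: "rowq A y 0 = (\<Sum>j\<in>?J. ?d j * qsym (- j))"
    by (subst rowq_eq[of N' A y _ D, OF N']) (auto simp: D_def)
  have "lin (rowq A x) (shift (rowq A y 0)) = (\<Sum>j\<in>?J. ?d j * lin (rowq A x) (shift (qsym (- j))))"
    unfolding y shift_sum lin_sum shift_cst_mult lin_smult ..
  also have "\<dots> = (\<Sum>j\<in>?J. \<Sum>i\<in>?I. ?c i * (?d j * qsym2 (- i) (- j)))"
  proof (rule sum.cong)
    fix j assume j: "j \<in> ?J"
    have "lin (rowq A x) (shift (qsym (- j))) = (\<Sum>i\<in>?I. ?c i * gam (- i) (shift (qsym (- j))))"
      by (rule lin_rowq[of N A x, OF N]) (use j degree_shift_qsym[of "- j"] in \<open>auto simp: D_def\<close>)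
    thus "?d j * lin (rowq A x) (shift (qsym (- j))) = (\<Sum>i\<in>?I. ?c i * (?d j * qsym2 (- i) (- j)))"
      by (simp add: gam_shift_qsym sum_distrib_left mult_ac)
  qed simp
  also have "\<dots> = (\<Sum>i\<in>?I. \<Sum>j\<in>?J. ?c i * (?d j * qsym2 (- i) (- j)))"
    by (rule sum.swap)
  finally have xy: "lin (rowq A x) (shift (rowq A y 0)) =
      (\<Sum>i\<in>?I. \<Sum>j\<in>?J. ?c i * (?d j * qsym2 (- i) (- j)))" .
  have const: "[:sum f S:] = (\<Sum>i\<in>S. [:f i:])" for f :: "int \<Rightarrow> Lam" and S
    by (rule sum_const_poly[symmetric])
  have const_mult: "[:a * b:] = [:a:] * [:b:]" for a b :: Lam by simp
  have tx: "shift (rowq A x 0) - [:rowq A x 0:] = (\<Sum>i\<in>?I. [:?c i:] * tsh (- i))"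
    unfolding x shift_sum const sum_subtractf[symmetric] tsh_def
    by (intro sum.cong refl) (simp add: shift_cst_mult smult_diff_right)
  have ty: "shift (rowq A y 0) - [:rowq A y 0:] = (\<Sum>j\<in>?J. [:?d j:] * tsh (- j))"
    unfolding y shift_sum const sum_subtractf[symmetric] tsh_def
    by (intro sum.cong refl) (simp add: shift_cst_mult smult_diff_right)
  have cx: "[:rowq A x 0:] = (\<Sum>i\<in>?I. [:?c i:] * [:qsym (- i):])"
    unfolding x const const_mult ..
  have cy: "[:rowq A y 0:] = (\<Sum>j\<in>?J. [:?d j:] * [:qsym (- j):])"
    unfolding y const const_mult ..
  have p1: "(shift (rowq A x 0) - [:rowq A x 0:]) * [:rowq A y 0:] =
      (\<Sum>i\<in>?I. \<Sum>j\<in>?J. [:?c i:] * ([:?d j:] * (tsh (- i) * [:qsym (- j):])))"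
    unfolding tx cy sum_product by (simp only: mult.assoc mult.left_commute)
  have p2: "(shift (rowq A y 0) - [:rowq A y 0:]) * [:rowq A x 0:] =
      (\<Sum>i\<in>?I. \<Sum>j\<in>?J. [:?c i:] * ([:?d j:] * (tsh (- j) * [:qsym (- i):])))"
    unfolding ty cx sum_product by (subst sum.swap) (simp only: mult.assoc mult.left_commute)
  have p0: "[:lin (rowq A x) (shift (rowq A y 0)):] =
      (\<Sum>i\<in>?I. \<Sum>j\<in>?J. [:?c i:] * ([:?d j:] * [:qsym2 (- i) (- j):]))"
    unfolding xy const const_mult ..
  show "shift (lin (rowq A x) (shift (rowq A y 0))) = [:lin (rowq A x) (shift (rowq A y 0)):] +
     (shift (rowq A x 0) - [:rowq A x 0:]) * [:rowq A y 0:] -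
     (shift (rowq A y 0) - [:rowq A y 0:]) * [:rowq A x 0:]"
    unfolding p0 p1 p2 sum.distrib[symmetric] sum_subtractf[symmetric]
      distrib_left[symmetric] right_diff_distrib[symmetric] shift_qsym2[symmetric]
    unfolding xy shift_sum shift_mult shift_cst ..
qed

lemma Q_tilde_eq_Qf: "Q_tilde A lam = Qf lam"
  by (induction lam) (simp_all add: Q_tilde_def Gamma_tilde_lin)

end

section \<open>Finite expansions\<close>

lemma has_finite_sumI:
  assumes "finite T" "T \<subseteq> S" "\<And>x. x \<in> S \<Longrightarrow> x \<notin> T \<Longrightarrow> F x = 0" "s = sum F T"
  shows "has_finite_sum F S s"
proof -
  have sub: "{x \<in> S. F x \<noteq> 0} \<subseteq> T" using assms(3) by blast
  have "sum F T = sum F {x \<in> S. F x \<noteq> 0}"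
    by (rule sum.mono_neutral_right) (use assms sub in auto)
  thus ?thesis using assms(1,4) finite_subset[OF sub] by (simp add: has_finite_sum_def)
qed

lemma Gamma_ser_cst_mult: "Gamma_ser (cst c * f) a = cst c * Gamma_ser f a"
  by (simp add: Gamma_ser_eq_gam shift_cst_mult gam_smult)

lemma Gamma_ser_0 [simp]: "Gamma_ser 0 a = 0"
  by (simp add: Gamma_ser_eq_gam)

lemma Gamma_ser_sum: "Gamma_ser (sum f S) a = (\<Sum>x\<in>S. Gamma_ser (f x) a)"
  by (simp add: Gamma_ser_eq_gam shift_sum gam_sum)

lemma calQ_pair: "calQ [k, r] = qsym2 k r"
proof -
  have "calQ [r] = qsym r" by (simp add: Gamma_ser_eq_gam gam_def)
  thus ?thesis by (simp add: Gamma_ser_eq_gam gam_shift_qsym)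
qed

context row_finite
begin

text \<open>By induction on \<open>lam\<close>. A new first exponent is bounded above because the
  row of \<open>A\<close> starts somewhere, and below because the vertex operator kills large
  negative exponents on the finitely many terms already present.\<close>

lemma Q_tilde_has_finite_sum:
  "has_finite_sum (\<lambda>\<alpha>. cst (\<Prod>i<length lam. A (- lam ! i) (- \<alpha> ! i)) * calQ \<alpha>)
     (Zvec (length lam)) (Q_tilde A lam)"
proof (induction lam)
  case Nil
  show ?case
    by (rule has_finite_sumI[of "{[]}"]) (auto simp: Zvec_def Q_tilde_def)
next
  case (Cons a lam)
  define F where "F lam \<alpha> = cst (\<Prod>i<length lam. A (- lam ! i) (- \<alpha> ! i)) * calQ \<alpha>" for lam \<alpha>
  define S where "S = {\<beta> \<in> Zvec (length lam). F lam \<beta> \<noteq> 0}"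
  have S: "finite S" "Q_tilde A lam = sum (F lam) S"
    using Cons.IH by (simp_all add: has_finite_sum_def F_def S_def)
  have F_Cons: "F (a # lam) (b # \<beta>) = cst (A (- a) (- b)) * Gamma_ser (F lam \<beta>) b" for b \<beta>
    by (simp add: F_def prod.lessThan_Suc_shift cst_mult Gamma_ser_cst_mult mult.assoc
        del: prod.lessThan_Suc)
  obtain N where N: "\<And>j. j < N \<Longrightarrow> A (- a) j = 0" using rows by blast
  \<comment> \<open>The sum of the degrees is a crude common bound for them.\<close>
  define D where "D = (\<Sum>\<beta>\<in>S. int (degree (shift (F lam \<beta>))))"
  have D: "int (degree (shift (F lam \<beta>))) \<le> D" if "\<beta> \<in> S" for \<beta>
    unfolding D_def by (rule member_le_sum) (use that S in auto)
  let ?T = "(\<lambda>(b, \<beta>). b # \<beta>) ` ({- D..- N} \<times> S)"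
  have "has_finite_sum (F (a # lam)) (Zvec (Suc (length lam))) (Q_tilde A (a # lam))"
  proof (rule has_finite_sumI[of ?T])
    show "finite ?T" using S by simp
    show "?T \<subseteq> Zvec (Suc (length lam))" by (auto simp: S_def Zvec_def)
  next
    fix \<alpha> assume \<alpha>: "\<alpha> \<in> Zvec (Suc (length lam))" "\<alpha> \<notin> ?T"
    then obtain b \<beta> where b: "\<alpha> = b # \<beta>" "\<beta> \<in> Zvec (length lam)"
      by (cases \<alpha>) (auto simp: Zvec_def)
    show "F (a # lam) \<alpha> = 0"
    proof (cases "\<beta> \<in> S")
      case False
      thus ?thesis using b by (simp add: F_Cons S_def)
    next
      case True
      hence "b \<notin> {- D..- N}" using \<alpha>(2) b by auto
      thus ?thesis
        using N[of "- b"] gam_eq_0[of b "shift (F lam \<beta>)"] D[OF True]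
        unfolding b F_Cons Gamma_ser_eq_gam by force
    qed
  next
    have "Q_tilde A (a # lam) = lin (rowq A a) (shift (sum (F lam) S))"
      using Gamma_tilde_lin by (simp add: Q_tilde_def flip: S(2)[unfolded Q_tilde_def])
    also have "\<dots> = (\<Sum>\<beta>\<in>S. \<Sum>j\<in>{N..D}. cst (A (- a) j) * gam (- j) (shift (F lam \<beta>)))"
      unfolding shift_sum lin_sum by (intro sum.cong refl lin_rowq N D)
    also have "\<dots> = (\<Sum>\<beta>\<in>S. \<Sum>b\<in>{- D..- N}. F (a # lam) (b # \<beta>))"
      unfolding F_Cons Gamma_ser_eq_gam
      by (intro sum.cong refl sum.reindex_bij_witness[of _ uminus uminus]) auto
    also have "\<dots> = (\<Sum>(b, \<beta>)\<in>{- D..- N} \<times> S. F (a # lam) (b # \<beta>))"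
      by (subst sum.swap) (simp add: sum.cartesian_product)
    also have "\<dots> = sum (F (a # lam)) ?T"
      by (subst sum.reindex) (auto simp: inj_on_def case_prod_unfold)
    finally show "Q_tilde A (a # lam) = sum (F (a # lam)) ?T" .
  qed
  thus ?case unfolding F_def[symmetric] by simp
qed

text \<open>Length two of the finite expansion, reindexed from lists to pairs; these values are the
  entries of the Pfaffian.\<close>

lemma Q_tilde_pair:
  shows "finite {(k, r). cst (A (- a) (- k) * A (- b) (- r)) * qsym2 k r \<noteq> 0}" (is ?fin)
    and "Q_tilde A [a, b] = (\<Sum>(k, r). cst (A (- a) (- k) * A (- b) (- r)) * qsym2 k r)" (is ?sum)
proof -
  let ?F = "\<lambda>\<alpha>. cst (\<Prod>i<length [a, b]. A (- [a, b] ! i) (- \<alpha> ! i)) * calQ \<alpha>"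
  let ?G = "\<lambda>(k, r). cst (A (- a) (- k) * A (- b) (- r)) * qsym2 k r"
  let ?p = "\<lambda>(k, r). [k, r :: int]"
  have FG: "?F (?p x) = ?G x" for x
    by (cases x) (simp add: calQ_pair lessThan_Suc numeral_2_eq_2 mult.commute del: calQ.simps)
  have img: "{\<alpha> \<in> Zvec (length [a, b]). ?F \<alpha> \<noteq> 0} = ?p ` {x. ?G x \<noteq> 0}"
  proof (intro equalityI subsetI)
    fix \<alpha> assume \<alpha>: "\<alpha> \<in> {\<alpha> \<in> Zvec (length [a, b]). ?F \<alpha> \<noteq> 0}"
    then obtain k r where "\<alpha> = ?p (k, r)"
      by (auto simp: Zvec_def length_Suc_conv numeral_2_eq_2)
    thus "\<alpha> \<in> ?p ` {x. ?G x \<noteq> 0}" using \<alpha> FG[of "(k, r)"]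
      by (intro image_eqI[of _ _ "(k, r)"]) auto
  next
    fix \<alpha> assume "\<alpha> \<in> ?p ` {x. ?G x \<noteq> 0}"
    then obtain x where "\<alpha> = ?p x" "?G x \<noteq> 0" by blast
    thus "\<alpha> \<in> {\<alpha> \<in> Zvec (length [a, b]). ?F \<alpha> \<noteq> 0}"
      using FG[of x] by (cases x) (auto simp: Zvec_def)
  qed
  have inj: "inj_on ?p X" for X by (auto simp: inj_on_def)
  note s = Q_tilde_has_finite_sum[of "[a, b]", unfolded has_finite_sum_def img]
  from s have fin: "finite {x. ?G x \<noteq> 0}" using finite_imageD[OF _ inj] by blast
  have "{(k, r). cst (A (- a) (- k) * A (- b) (- r)) * qsym2 k r \<noteq> 0} = {x. ?G x \<noteq> 0}" by auto
  thus ?fin using fin by simp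
  have "Q_tilde A [a, b] = sum ?F (?p ` {x. ?G x \<noteq> 0})" using s by simp
  also have "\<dots> = (\<Sum>x\<in>{x. ?G x \<noteq> 0}. ?G x)"
    by (subst sum.reindex[OF inj]) (simp only: o_def FG)
  finally show ?sum by (simp add: Sum_any.expand_set)
qed

lemma Q_tilde_Pfaffian:
  assumes "length lam = 2 * l"
  shows "Q_tilde A lam = Pfaffian l (\<lambda>i j.
         \<Sum>(k, r). cst (A (- lam ! i) (- k) * A (- lam ! j) (- r)) * qsym2 k r)"
  using Qf_Pfaffian[OF assms] by (simp only: Q_tilde_eq_Qf[symmetric] Q_tilde_pair(2))

end

text \<open>Both sides are ring homomorphisms in \<open>f\<close>. On a power sum the last summand
  is a positive power of the variable set to 0, and it disappears.\<close>

lemma lam_spec_stable: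
  "psubst (\<lambda>i. if i = n then 0 else var i) (lam_spec (Suc n) f) = lam_spec n f"
proof (induction f rule: cpoly_induct)
  case (cst c)
  thus ?case by (simp add: lam_spec_def)
next
  case (var i f)
  have "psubst (\<lambda>i. if i = n then 0 else var i) (\<Sum>j<Suc n. var j ^ Suc i) = (\<Sum>j<n. var j ^ Suc i)"
    by (simp add: psubst_sum psubst_power psubst_mult psubst_add)
  thus ?case using var by (simp add: lam_spec_def psubst_mult del: sum.lessThan_Suc)
next
  case (add f g)
  thus ?case by (simp add: lam_spec_def psubst_add)
qed

section \<open>Weights under the vertex operators\<close>

definition homog :: "nat \<Rightarrow> Lam \<Rightarrow> bool" where
  "homog d f \<longleftrightarrow> (\<forall>m\<in>Poly_Mapping.keys f. wt m = d)"

lemma homog_mult: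
  assumes "homog a f" "homog b g"
  shows "homog (a + b) (f * g)"
  unfolding homog_def
proof
  fix m assume "m \<in> Poly_Mapping.keys (f * g)"
  then obtain x y where "m = x + y" "x \<in> Poly_Mapping.keys f" "y \<in> Poly_Mapping.keys g"
    using keys_mult by blast
  thus "wt m = a + b" using assms by (auto simp: homog_def wt_add)
qed

lemma homog_0: "homog d 0"
  by (simp add: homog_def)

lemma homog_add: "homog d f \<Longrightarrow> homog d g \<Longrightarrow> homog d (f + g)"
  using Poly_Mapping.keys_add[of f g] by (auto simp: homog_def)

lemma homog_sum: "(\<And>x. x \<in> S \<Longrightarrow> homog d (f x)) \<Longrightarrow> homog d (sum f S)"
  by (induction S rule: infinite_finite_induct) (auto intro: homog_0 homog_add)

lemma homog_cst: "homog 0 (cst c)"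
  by (cases "c = 0") (auto simp: homog_def cst_def)

lemma homog_psym: "homog (Suc i) (psym (Suc i))"
  by (simp add: homog_def psym_def var_def)

lemma homog_hsym: "homog k (hsym k)"
proof (induction k rule: less_induct)
  case (less k)
  show ?case
  proof (cases k)
    case 0
    thus ?thesis using homog_cst[of 1] by simp
  next
    case (Suc n)
    have "homog (Suc n) (psym (Suc i) * hsym (n - i))" if "i \<le> n" for i
    proof -
      have "homog (Suc i + (n - i)) (psym (Suc i) * hsym (n - i))"
        by (intro homog_mult[OF homog_psym] less.IH) (use Suc in simp)
      thus ?thesis using that by simp
    qed
    hence "homog (0 + Suc n) (hsym (Suc n))"
      unfolding hsym.simps by (intro homog_mult[OF homog_cst] homog_sum) simp
    thus ?thesis unfolding Suc by (simp only: add_0)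
  qed
qed

lemma homog_esym: "homog k (esym k)"
proof (induction k rule: less_induct)
  case (less k)
  show ?case
  proof (cases k)
    case 0
    thus ?thesis using homog_cst[of 1] by simp
  next
    case (Suc n)
    have "homog 0 ((-1) ^ i)" for i
    proof -
      have "cst ((-1) ^ i) = (-1) ^ i" by (induction i) (simp_all add: cst_mult cst_uminus)
      thus ?thesis using homog_cst by metis
    qed
    hence "homog (0 + Suc i + (n - i)) ((-1) ^ i * psym (Suc i) * esym (n - i))" if "i \<le> n" for i
      by (intro homog_mult homog_psym less.IH) (use that Suc in auto)
    hence "homog (Suc n) ((-1) ^ i * psym (Suc i) * esym (n - i))" if "i \<le> n" for i
      using that by simp
    hence "homog (0 + Suc n) (esym (Suc n))"
      unfolding esym.simps by (intro homog_mult[OF homog_cst] homog_sum) simp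
    thus ?thesis unfolding Suc by (simp only: add_0)
  qed
qed

text \<open>The bound is an integer because the indices of vertex operators may be negative.\<close>

definition wt_ge :: "int \<Rightarrow> Lam \<Rightarrow> bool" where
  "wt_ge D f \<longleftrightarrow> (\<forall>m\<in>Poly_Mapping.keys f. D \<le> int (wt m))"

lemma wt_ge_mult:
  assumes "wt_ge a f" "wt_ge b g"
  shows "wt_ge (a + b) (f * g)"
  unfolding wt_ge_def
proof
  fix m assume "m \<in> Poly_Mapping.keys (f * g)"
  then obtain x y where "m = x + y" "x \<in> Poly_Mapping.keys f" "y \<in> Poly_Mapping.keys g"
    using keys_mult by blast
  thus "a + b \<le> int (wt m)" using assms by (force simp: wt_ge_def wt_add)
qed

lemma wt_ge_sum: "(\<And>x. x \<in> S \<Longrightarrow> wt_ge d (f x)) \<Longrightarrow> wt_ge d (sum f S)"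
proof (induction S rule: infinite_finite_induct)
  case (insert x F)
  thus ?case using Poly_Mapping.keys_add[of "f x" "sum f F"] unfolding wt_ge_def by auto
qed (simp_all add: wt_ge_def)

lemma wt_ge_qsym: "wt_ge a (qsym a)"
proof (cases "a < 0")
  case False
  have "homog (nat a) (esym i * hsym (nat a - i))" if "i \<le> nat a" for i
    using homog_mult[OF homog_esym[of i] homog_hsym[of "nat a - i"]] that by simp
  hence "homog (nat a) (qsym a)"
    unfolding qsym_def fps_mult_nth using False by (auto intro!: homog_sum)
  thus ?thesis using False by (simp add: wt_ge_def homog_def)
qed (simp add: wt_ge_def qsym_neg)

text \<open>Up to sign, \<open>coeff (shift f) k\<close> is the image of \<open>f\<close> under the adjoint of \<open>esym k\<close>, which has weight \<open>k\<close>.\<close>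

lemma wt_ge_coeff_shift:
  assumes "wt_ge D f"
  shows "wt_ge (D - int k) (coeff (shift f) k)"
  unfolding wt_ge_def
proof
  fix n assume "n \<in> Poly_Mapping.keys (coeff (shift f) k)"
  hence "lam_scalar (coeff (shift f) k) (Poly_Mapping.single n 1) \<noteq> 0"
    by (simp add: lam_scalar_single zee_nonzero in_keys_iff)
  hence "lam_scalar f (esym k * Poly_Mapping.single n 1) \<noteq> 0"
    by (simp add: lam_scalar_coeff_shift)
  then obtain m where m: "m \<in> Poly_Mapping.keys f"
    "Poly_Mapping.lookup (esym k * Poly_Mapping.single n 1) m \<noteq> 0"
    unfolding lam_scalar_def by (metis (no_types, lifting) mult_zero_left mult_zero_right sum.neutral)
  have "homog (k + wt n) (esym k * Poly_Mapping.single n 1)"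
    by (intro homog_mult homog_esym) (simp add: homog_def)
  hence "wt m = k + wt n" using m(2) by (simp add: homog_def in_keys_iff)
  thus "D - int k \<le> int (wt n)" using assms m(1) by (force simp: wt_ge_def)
qed

text \<open>In the k-th summand the factors have weights at least \<open>a + k\<close> and
  \<open>D - k\<close>, and the sum of these bounds is independent of k.\<close>

lemma wt_ge_Gamma_ser:
  assumes "wt_ge D f"
  shows "wt_ge (a + D) (Gamma_ser f a)"
  unfolding Gamma_ser_eq_gam gam_def lin_def
proof (rule wt_ge_sum)
  fix k
  show "wt_ge (a + D) (qsym (a + int k) * coeff (shift f) k)"
    using wt_ge_mult[OF wt_ge_qsym[of "a + int k"] wt_ge_coeff_shift[OF assms, of k]] by simp
qed

section \<open>Inversion\<close>

lemma has_iterated_sum_cong: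
  assumes "\<And>v. length v = l \<Longrightarrow> F v = G v"
  shows "has_iterated_sum l F s \<longleftrightarrow> has_iterated_sum l G s"
  using assms
proof (induction l arbitrary: F G s)
  case (Suc l)
  have "has_iterated_sum l (\<lambda>v. F (v @ [k])) t \<longleftrightarrow> has_iterated_sum l (\<lambda>v. G (v @ [k])) t" for k t
    by (rule Suc.IH) (simp add: Suc.prems)
  thus ?case by simp
qed simp

text \<open>Fubini for unordered sums, splitting off the last entry: once the unordered sum exists,
  it has the value of the iterated one. Hence \<open>has_formal_sum\<close> only requires the
  iterated sum.\<close>

lemma has_iterated_sum_imp_has_sum:
  assumes "has_iterated_sum l F s"
    and "(\<lambda>v. Poly_Mapping.lookup (F v) m) summable_on Zvec l"
  shows "((\<lambda>v. Poly_Mapping.lookup (F v) m) has_sum Poly_Mapping.lookup s m) (Zvec l)"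
  using assms
proof (induction l arbitrary: F s)
  case 0
  have "Zvec 0 = {[]}" by (auto simp: Zvec_def)
  thus ?case using 0 by (simp add: has_sum_finite_iff)
next
  case (Suc l)
  from Suc.prems(1) obtain G where G: "\<And>k. has_iterated_sum l (\<lambda>v. F (v @ [k])) (G k)"
    "((\<lambda>k. Poly_Mapping.lookup (G k) m) has_sum Poly_Mapping.lookup s m) UNIV"
    by auto
  let ?p = "\<lambda>(k, v). v @ [k :: int]"
  let ?f = "\<lambda>v. Poly_Mapping.lookup (F v) m"
  have bij: "bij_betw ?p (UNIV \<times> Zvec l) (Zvec (Suc l))"
    by (rule bij_betwI[where g = "\<lambda>v. (last v, butlast v)"])
      (auto simp: Zvec_def length_Suc_conv_rev)
  have "(\<lambda>x. ?f (?p x)) summable_on UNIV \<times> Zvec l"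
    using summable_on_reindex_bij_betw[OF bij, of ?f] Suc.prems(2) by simp
  then obtain t where t: "((\<lambda>x. ?f (?p x)) has_sum t) (UNIV \<times> Zvec l)"
    by (auto simp: summable_on_def)
  hence "(\<lambda>(k, v). ?f (v @ [k])) summable_on Sigma UNIV (\<lambda>_. Zvec l)"
    by (auto simp: summable_on_def case_prod_unfold)
  hence "(\<lambda>v. ?f (v @ [k])) summable_on Zvec l" for k
    by (rule summable_on_SigmaD1) simp
  hence "((\<lambda>v. ?f (v @ [k])) has_sum Poly_Mapping.lookup (G k) m) (Zvec l)" for k
    by (intro Suc.IH G)
  hence "((\<lambda>k. Poly_Mapping.lookup (G k) m) has_sum t) UNIV"
    by (intro has_sum_Sigma'[OF t]) simp
  hence "t = Poly_Mapping.lookup s m" using G(2) has_sum_unique by blast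
  thus ?case using t has_sum_reindex_bij_betw[OF bij, of ?f] by simp
qed

lemma has_formal_sumI: "has_iterated_sum l F s \<Longrightarrow> has_formal_sum l F s"
  by (simp add: has_formal_sum_def has_iterated_sum_imp_has_sum)

section \<open>Recovering compositions of vertex operators from \<open>Gamma_tilde\<close>\<close>

lemma has_sum_sum:
  fixes f :: "'a \<Rightarrow> 'b \<Rightarrow> 'c :: topological_comm_monoid_add"
  assumes "finite J" "\<And>j. j \<in> J \<Longrightarrow> (f j has_sum s j) S"
  shows "((\<lambda>x. \<Sum>j\<in>J. f j x) has_sum (\<Sum>j\<in>J. s j)) S"
  using assms by (induction J) (auto intro: has_sum_add)

text \<open>\<open>calQ\<close> with 1 replaced by an arbitrary \<open>f\<close>: the inversion
  peels off the innermost operator, which then acts on \<open>f\<close>.\<close>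

definition Gammas :: "int list \<Rightarrow> Lam \<Rightarrow> Lam" where
  "Gammas \<alpha> f = foldr (\<lambda>a g. Gamma_ser g a) \<alpha> f"

lemma Gammas_simps: "Gammas [] f = f" "Gammas (a # \<alpha>) f = Gamma_ser (Gammas \<alpha> f) a"
  "Gammas (\<alpha> @ [a]) f = Gammas \<alpha> (Gamma_ser f a)"
  by (simp_all add: Gammas_def)

lemma Gammas_1: "Gammas \<alpha> 1 = calQ \<alpha>"
  by (induction \<alpha>) (simp_all add: Gammas_simps)

lemma Gammas_cst_mult: "Gammas \<alpha> (cst c * f) = cst c * Gammas \<alpha> f"
  by (induction \<alpha>) (simp_all add: Gammas_simps Gamma_ser_cst_mult)

lemma Gammas_sum: "Gammas \<alpha> (sum f S) = (\<Sum>x\<in>S. Gammas \<alpha> (f x))"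
  by (induction \<alpha>) (simp_all add: Gammas_simps Gamma_ser_sum)

lemma wt_ge_Gammas: "wt_ge D f \<Longrightarrow> wt_ge (sum_list \<alpha> + D) (Gammas \<alpha> f)"
  by (induction \<alpha>) (auto simp: Gammas_simps add.assoc intro: wt_ge_Gamma_ser)

lemma lookup_Gammas_eq_0:
  assumes "int (wt m) < sum_list \<alpha> + a"
  shows "Poly_Mapping.lookup (Gammas \<alpha> (Gamma_ser f a)) m = 0"
proof -
  have "wt_ge 0 f" by (simp add: wt_ge_def)
  from wt_ge_Gammas[OF wt_ge_Gamma_ser[OF this, of a], of \<alpha>] assms show ?thesis
    by (force simp: wt_ge_def in_keys_iff)
qed

context row_finite
begin

text \<open>Large \<open>j\<close> are excluded by the degree of \<open>shift f\<close>, and very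
  negative \<open>j\<close> because they raise the weight above that of \<open>m\<close>. The finite
  set \<open>J\<close> is the same for all rows \<open>i\<close>, so a sum over the rows can be
  exchanged with it.\<close>

lemma lookup_Gammas_Gamma_tilde:
  "\<exists>J. finite J \<and> (\<forall>j. Poly_Mapping.lookup (Gammas \<alpha> (Gamma_ser f (- j))) m \<noteq> 0 \<longrightarrow> j \<in> J) \<and>
     (\<forall>i. Poly_Mapping.lookup (Gammas \<alpha> (Gamma_tilde A i f)) m =
          (\<Sum>j\<in>J. A i j * Poly_Mapping.lookup (Gammas \<alpha> (Gamma_ser f (- j))) m))"
proof -
  define h where "h j = Poly_Mapping.lookup (Gammas \<alpha> (Gamma_ser f (- j))) m" for j
  define D where "D = int (degree (shift f))"
  define L where "L = sum_list \<alpha> - int (wt m)"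
  have h: "h j = 0" if "j \<notin> {L..D}" for j
  proof (cases "j < L")
    case True
    thus ?thesis unfolding h_def by (intro lookup_Gammas_eq_0) (simp add: L_def)
  next
    case False
    hence "Gamma_ser f (- j) = 0"
      unfolding Gamma_ser_eq_gam using that by (intro gam_eq_0) (simp add: D_def)
    \<comment> \<open>The instance with scalar 0 says that \<open>Gammas \<alpha> 0\<close> is
      0.\<close>
    thus ?thesis using Gammas_cst_mult[of \<alpha> 0 0] by (simp add: h_def)
  qed
  have "Poly_Mapping.lookup (Gammas \<alpha> (Gamma_tilde A i f)) m = (\<Sum>j\<in>{L..D}. A i j * h j)" for i
  proof -
    obtain N where N: "\<And>j. j < N \<Longrightarrow> A (- (- i)) j = 0" using rows by fastforce
    have "Gamma_tilde A i f = (\<Sum>j\<in>{N..D}. cst (A i j) * Gamma_ser f (- j))"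
      using Gamma_tilde_lin[of "- i" f] lin_rowq[of N A "- i" "shift f" D, OF N]
      by (simp add: D_def Gamma_ser_eq_gam)
    hence "Poly_Mapping.lookup (Gammas \<alpha> (Gamma_tilde A i f)) m = (\<Sum>j\<in>{N..D}. A i j * h j)"
      by (simp add: Gammas_sum Gammas_cst_mult lookup_sum h_def)
    also have "\<dots> = (\<Sum>j\<in>{min N L..D}. A i j * h j)"
      by (rule sum.mono_neutral_left) (use N in auto)
    also have "\<dots> = (\<Sum>j\<in>{L..D}. A i j * h j)"
      by (rule sum.mono_neutral_right) (use h in auto)
    finally show ?thesis .
  qed
  thus ?thesis using h unfolding h_def by (intro exI[of _ "{L..D}"]) blast
qed

lemma Gamma_tilde_cst_mult: "Gamma_tilde A i (cst c * f) = cst c * Gamma_tilde A i f"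
  using Gamma_tilde_lin[of "- i"] by (simp add: shift_cst_mult lin_smult)

lemma foldr_Gamma_tilde_cst_mult:
  "foldr (\<lambda>a. Gamma_tilde A (- a)) v (cst c * f) = cst c * foldr (\<lambda>a. Gamma_tilde A (- a)) v f"
  by (induction v) (simp_all add: Gamma_tilde_cst_mult)

text \<open>At a fixed monomial only the finitely many \<open>j\<close> in \<open>J\<close> matter,
  so the infinite sum over \<open>k\<close> moves inside the sum over \<open>j\<close>, where the
  left inverse yields a Kronecker delta.\<close>

lemma has_sum_inverse:
  assumes "is_left_inverse B A"
  shows "((\<lambda>k. Poly_Mapping.lookup (Gammas \<alpha> (cst (B (- b) (- k)) * Gamma_tilde A (- k) f)) m)
     has_sum Poly_Mapping.lookup (Gammas (\<alpha> @ [b]) f) m) UNIV"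
proof -
  obtain J where J: "finite J"
    "\<And>j. Poly_Mapping.lookup (Gammas \<alpha> (Gamma_ser f (- j))) m \<noteq> 0 \<Longrightarrow> j \<in> J"
    "\<And>i. Poly_Mapping.lookup (Gammas \<alpha> (Gamma_tilde A i f)) m =
          (\<Sum>j\<in>J. A i j * Poly_Mapping.lookup (Gammas \<alpha> (Gamma_ser f (- j))) m)"
    using lookup_Gammas_Gamma_tilde by meson
  let ?h = "\<lambda>j. Poly_Mapping.lookup (Gammas \<alpha> (Gamma_ser f (- j))) m"
  have bij: "bij_betw uminus (UNIV :: int set) UNIV"
    by (rule bij_betwI[where g = uminus]) auto
  have "((\<lambda>k. B (- b) (- k) * A (- k) j) has_sum (if - b = j then 1 else 0)) UNIV" for j
    using has_sum_reindex_bij_betw[OF bij, of "\<lambda>k. B (- b) k * A k j"] assms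
    unfolding is_left_inverse_def by blast
  hence "((\<lambda>k. \<Sum>j\<in>J. B (- b) (- k) * A (- k) j * ?h j) has_sum
        (\<Sum>j\<in>J. (if - b = j then 1 else 0) * ?h j)) UNIV"
    using J(1) by (intro has_sum_sum has_sum_cmult_left)
  also have "(\<lambda>k. \<Sum>j\<in>J. B (- b) (- k) * A (- k) j * ?h j) =
      (\<lambda>k. Poly_Mapping.lookup (Gammas \<alpha> (cst (B (- b) (- k)) * Gamma_tilde A (- k) f)) m)"
    by (simp add: Gammas_cst_mult J(3) sum_distrib_left mult.assoc)
  also have "(\<Sum>j\<in>J. (if - b = j then 1 else 0) * ?h j) = (\<Sum>j\<in>J. if j = - b then ?h j else 0)"
    by (intro sum.cong) auto
  \<comment> \<open>If \<open>- b\<close> is outside \<open>J\<close>, both sides are 0.\<close>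
  also have "\<dots> = ?h (- b)"
    using J(1) J(2)[of "- b"] by auto
  finally show ?thesis by (simp add: Gammas_simps)
qed

text \<open>With \<open>f\<close> arbitrary, the sum over the first entries is the induction
  hypothesis for a multiple of \<open>Gamma_tilde A (- k) f\<close>, and the remaining sum over the
  last entry \<open>k\<close> is \<open>has_sum_inverse\<close>.\<close>

lemma has_iterated_sum_inverse:
  assumes "is_left_inverse B A" "length \<alpha> = l"
  shows "has_iterated_sum l (\<lambda>v. cst (\<Prod>i<l. B (- \<alpha> ! i) (- v ! i)) *
     foldr (\<lambda>a. Gamma_tilde A (- a)) v f) (Gammas \<alpha> f)"
  using assms(2)
proof (induction l arbitrary: \<alpha> f)
  case 0
  thus ?case by (simp add: Gammas_simps)
next
  case (Suc l)
  then obtain \<beta> b where \<alpha>: "\<alpha> = \<beta> @ [b]" and len: "length \<beta> = l"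
    by (metis length_Suc_conv_rev)
  let ?G = "\<lambda>k. Gammas \<beta> (cst (B (- b) (- k)) * Gamma_tilde A (- k) f)"
  have "has_iterated_sum l (\<lambda>v. cst (\<Prod>i<Suc l. B (- \<alpha> ! i) (- (v @ [k]) ! i)) *
     foldr (\<lambda>a. Gamma_tilde A (- a)) (v @ [k]) f) (?G k)" for k
  proof (subst has_iterated_sum_cong)
    fix v :: "int list" assume v: "length v = l"
    have "(\<Prod>i<l. B (- \<alpha> ! i) (- (v @ [k]) ! i)) = (\<Prod>i<l. B (- \<beta> ! i) (- v ! i))"
      using v len by (intro prod.cong) (auto simp: \<alpha> nth_append)
    thus "cst (\<Prod>i<Suc l. B (- \<alpha> ! i) (- (v @ [k]) ! i)) *
        foldr (\<lambda>a. Gamma_tilde A (- a)) (v @ [k]) f =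
      cst (\<Prod>i<l. B (- \<beta> ! i) (- v ! i)) *
        foldr (\<lambda>a. Gamma_tilde A (- a)) v (cst (B (- b) (- k)) * Gamma_tilde A (- k) f)"
      using v len by (simp add: foldr_Gamma_tilde_cst_mult cst_mult \<alpha> nth_append mult.assoc)
  qed (rule Suc.IH[OF len])
  thus ?case
    using has_sum_inverse[OF assms(1), of \<beta> b f] unfolding has_iterated_sum.simps \<alpha>[symmetric]
    by (intro exI[of _ ?G]) blast
qed

lemma Q_tilde_has_formal_sum:
  assumes "is_left_inverse B A" "length \<alpha> = l"
  shows "has_formal_sum l (\<lambda>lam. cst (\<Prod>i<l. B (- \<alpha> ! i) (- lam ! i)) * Q_tilde A lam) (calQ \<alpha>)"
  using has_iterated_sum_inverse[OF assms, of 1]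
  by (intro has_formal_sumI) (simp add: Q_tilde_def Gammas_1)

lemma Q_tilde_has_formal_sum_g_prod:
  assumes "is_left_inverse B A" "length \<alpha> = l"
  shows "has_formal_sum l (\<lambda>lam. cst (g_prod B lam \<alpha>) * Q_tilde A lam) (calQ \<alpha>)"
proof (rule has_formal_sumI)
  have "has_iterated_sum l (\<lambda>lam. cst (\<Prod>i<l. B (- \<alpha> ! i) (- lam ! i)) * Q_tilde A lam) (calQ \<alpha>)"
    using Q_tilde_has_formal_sum[OF assms] by (simp add: has_formal_sum_def)
  thus "has_iterated_sum l (\<lambda>lam. cst (g_prod B lam \<alpha>) * Q_tilde A lam) (calQ \<alpha>)"
    by (subst has_iterated_sum_cong) (auto simp: g_prod_def g_ser_def)
qed

end

section \<open>Partial fractions\<close>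

definition pf_coeff :: "('i \<Rightarrow> 'a :: field) \<Rightarrow> 'i set \<Rightarrow> 'i \<Rightarrow> 'a" where
  "pf_coeff X S i = (\<Prod>j\<in>S - {i}. (X i + X j) / (X i - X j))"

lemma pf_coeff_insert:
  assumes "finite S" "z \<notin> S" "i \<in> S"
  shows "pf_coeff X (insert z S) i = (X i + X z) / (X i - X z) * pf_coeff X S i"
proof -
  have "insert z S - {i} = insert z (S - {i})" using assms by auto
  thus ?thesis using assms by (simp add: pf_coeff_def)
qed

lemma pf_coeff_insert_self:
  "z \<notin> S \<Longrightarrow> pf_coeff X (insert z S) z = (\<Prod>j\<in>S. (X z + X j) / (X z - X j))"
  by (simp add: pf_coeff_def)

text \<open>The term (-1)^card S is the value at y = 0. In the induction \<open>y\<close> is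
  arbitrary because the instance \<open>y = X z\<close> evaluates the coefficient at the new
  pole.\<close>

lemma partial_fraction_prod:
  fixes X :: "'i \<Rightarrow> 'a :: field"
  assumes "finite S" "inj_on X S" "y \<notin> X ` S"
  shows "(\<Prod>i\<in>S. (y + X i) / (y - X i)) =
     (-1) ^ card S + (\<Sum>i\<in>S. 2 * pf_coeff X S i * (y / (y - X i)))"
  using assms
proof (induction S arbitrary: y rule: finite_induct)
  case (insert z S)
  define \<epsilon> :: 'a where "\<epsilon> = (-1) ^ card S"
  let ?c = "pf_coeff X S"
  have yz: "y - X z \<noteq> 0" using insert.prems by auto
  have IH: "(\<Prod>i\<in>S. (y + X i) / (y - X i)) = \<epsilon> + (\<Sum>i\<in>S. 2 * ?c i * (y / (y - X i)))"
    if "y \<notin> X ` S" for y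
    unfolding \<epsilon>_def using insert.prems that by (intro insert.IH) auto
  have z: "pf_coeff X (insert z S) z = \<epsilon> + (\<Sum>i\<in>S. 2 * ?c i * (X z / (X z - X i)))"
    unfolding pf_coeff_insert_self[OF insert.hyps(2)]
    using insert.prems insert.hyps by (intro IH) (auto simp: inj_on_def)
  \<comment> \<open>Splits a product with poles at x and Z into simple poles.\<close>
  have 1: "2 * c * (y / (y - x)) * ((y + Z) / (y - Z)) =
      2 * ((x + Z) / (x - Z) * c) * (y / (y - x)) + 2 * (2 * c * (Z / (Z - x))) * (y / (y - Z))"
    if "y - x \<noteq> 0" "y - Z \<noteq> 0" "x - Z \<noteq> 0" for c x Z :: 'a
  proof -
    have "Z / (Z - x) = - (Z / (x - Z))" by (metis minus_diff_eq minus_divide_right)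
    moreover have "2 * c * (y / (y - x)) * ((y + Z) / (y - Z)) =
      2 * ((x + Z) / (x - Z) * c) * (y / (y - x)) + 2 * (2 * c * (- (Z / (x - Z)))) * (y / (y - Z))"
      using that by (simp add: divide_simps) (simp add: algebra_simps)
    ultimately show ?thesis by simp
  qed
  have "(\<Prod>i\<in>insert z S. (y + X i) / (y - X i)) =
      (y + X z) / (y - X z) * (\<epsilon> + (\<Sum>i\<in>S. 2 * ?c i * (y / (y - X i))))"
    using insert by (simp add: IH)
  also have "\<dots> = (y + X z) / (y - X z) * \<epsilon> +
      (\<Sum>i\<in>S. 2 * ?c i * (y / (y - X i)) * ((y + X z) / (y - X z)))"
    by (simp add: distrib_left sum_distrib_left mult.commute)
  also have "(\<Sum>i\<in>S. 2 * ?c i * (y / (y - X i)) * ((y + X z) / (y - X z))) =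
      (\<Sum>i\<in>S. 2 * pf_coeff X (insert z S) i * (y / (y - X i)) +
        2 * (2 * ?c i * (X z / (X z - X i))) * (y / (y - X z)))"
  proof (rule sum.cong)
    fix i assume i: "i \<in> S"
    have "y - X i \<noteq> 0" "X i - X z \<noteq> 0" using i insert by (auto simp: inj_on_def)
    from 1[OF this(1) yz this(2), of "?c i"]
    show "2 * ?c i * (y / (y - X i)) * ((y + X z) / (y - X z)) =
        2 * pf_coeff X (insert z S) i * (y / (y - X i)) +
        2 * (2 * ?c i * (X z / (X z - X i))) * (y / (y - X z))"
      unfolding pf_coeff_insert[OF insert.hyps i] .
  qed simp
  also have "\<dots> = (\<Sum>i\<in>S. 2 * pf_coeff X (insert z S) i * (y / (y - X i))) +
      2 * (\<Sum>i\<in>S. 2 * ?c i * (X z / (X z - X i))) * (y / (y - X z))"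
    by (simp only: sum.distrib sum_distrib_left sum_distrib_right)
  also have "(y + X z) / (y - X z) * \<epsilon> = - \<epsilon> + 2 * \<epsilon> * (y / (y - X z))"
    using yz by (simp add: divide_simps) (simp add: algebra_simps)
  also have "- \<epsilon> + 2 * \<epsilon> * (y / (y - X z)) +
      ((\<Sum>i\<in>S. 2 * pf_coeff X (insert z S) i * (y / (y - X i))) +
      2 * (\<Sum>i\<in>S. 2 * ?c i * (X z / (X z - X i))) * (y / (y - X z))) =
      - \<epsilon> + (\<Sum>i\<in>S. 2 * pf_coeff X (insert z S) i * (y / (y - X i))) +
      2 * pf_coeff X (insert z S) z * (y / (y - X z))"
    unfolding z by (simp only: distrib_left distrib_right add_ac)
  also have "\<dots> = (-1) ^ card (insert z S) +
      (\<Sum>i\<in>insert z S. 2 * pf_coeff X (insert z S) i * (y / (y - X i)))"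
    using insert.hyps by (simp add: \<epsilon>_def)
  finally show ?case .
qed simp

section \<open>Partial fractions of power series\<close>

definition geo :: "'a :: field \<Rightarrow> 'a fps" where
  "geo x = Abs_fps (\<lambda>k. x ^ k)"

lemma geo_mult: "(1 - fps_const x * fps_X) * geo x = 1"
  unfolding geo_def by (rule fps_ext) (auto simp: left_diff_distrib mult.assoc gr0_conv_Suc)

lemma geo_mult_const: "geo z * (1 + fps_const z * fps_X) = 2 * geo z - 1"
  using geo_mult[of z] by (simp add: algebra_simps)

lemma fps_linear_nonzero: "1 - fps_const x * fps_X \<noteq> (0 :: 'a :: field fps)"
  by (metis fps_nth_Abs_fps geo_mult mult_zero_left zero_neq_one)

text \<open>Two-pole partial fractions, checked after multiplication by (1 - x u)(1 - z u); the
  equations \<open>ab\<close> compare the coefficients of 1 and u.\<close>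

lemma geo_mult_geo:
  fixes x z :: "'a :: field"
  assumes "x \<noteq> z"
  shows "geo z * (1 + fps_const z * fps_X) * geo x =
    fps_const ((x + z) / (x - z)) * geo x + fps_const (2 * (z / (z - x))) * geo z"
proof -
  let ?x = "1 - fps_const x * fps_X" and ?z = "1 - fps_const z * fps_X"
  define a where "a = (x + z) / (x - z)"
  define b where "b = 2 * (z / (z - x))"
  have ab: "a + b = 1" "- (a * z) - b * x = z"
  proof -
    have "x - z \<noteq> 0" "z - x \<noteq> 0" using assms by auto
    thus "a + b = 1" "- (a * z) - b * x = z"
      unfolding a_def b_def by (simp_all add: divide_simps) (simp_all add: algebra_simps)
  qed
  have "?x * ?z * (fps_const a * geo x + fps_const b * geo z) =
      fps_const a * ?z * (?x * geo x) + fps_const b * ?x * (?z * geo z)"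
    by (simp only: distrib_left mult_ac)
  also have "\<dots> = fps_const a * ?z + fps_const b * ?x" unfolding geo_mult by simp
  also have "\<dots> = fps_const (a + b) + fps_const (- (a * z) - b * x) * fps_X"
    by (simp add: algebra_simps flip: fps_const_add fps_const_sub fps_const_neg fps_const_mult)
  also have "\<dots> = 1 + fps_const z * fps_X" unfolding ab by simp
  also have "\<dots> = ?x * ?z * (geo z * (1 + fps_const z * fps_X) * geo x)"
  proof -
    have "?x * ?z * (geo z * (1 + fps_const z * fps_X) * geo x) =
        (?x * geo x) * (?z * geo z) * (1 + fps_const z * fps_X)" by (simp only: mult_ac)
    thus ?thesis unfolding geo_mult by simp
  qed
  finally show ?thesis using fps_linear_nonzero[of x] fps_linear_nonzero[of z]
    unfolding a_def[symmetric] b_def[symmetric] by (simp add: mult_left_cancel[of "?x * ?z"])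
qed

text \<open>The recursion says that \<open>G S\<close> is \<open>\<Prod>i\<in>S. (1 + X i u) / (1 - X i u)\<close>.\<close>

lemma partial_fraction_fps:
  fixes X :: "'i \<Rightarrow> 'a :: field"
  assumes "finite S" "inj_on X S" "G {} = 1"
    and rec: "\<And>z T. z \<notin> T \<Longrightarrow> insert z T \<subseteq> S \<Longrightarrow>
      (1 - fps_const (X z) * fps_X) * G (insert z T) = (1 + fps_const (X z) * fps_X) * G T"
  shows "G S = fps_const ((-1) ^ card S) + (\<Sum>i\<in>S. fps_const (2 * pf_coeff X S i) * geo (X i))"
  using assms(1,2) rec
proof (induction S rule: finite_induct)
  case empty
  thus ?case using assms(3) by simp
next
  case (insert z S)
  define \<epsilon> :: 'a where "\<epsilon> = (-1) ^ card S"
  let ?c = "pf_coeff X S" and ?m = "geo (X z) * (1 + fps_const (X z) * fps_X)"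
  have IH: "G S = fps_const \<epsilon> + (\<Sum>i\<in>S. fps_const (2 * ?c i) * geo (X i))"
    unfolding \<epsilon>_def using insert.prems by (intro insert.IH) auto
  have const_sum: "fps_const (\<Sum>i\<in>S. f i) = (\<Sum>i\<in>S. fps_const (f i))" for f :: "'i \<Rightarrow> 'a"
    by (rule fps_ext) (simp add: fps_sum_nth)
  \<comment> \<open>The coefficient at the new pole is the old product evaluated at
    \<open>X z\<close>.\<close>
  have z: "pf_coeff X (insert z S) z = \<epsilon> + (\<Sum>i\<in>S. 2 * ?c i * (X z / (X z - X i)))"
    unfolding pf_coeff_insert_self[OF insert.hyps(2)] \<epsilon>_def
    using insert.prems insert.hyps by (intro partial_fraction_prod) (auto simp: inj_on_def)
  have "G (insert z S) = geo (X z) * ((1 - fps_const (X z) * fps_X) * G (insert z S))"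
    using geo_mult[of "X z"] by (simp add: mult.assoc[symmetric] mult.commute)
  also have "\<dots> = ?m * G S"
    unfolding insert.prems(2)[OF insert.hyps(2) order_refl] by (simp only: mult.assoc)
  also have "\<dots> = fps_const \<epsilon> * ?m + (\<Sum>i\<in>S. fps_const (2 * ?c i) * (?m * geo (X i)))"
    unfolding IH by (simp add: distrib_left sum_distrib_left mult_ac)
  also have "(\<Sum>i\<in>S. fps_const (2 * ?c i) * (?m * geo (X i))) =
      (\<Sum>i\<in>S. fps_const (2 * pf_coeff X (insert z S) i) * geo (X i) +
        fps_const (2 * (2 * ?c i * (X z / (X z - X i)))) * geo (X z))"
  proof (rule sum.cong)
    fix i assume i: "i \<in> S"
    hence "X i \<noteq> X z" using insert by (auto simp: inj_on_def)
    thus "fps_const (2 * ?c i) * (?m * geo (X i)) =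
        fps_const (2 * pf_coeff X (insert z S) i) * geo (X i) +
        fps_const (2 * (2 * ?c i * (X z / (X z - X i)))) * geo (X z)"
      unfolding geo_mult_geo[OF \<open>X i \<noteq> X z\<close>] pf_coeff_insert[OF insert.hyps i]
      by (simp only: distrib_left mult.assoc[symmetric] fps_const_mult) (simp only: mult_ac)
  qed simp
  also have "\<dots> = (\<Sum>i\<in>S. fps_const (2 * pf_coeff X (insert z S) i) * geo (X i)) +
      fps_const (2 * (\<Sum>i\<in>S. 2 * ?c i * (X z / (X z - X i)))) * geo (X z)"
    by (simp only: sum.distrib sum_distrib_left sum_distrib_right const_sum)
  also have "fps_const \<epsilon> * ?m = fps_const (- \<epsilon>) + fps_const (2 * \<epsilon>) * geo (X z)"
    unfolding geo_mult_const
    by (simp add: algebra_simps flip: fps_const_mult fps_const_neg)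
      (simp add: numeral_fps_const mult.commute)
  also have "fps_const (- \<epsilon>) + fps_const (2 * \<epsilon>) * geo (X z) +
      ((\<Sum>i\<in>S. fps_const (2 * pf_coeff X (insert z S) i) * geo (X i)) +
      fps_const (2 * (\<Sum>i\<in>S. 2 * ?c i * (X z / (X z - X i)))) * geo (X z)) =
      fps_const (- \<epsilon>) + (\<Sum>i\<in>S. fps_const (2 * pf_coeff X (insert z S) i) * geo (X i)) +
      fps_const (2 * pf_coeff X (insert z S) z) * geo (X z)"
    unfolding z by (simp only: distrib_left distrib_right fps_const_add[symmetric] add_ac)
  also have "\<dots> = fps_const ((-1) ^ card (insert z S)) +
      (\<Sum>i\<in>insert z S. fps_const (2 * pf_coeff X (insert z S) i) * geo (X i))"
    using insert.hyps by (simp add: \<epsilon>_def add_ac)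
  finally show ?case .
qed

section \<open>Specialization to finitely many variables\<close>

lemma to_xrat_add: "to_xrat (f + g) = to_xrat f + to_xrat g"
  and to_xrat_mult: "to_xrat (f * g) = to_xrat f * to_xrat g"
  and to_xrat_0 [simp]: "to_xrat 0 = 0"
  and to_xrat_1 [simp]: "to_xrat 1 = 1"
  by (simp_all add: to_xrat_def Zero_fract_def One_fract_def)

lemma to_xrat_eq_iff [simp]: "to_xrat f = to_xrat g \<longleftrightarrow> f = g"
  by (simp add: to_xrat_def eq_fract)

lemma to_xrat_power: "to_xrat (f ^ n) = to_xrat f ^ n"
  by (induction n) (simp_all add: to_xrat_mult)

lemma to_xrat_sum: "to_xrat (sum f S) = (\<Sum>x\<in>S. to_xrat (f x))"
  by (induction S rule: infinite_finite_induct) (simp_all add: to_xrat_add)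

lemma to_xrat_of_nat: "to_xrat (of_nat n) = of_nat n"
  by (induction n) (simp_all add: to_xrat_add)

text \<open>Characteristic 0, so that factorials can be divided out at the end.\<close>

lemma xrat_of_nat_eq_0_iff: "of_nat n = (0 :: xrat) \<longleftrightarrow> n = 0"
proof -
  have "of_nat n = (0 :: xrat) \<longleftrightarrow> to_xrat (cst (of_nat n)) = to_xrat (cst 0)"
    by (simp only: cst_of_nat to_xrat_of_nat cst_0 to_xrat_0)
  also have "\<dots> \<longleftrightarrow> n = 0" unfolding to_xrat_eq_iff by simp
  finally show ?thesis .
qed

definition xvar :: "nat \<Rightarrow> xrat" where
  "xvar i = to_xrat (var i)"

lemma inj_xvar: "inj xvar"
proof (rule injI)
  fix i j assume "xvar i = xvar j"
  hence "var i = var j" by (simp add: xvar_def)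
  hence "Poly_Mapping.lookup (var i) (Poly_Mapping.single j 1) = 1" by (simp add: var_def)
  hence "Poly_Mapping.single i (1::nat) = Poly_Mapping.single j 1"
    by (auto simp: var_def lookup_single when_def split: if_splits)
  hence "Poly_Mapping.lookup (Poly_Mapping.single i (1::nat)) j = 1" by simp
  thus "i = j" by (auto simp: lookup_single when_def split: if_splits)
qed

text \<open>Specialization to the variables indexed by a set, because removing a variable from x_1,
  ..., x_n leaves an arbitrary subset.\<close>

definition ev :: "nat set \<Rightarrow> Lam \<Rightarrow> xrat" where
  "ev S f = to_xrat (psubst (\<lambda>i. \<Sum>j\<in>S. var j ^ Suc i) f)"

lemma ev_lam_spec: "ev {..<n} f = to_xrat (lam_spec n f)"
  by (simp add: ev_def lam_spec_def)

lemma ev_add: "ev S (f + g) = ev S f + ev S g"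
  and ev_mult: "ev S (f * g) = ev S f * ev S g"
  and ev_cst: "ev S (cst c) = to_xrat (cst c)"
  and ev_0 [simp]: "ev S 0 = 0"
  and ev_1 [simp]: "ev S 1 = 1"
  and ev_var: "ev S (var i) = (\<Sum>j\<in>S. xvar j ^ Suc i)"
  by (simp_all add: ev_def psubst_add psubst_mult to_xrat_add to_xrat_mult to_xrat_sum to_xrat_power
      xvar_def)

lemma ev_uminus: "ev S (- f) = - ev S f"
  using ev_add[of S f "- f"] by (simp add: eq_neg_iff_add_eq_0 add.commute)

lemma ev_diff: "ev S (f - g) = ev S f - ev S g"
  using ev_add[of S f "- g"] by (simp add: ev_uminus)

lemma ev_sum: "ev S (sum f T) = (\<Sum>x\<in>T. ev S (f x))"
  by (induction T rule: infinite_finite_induct) (simp_all add: ev_add)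

definition pev :: "nat set \<Rightarrow> xrat \<Rightarrow> Lam poly \<Rightarrow> xrat" where
  "pev S x p = poly (map_poly (ev S) p) x"

lemma pev_add: "pev S x (p + q) = pev S x p + pev S x q"
proof -
  have "map_poly (ev S) (p + q) = map_poly (ev S) p + map_poly (ev S) q"
    by (rule poly_eqI) (simp add: coeff_map_poly ev_add)
  thus ?thesis by (simp add: pev_def)
qed

lemma pev_diff: "pev S x (p - q) = pev S x p - pev S x q"
proof -
  have "map_poly (ev S) (p - q) = map_poly (ev S) p - map_poly (ev S) q"
    by (rule poly_eqI) (simp add: coeff_map_poly ev_diff)
  thus ?thesis by (simp add: pev_def)
qed

lemma pev_smult: "pev S x (smult c p) = ev S c * pev S x p"
proof -
  have "map_poly (ev S) (smult c p) = smult (ev S c) (map_poly (ev S) p)"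
    by (rule poly_eqI) (simp add: coeff_map_poly ev_mult)
  thus ?thesis by (simp add: pev_def)
qed

lemma pev_monom_mult: "pev S x (monom 1 n * p) = x ^ n * pev S x p"
proof -
  have "map_poly (ev S) (monom 1 n * p) = monom 1 n * map_poly (ev S) p"
    by (rule poly_eqI) (simp add: coeff_map_poly coeff_monom_mult)
  thus ?thesis by (simp add: pev_def poly_monom)
qed

lemma pev_const: "pev S x [:c:] = ev S c"
  by (simp add: pev_def map_poly_pCons)

lemma pev_ww_mult: "pev S x (ww * p) = x * pev S x p"
  by (simp add: ww_mult pev_def map_poly_pCons)

lemma pev_sum_atMost: "pev S x p = (\<Sum>k\<le>degree p. ev S (coeff p k) * x ^ k)"
proof -
  have "pev S x p = (\<Sum>k\<le>degree (map_poly (ev S) p). ev S (coeff p k) * x ^ k)"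
    by (simp add: pev_def poly_altdef coeff_map_poly)
  also have "\<dots> = (\<Sum>k\<le>degree p. ev S (coeff p k) * x ^ k)"
  proof (rule sum.mono_neutral_left)
    show "{..degree (map_poly (ev S) p)} \<subseteq> {..degree p}"
      using map_poly_degree_leq by auto
    show "\<forall>k\<in>{..degree p} - {..degree (map_poly (ev S) p)}. ev S (coeff p k) * x ^ k = 0"
    proof
      fix k assume "k \<in> {..degree p} - {..degree (map_poly (ev S) p)}"
      hence "coeff (map_poly (ev S) p) k = 0" by (intro coeff_eq_0) auto
      thus "ev S (coeff p k) * x ^ k = 0" by (simp add: coeff_map_poly)
    qed
  qed simp
  finally show ?thesis .
qed

text \<open>The shift at \<open>w = x\<^sub>i\<close> subtracts \<open>x\<^sub>i ^ n\<close> from each power sum, so it removes the variable \<open>x\<^sub>i\<close>.\<close>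

lemma pev_shift:
  assumes "finite S" "i \<in> S"
  shows "pev S (xvar i) (shift f) = ev (S - {i}) f"
proof (induction f rule: cpoly_induct)
  case (cst c)
  show ?case by (simp add: pev_const ev_cst)
next
  case (add f g)
  thus ?case by (simp add: shift_add pev_add ev_add)
next
  case (var k f)
  have "shift (var k * f) = smult (var k) (shift f) - monom 1 (Suc k) * shift f"
    by (simp add: shift_mult shift_var_def left_diff_distrib)
  hence "pev S (xvar i) (shift (var k * f)) = (ev S (var k) - xvar i ^ Suc k) * ev (S - {i}) f"
    by (simp add: pev_diff pev_smult pev_monom_mult var left_diff_distrib del: power_Suc)
  also have "ev S (var k) - xvar i ^ Suc k = ev (S - {i}) (var k)"
    unfolding ev_var using sum.remove[OF assms, of "\<lambda>j. xvar j ^ Suc k"] by simp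
  finally show ?case by (simp add: ev_mult)
qed

lemma ev_qsym_remove:
  assumes "finite S" "i \<in> S"
  shows "ev (S - {i}) (qsym a) + xvar i * ev (S - {i}) (qsym (a - 1)) =
     ev S (qsym a) - xvar i * ev S (qsym (a - 1))"
  using arg_cong[OF shift_qsym[of a], of "pev S (xvar i)"] pev_shift[OF assms]
  by (simp only: pev_add pev_diff pev_ww_mult pev_const)

lemma ev_empty_qsym: "ev {} (qsym (int k)) = (if k = 0 then 1 else 0)"
proof -
  have h: "ev {} (hsym k) = (if k = 0 then 1 else 0)" for k
    using arg_cong[OF lam_spec_hsym[of 0], of "\<lambda>F. fps_nth F k"] ev_lam_spec[of 0 "hsym k"]
    by simp
  have e: "ev {} (esym k) = (if k = 0 then 1 else 0)" for k
    using arg_cong[OF lam_spec_esym[of 0], of "\<lambda>F. fps_nth F k"] ev_lam_spec[of 0 "esym k"]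
    by simp
  have "ev {} (qsym (int k)) = (\<Sum>i=0..k. (if i = 0 then 1 else 0) * (if k - i = 0 then 1 else 0))"
  proof -
    have "qsym (int k) = (\<Sum>i=0..k. esym i * hsym (k - i))" by (simp add: qsym_def fps_mult_nth)
    thus ?thesis by (simp only: ev_sum ev_mult h e)
  qed
  also have "\<dots> = (\<Sum>i=0..k. if i = 0 then (if k = 0 then 1 else 0) else 0)"
    by (intro sum.cong) auto
  finally show ?thesis by simp
qed

text \<open>Coefficient of u^a in the partial fraction decomposition of Q(u); the constant (-1)^card
  S does not contribute as \<open>a \<ge> 1\<close>.\<close>

lemma ev_qsym:
  assumes "finite S" "a \<ge> 1"
  shows "ev S (qsym a) = (\<Sum>i\<in>S. 2 * pf_coeff xvar S i * xvar i ^ nat a)"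
proof -
  define G where "G T = Abs_fps (\<lambda>k. ev T (qsym (int k)))" for T
  have "G S = fps_const ((-1) ^ card S) + (\<Sum>i\<in>S. fps_const (2 * pf_coeff xvar S i) * geo (xvar i))"
  proof (rule partial_fraction_fps)
    show "inj_on xvar S" using inj_xvar by (rule inj_on_subset) simp
    show "G {} = 1" by (rule fps_ext) (simp add: G_def ev_empty_qsym)
  next
    fix z T assume z: "z \<notin> T" "insert z T \<subseteq> S"
    hence T: "insert z T - {z} = T" "finite (insert z T)" using assms(1) finite_subset by auto
    note rec = ev_qsym_remove[OF T(2) insertI1, unfolded T(1)]
    show "(1 - fps_const (xvar z) * fps_X) * G (insert z T) = (1 + fps_const (xvar z) * fps_X) * G T"
    proof (rule fps_ext)
      fix n
      show "fps_nth ((1 - fps_const (xvar z) * fps_X) * G (insert z T)) n =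
          fps_nth ((1 + fps_const (xvar z) * fps_X) * G T) n"
        using rec[of "int n"]
        by (cases n) (simp_all add: left_diff_distrib distrib_right mult.assoc G_def qsym_neg)
    qed
  qed fact
  hence "fps_nth (G S) (nat a) =
      fps_nth (fps_const ((-1) ^ card S) + (\<Sum>i\<in>S. fps_const (2 * pf_coeff xvar S i) * geo (xvar i))) (nat a)"
    by simp
  thus ?thesis using assms(2) by (simp add: G_def geo_def fps_sum_nth)
qed

text \<open>The factor x_i^k from \<open>qsym (a + k)\<close> turns the coefficients of
  \<open>shift f\<close> into its value at w = x_i, which removes x_i. All indices
  \<open>a + k\<close> are positive, so \<open>ev_qsym\<close> applies to each.\<close>

lemma ev_gam:
  assumes "finite S" "a \<ge> 1"
  shows "ev S (gam a (shift f)) =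
     (\<Sum>i\<in>S. 2 * pf_coeff xvar S i * xvar i ^ nat a * ev (S - {i}) f)"
proof -
  let ?p = "shift f"
  have "ev S (gam a ?p) = (\<Sum>k\<le>degree ?p. ev S (qsym (a + int k)) * ev S (coeff ?p k))"
    by (simp add: gam_def lin_def ev_sum ev_mult)
  also have "\<dots> = (\<Sum>k\<le>degree ?p. \<Sum>i\<in>S.
      2 * pf_coeff xvar S i * xvar i ^ nat a * (ev S (coeff ?p k) * xvar i ^ k))"
    using assms by (intro sum.cong refl)
      (simp add: ev_qsym sum_distrib_left nat_add_distrib power_add mult_ac)
  also have "\<dots> = (\<Sum>i\<in>S. 2 * pf_coeff xvar S i * xvar i ^ nat a * pev S (xvar i) ?p)"
    unfolding pev_sum_atMost by (subst sum.swap) (simp add: sum_distrib_left)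
  also have "\<dots> = (\<Sum>i\<in>S. 2 * pf_coeff xvar S i * xvar i ^ nat a * ev (S - {i}) f)"
    by (intro sum.cong refl) (simp add: pev_shift[OF assms(1)])
  finally show ?thesis .
qed

section \<open>Polynomials attached to the rows of the matrix\<close>

lemma first_pos_zero:
  assumes "\<And>j. j < N \<Longrightarrow> A i j = 0" "j < first_pos A i"
  shows "A i j = 0"
proof (cases "\<exists>j. A i j \<noteq> 0")
  case True
  then obtain m where m: "A i m \<noteq> 0" by blast
  let ?P = "\<lambda>k. \<forall>r<k. A i r = 0"
  \<comment> \<open>Restricting the candidates to an interval starting at the known bound
    \<open>N\<close> makes them finite without changing the greatest one.\<close>
  let ?K = "{k \<in> {N..m}. ?P k}"
  have le: "k \<le> m" if "?P k" for k using that m by (meson not_le)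
  have K: "finite ?K" by (rule finite_subset[of _ "{N..m}"]) auto
  have N: "N \<in> ?K" using assms(1) le[of N] by auto
  have "first_pos A i = Max ?K"
    unfolding first_pos_def
  proof (rule Greatest_equality)
    show "?P (Max ?K)" using Max_in[OF K] N by blast
    fix k assume k: "?P k"
    show "k \<le> Max ?K"
    proof (cases "N \<le> k")
      case True
      thus ?thesis using k le[OF k] by (intro Max_ge K) auto
    next
      case False
      thus ?thesis using Max_ge[OF K N] by simp
    qed
  qed
  thus ?thesis using Max_in[OF K] N assms(2) by auto
qed auto

lemma eval_f_poly:
  assumes "\<And>j. j < N \<Longrightarrow> A (- k) j = 0" "k \<noteq> 0"
  shows "eval_xrat (f_poly A k) x =
     (\<Sum>j\<in>{N..-1}. to_xrat (cst (A (- k) j)) * x ^ nat (- j))"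
proof -
  let ?M = "- first_pos A (- k)" and ?h = "\<lambda>c. to_xrat (cst c)"
  have add: "eval_xrat (p + q) x = eval_xrat p x + eval_xrat q x" for p q
  proof -
    have "map_poly ?h (p + q) = map_poly ?h p + map_poly ?h q"
      by (rule poly_eqI) (simp add: coeff_map_poly cst_add to_xrat_add)
    thus ?thesis by (simp add: eval_xrat_def)
  qed
  have zero: "eval_xrat 0 x = 0" by (simp add: eval_xrat_def)
  have sum: "eval_xrat (sum p T) x = (\<Sum>j\<in>T. eval_xrat (p j) x)" for p and T :: "int set"
    by (induction T rule: infinite_finite_induct) (simp_all add: add zero)
  have mono: "eval_xrat (monom c n) x = ?h c * x ^ n" for c n
    by (simp add: eval_xrat_def map_poly_monom poly_monom)
  have "eval_xrat (f_poly A k) x = (\<Sum>j\<in>{1..?M}. ?h (A (- k) (- j)) * x ^ nat j)"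
    using assms(2) by (simp add: f_poly_def sum mono)
  \<comment> \<open>The bound \<open>N\<close> need not be the first nonzero position, so both
    ranges are compared through the larger one.\<close>
  also have "\<dots> = (\<Sum>j\<in>{1..max ?M (- N)}. ?h (A (- k) (- j)) * x ^ nat j)"
  proof (rule sum.mono_neutral_left)
    show "\<forall>j\<in>{1..max ?M (- N)} - {1..?M}. ?h (A (- k) (- j)) * x ^ nat j = 0"
    proof
      fix j assume "j \<in> {1..max ?M (- N)} - {1..?M}"
      hence "A (- k) (- j) = 0" by (intro first_pos_zero[of N A "- k", OF assms(1)]) auto
      thus "?h (A (- k) (- j)) * x ^ nat j = 0" by simp
    qed
  qed auto
  also have "\<dots> = (\<Sum>j\<in>{1..- N}. ?h (A (- k) (- j)) * x ^ nat j)"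
    by (rule sum.mono_neutral_right) (use assms(1) in auto)
  also have "\<dots> = (\<Sum>j\<in>{N..-1}. ?h (A (- k) j) * x ^ nat (- j))"
    by (rule sum.reindex_bij_witness[of _ uminus uminus]) auto
  finally show ?thesis .
qed

context row_finite
begin

text \<open>The vanishing for \<open>j \<ge> 0\<close> leaves only vertex operators with positive
  exponent of u, to which \<open>ev_gam\<close> applies; the powers of x_i then add up to the
  polynomial of the row.\<close>

lemma ev_Gamma_tilde:
  assumes "finite S" "k \<noteq> 0" "\<And>j. j \<ge> 0 \<Longrightarrow> A (- k) j = 0"
  shows "ev S (Gamma_tilde A (- k) f) =
     (\<Sum>i\<in>S. 2 * pf_coeff xvar S i * eval_xrat (f_poly A k) (xvar i) * ev (S - {i}) f)"
proof -
  obtain N where N: "\<And>j. j < N \<Longrightarrow> A (- k) j = 0" using rows by blast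
  let ?D = "int (degree (shift f))" and ?h = "\<lambda>j. to_xrat (cst (A (- k) j))"
  have eval: "eval_xrat (f_poly A k) x = (\<Sum>j\<in>{N..-1}. ?h j * x ^ nat (- j))" for x
    by (rule eval_f_poly) (use N assms(2) in auto)
  have "ev S (Gamma_tilde A (- k) f) = (\<Sum>j\<in>{N..?D}. ?h j * ev S (gam (- j) (shift f)))"
    using Gamma_tilde_lin[of k f] lin_rowq[of N A k "shift f" ?D, OF N order_refl]
    by (simp add: ev_sum ev_mult ev_cst)
  also have "\<dots> = (\<Sum>j\<in>{N..-1}. ?h j * ev S (gam (- j) (shift f)))"
    by (rule sum.mono_neutral_right) (use assms(3) in auto)
  also have "\<dots> = (\<Sum>j\<in>{N..-1}. \<Sum>i\<in>S.
      2 * pf_coeff xvar S i * (?h j * xvar i ^ nat (- j)) * ev (S - {i}) f)"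
    using assms(1) by (intro sum.cong refl) (simp add: ev_gam sum_distrib_left mult_ac)
  also have "\<dots> = (\<Sum>i\<in>S. 2 * pf_coeff xvar S i * eval_xrat (f_poly A k) (xvar i) * ev (S - {i}) f)"
    by (subst sum.swap) (simp only: eval sum_distrib_left sum_distrib_right)
  finally show ?thesis .
qed

end

section \<open>Symmetrization\<close>

lemma sum_permutations_of_set:
  assumes "finite S" "S \<noteq> {}"
  shows "(\<Sum>xs\<in>permutations_of_set S. F xs) =
    (\<Sum>x\<in>S. \<Sum>xs\<in>permutations_of_set (S - {x}). F (x # xs))"
proof -
  have "(\<Sum>xs\<in>permutations_of_set S. F xs) =
      (\<Sum>x\<in>S. \<Sum>xs\<in>(#) x ` permutations_of_set (S - {x}). F xs)"
    unfolding permutations_of_set_nonempty[OF assms(2)]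
    by (rule sum.UNION_disjoint) (use assms in auto)
  also have "\<dots> = (\<Sum>x\<in>S. \<Sum>xs\<in>permutations_of_set (S - {x}). F (x # xs))"
    by (rule sum.cong[OF refl], subst sum.reindex) simp_all
  finally show ?thesis .
qed

text \<open>Writing a permutation as the list of its values is injective, and both sets have the
  same number of elements.\<close>

lemma sum_permutations_of_set_lessThan:
  "(\<Sum>xs\<in>permutations_of_set {..<n}. F xs) = (\<Sum>\<sigma> | \<sigma> permutes {..<n}. F (map \<sigma> [0..<n]))"
proof -
  let ?g = "\<lambda>\<sigma>. map \<sigma> [0..<n]"
  let ?P = "{\<sigma>. \<sigma> permutes {..<n}}"
  have inj: "inj_on ?g ?P"
  proof (rule inj_onI)
    fix \<sigma> \<tau> assume p: "\<sigma> \<in> ?P" "\<tau> \<in> ?P" and eq: "?g \<sigma> = ?g \<tau>"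
    have "\<sigma> i = \<tau> i" for i
    proof (cases "i < n")
      case True
      thus ?thesis using eq by simp
    next
      case False
      thus ?thesis using p permutes_not_in[of \<sigma> "{..<n}" i] permutes_not_in[of \<tau> "{..<n}" i] by simp
    qed
    thus "\<sigma> = \<tau>" by blast
  qed
  have "?g ` ?P = permutations_of_set {..<n}"
  proof (rule card_subset_eq)
    show "?g ` ?P \<subseteq> permutations_of_set {..<n}"
    proof
      fix xs assume "xs \<in> ?g ` ?P"
      then obtain \<sigma> where \<sigma>: "\<sigma> permutes {..<n}" "xs = map \<sigma> [0..<n]" by blast
      have "set xs = {..<n}"
        using permutes_image[OF \<sigma>(1)] by (simp add: \<sigma>(2) atLeast0LessThan)
      moreover have "distinct xs"
        using permutes_inj_on[OF \<sigma>(1)] by (simp add: \<sigma>(2) distinct_map)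
      ultimately show "xs \<in> permutations_of_set {..<n}" by (rule permutations_of_setI)
    qed
    show "card (?g ` ?P) = card (permutations_of_set {..<n})"
      by (simp add: card_image[OF inj] card_permutations[of "{..<n}" n])
  qed simp
  thus ?thesis using sum.reindex[OF inj, of F] by simp
qed

context row_finite
begin

text \<open>The list \<open>xs\<close> is an arrangement of the variables. Only the positions of
  \<open>lam\<close> carry factors, each with its own 2, so that a recursion on \<open>lam\<close>
  is possible.\<close>

definition sym_term :: "int list \<Rightarrow> nat list \<Rightarrow> xrat" where
  "sym_term lam xs = (\<Prod>i<length lam. 2 * eval_xrat (f_poly A (lam ! i)) (xvar (xs ! i)) *
     (\<Prod>j\<in>{i<..<length xs}. (xvar (xs ! i) + xvar (xs ! j)) / (xvar (xs ! i) - xvar (xs ! j))))"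

lemma sym_term_Cons:
  assumes "distinct xs"
  shows "sym_term (a # lam) (x # xs) = 2 * eval_xrat (f_poly A a) (xvar x) *
    (\<Prod>y\<in>set xs. (xvar x + xvar y) / (xvar x - xvar y)) * sym_term lam xs"
proof -
  have 1: "(\<Prod>j\<in>{0<..<Suc (length xs)}. (xvar x + xvar ((x # xs) ! j)) / (xvar x - xvar ((x # xs) ! j))) =
      (\<Prod>y\<in>set xs. (xvar x + xvar y) / (xvar x - xvar y))"
  \<comment> \<open>Positions and entries of \<open>xs\<close> correspond because \<open>xs\<close>
    is distinct; the \<open>THE\<close> term is the position of \<open>y\<close>.\<close>
  proof (rule prod.reindex_bij_witness[of _ "\<lambda>y. Suc (THE i. i < length xs \<and> xs ! i = y)" "\<lambda>j. xs ! (j - 1)"])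
    fix y assume "y \<in> set xs"
    then obtain i where i: "i < length xs" "xs ! i = y" by (auto simp: in_set_conv_nth)
    have "(THE i. i < length xs \<and> xs ! i = y) = i"
      using i assms by (intro the_equality) (auto simp: nth_eq_iff_index_eq)
    thus "xs ! (Suc (THE i. i < length xs \<and> xs ! i = y) - 1) = y"
      "Suc (THE i. i < length xs \<and> xs ! i = y) \<in> {0<..<Suc (length xs)}"
      using i by auto
  next
    fix j assume j: "j \<in> {0<..<Suc (length xs)}"
    have "(THE i. i < length xs \<and> xs ! i = xs ! (j - 1)) = j - 1"
      using j assms by (intro the_equality) (auto simp: nth_eq_iff_index_eq)
    thus "Suc (THE i. i < length xs \<and> xs ! i = xs ! (j - 1)) = j" using j by simp
    show "xs ! (j - 1) \<in> set xs" using j by auto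
    show "(xvar x + xvar (xs ! (j - 1))) / (xvar x - xvar (xs ! (j - 1))) =
        (xvar x + xvar ((x # xs) ! j)) / (xvar x - xvar ((x # xs) ! j))"
      using j by (cases j) auto
  qed
  have "{Suc i<..<Suc (length xs)} = Suc ` {i<..<length xs}" for i
    by (simp flip: atLeastSucLessThan_greaterThanLessThan image_Suc_atLeastLessThan)
  hence 2: "(\<Prod>j\<in>{Suc i<..<Suc (length xs)}. (u + xvar ((x # xs) ! j)) / (u - xvar ((x # xs) ! j))) =
      (\<Prod>j\<in>{i<..<length xs}. (u + xvar (xs ! j)) / (u - xvar (xs ! j)))" for i u
    by (simp add: prod.reindex)
  show ?thesis
    by (simp only: sym_term_def length_Cons prod.lessThan_Suc_shift nth_Cons_0 nth_Cons_Suc 1 2)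
qed

text \<open>The first entry of the arrangement is the variable removed by
  \<open>ev_Gamma_tilde\<close>. When \<open>lam\<close> is used up, each arrangement of the
  remaining variables counts 1, whence the factorial.\<close>

lemma sum_sym_term:
  assumes neg: "\<And>i j. i < 0 \<Longrightarrow> j \<ge> 0 \<Longrightarrow> A i j = 0"
    and "finite S" "length lam \<le> card S" "\<And>a. a \<in> set lam \<Longrightarrow> a \<ge> 1"
  shows "(\<Sum>xs\<in>permutations_of_set S. sym_term lam xs) =
     of_nat (fact (card S - length lam)) * ev S (Q_tilde A lam)"
  using assms(2-)
proof (induction lam arbitrary: S)
  case Nil
  thus ?case by (simp add: sym_term_def Q_tilde_def)
next
  case (Cons a lam)
  have "S \<noteq> {}" using Cons.prems by auto
  have a: "a \<ge> 1" using Cons.prems by simp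
  let ?c = "\<lambda>x. 2 * pf_coeff xvar S x * eval_xrat (f_poly A a) (xvar x)"
  let ?N = "of_nat (fact (card S - length (a # lam))) :: xrat"
  have "(\<Sum>xs\<in>permutations_of_set S. sym_term (a # lam) xs) =
      (\<Sum>x\<in>S. \<Sum>xs\<in>permutations_of_set (S - {x}). sym_term (a # lam) (x # xs))"
    by (rule sum_permutations_of_set) fact+
  also have "\<dots> = (\<Sum>x\<in>S. ?c x * (\<Sum>xs\<in>permutations_of_set (S - {x}). sym_term lam xs))"
    unfolding sum_distrib_left
    by (intro sum.cong refl)
      (simp add: sym_term_Cons permutations_of_setD pf_coeff_def mult_ac)
  also have "\<dots> = (\<Sum>x\<in>S. ?c x * (?N * ev (S - {x}) (Q_tilde A lam)))"
    using Cons.prems by (intro sum.cong refl, subst Cons.IH) (auto simp: card_Diff_singleton)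
  also have "\<dots> = ?N * (\<Sum>x\<in>S. ?c x * ev (S - {x}) (Q_tilde A lam))"
    by (simp only: sum_distrib_left mult_ac)
  also have "(\<Sum>x\<in>S. ?c x * ev (S - {x}) (Q_tilde A lam)) = ev S (Gamma_tilde A (- a) (Q_tilde A lam))"
    using a Cons.prems(1) by (subst ev_Gamma_tilde) (auto intro: neg)
  finally show ?case by (simp add: Q_tilde_def)
qed

text \<open>The summand of \<open>R (length lam)\<close> is unchanged when the variables past
  \<open>length lam\<close> are permuted, hence the denominator. In \<open>R n\<close> it changes
  sign when two adjacent ones of them are swapped, so that symmetrization gives 0 once there are
  two; with at most one, the two products agree.\<close>

lemma Q_tilde_symmetrization:
  fixes lam :: "int list" and n :: nat
  defines "lam' \<equiv> (\<lambda>i. if i < length lam then lam ! i else 0)"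
  defines "R \<equiv> (\<lambda>m (x :: nat \<Rightarrow> xrat). (\<Prod>i<n. eval_xrat (f_poly A (lam' i)) (x i)) *
    (\<Prod>i<m. \<Prod>j\<in>{i<..<n}. (x i + x j) / (x i - x j)))"
  assumes neg: "\<And>i j. i < 0 \<Longrightarrow> j \<ge> 0 \<Longrightarrow> A i j = 0"
    and lam: "\<And>i. i < length lam \<Longrightarrow> lam ! i \<ge> 1" and n: "length lam \<le> n"
  shows "to_xrat (lam_spec n (Q_tilde A lam)) = 2 ^ length lam / of_nat (fact (n - length lam)) *
      (\<Sum>\<sigma> | \<sigma> permutes {..<n}. R (length lam) (\<lambda>i. to_xrat (var (\<sigma> i))))" (is ?A)
    and "n \<le> length lam + 1 \<Longrightarrow> to_xrat (lam_spec n (Q_tilde A lam)) = 2 ^ length lam *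
      (\<Sum>\<sigma> | \<sigma> permutes {..<n}. R n (\<lambda>i. to_xrat (var (\<sigma> i))))" (is "_ \<Longrightarrow> ?B")
proof -
  let ?l = "length lam"
  have pos: "a \<in> set lam \<Longrightarrow> a \<ge> 1" for a
    using lam by (auto simp: in_set_conv_nth)
  have tm: "sym_term lam (map \<sigma> [0..<n]) = 2 ^ ?l * R ?l (\<lambda>i. to_xrat (var (\<sigma> i)))" for \<sigma>
  proof -
    let ?x = "\<lambda>i. xvar (\<sigma> i)"
    have "sym_term lam (map \<sigma> [0..<n]) = (\<Prod>i<?l. 2 * eval_xrat (f_poly A (lam ! i)) (?x i) *
        (\<Prod>j\<in>{i<..<n}. (?x i + ?x j) / (?x i - ?x j)))"
      unfolding sym_term_def using n by (intro prod.cong refl arg_cong2[of _ _ _ _ times]) auto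
    also have "\<dots> = 2 ^ ?l * (\<Prod>i<?l. eval_xrat (f_poly A (lam ! i)) (?x i)) *
        (\<Prod>i<?l. \<Prod>j\<in>{i<..<n}. (?x i + ?x j) / (?x i - ?x j))"
      by (simp add: prod.distrib)
    \<comment> \<open>The padding entries are 0, and their polynomial is 1.\<close>
    also have "(\<Prod>i<?l. eval_xrat (f_poly A (lam ! i)) (?x i)) =
        (\<Prod>i<n. eval_xrat (f_poly A (lam' i)) (?x i))"
      by (rule prod.mono_neutral_cong_left)
        (use n in \<open>auto simp: lam'_def f_poly_def eval_xrat_def map_poly_1\<close>)
    finally show ?thesis by (simp add: R_def xvar_def mult.assoc)
  qed
  have "of_nat (fact (n - ?l)) * to_xrat (lam_spec n (Q_tilde A lam)) =
      2 ^ ?l * (\<Sum>\<sigma> | \<sigma> permutes {..<n}. R ?l (\<lambda>i. to_xrat (var (\<sigma> i))))"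
    using sum_sym_term[of "{..<n}" lam, OF neg _ _ pos] n
    by (simp add: sum_permutations_of_set_lessThan tm sum_distrib_left ev_lam_spec)
  thus A: ?A
    using xrat_of_nat_eq_0_iff[of "fact (n - ?l)"] by (simp add: field_simps)
  assume n': "n \<le> ?l + 1"
  have "R n = R ?l"
  proof (cases "n = ?l")
    case False
    hence "n = Suc ?l" using n n' by simp
    moreover have "{?l<..<Suc ?l} = {}" by auto
    ultimately show ?thesis unfolding R_def by simp
  qed simp
  moreover have "fact (n - ?l) = (1 :: nat)"
    using n n' by (cases "n = ?l") (auto simp: le_Suc_eq)
  ultimately show ?B using A by simp
qed

end

theorem corollary5p2:
  fixes A :: "int \<Rightarrow> int \<Rightarrow> complex"
  assumes rows: "\<forall>i. \<exists>N. \<forall>j<N. A i j = 0"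
  shows
    "\<comment> \<open>(a)\<close>
     (\<forall>l. \<forall>lam\<in>Zvec l.
       has_finite_sum (\<lambda>\<alpha>. cst (\<Prod>i<l. A (- lam ! i) (- \<alpha> ! i)) * calQ \<alpha>) (Zvec l)
         (Q_tilde A lam)) \<and>
     (\<forall>B. is_left_inverse B A \<longrightarrow> (\<forall>l. \<forall>\<alpha>\<in>Zvec l.
       has_formal_sum l (\<lambda>lam. cst (\<Prod>i<l. B (- \<alpha> ! i) (- lam ! i)) * Q_tilde A lam)
         (calQ \<alpha>))) \<and>
     \<comment> \<open>(b)\<close>
     (\<forall>a b. finite {(k, r). cst (A (- a) (- k) * A (- b) (- r)) * qsym2 k r \<noteq> 0}) \<and>
     (\<forall>l. \<forall>lam\<in>Zvec (2 * l).
       Q_tilde A lam = Pfaffian l (\<lambda>i j.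
         \<Sum>(k, r). cst (A (- lam ! i) (- k) * A (- lam ! j) (- r)) * qsym2 k r)) \<and>
     \<comment> \<open>(c)\<close>
     (\<forall>l. \<forall>lam\<in>Zvec l. \<forall>n.
       psubst (\<lambda>i. if i = n then 0 else var i) (lam_spec (Suc n) (Q_tilde A lam))
         = lam_spec n (Q_tilde A lam)) \<and>
     \<comment> \<open>(d)\<close>
     (\<forall>B. is_left_inverse B A \<longrightarrow> (\<forall>l. \<forall>\<alpha>\<in>Zvec l.
       has_formal_sum l (\<lambda>lam. cst (g_prod B lam \<alpha>) * Q_tilde A lam) (calQ \<alpha>))) \<and>
     \<comment> \<open>(e)\<close>
     ((\<forall>i<0. \<forall>j\<ge>0. A i j = 0) \<longrightarrow> (\<forall>j. A 0 j = (if j = 0 then 1 else 0)) \<longrightarrow>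
       (\<forall>l. \<forall>lam\<in>Zvec l. (\<forall>i<l. lam ! i \<ge> 1) \<longrightarrow> (\<forall>n\<ge>l.
          let lam' = (\<lambda>i. if i < l then lam ! i else 0);
              R = (\<lambda>m (x :: nat \<Rightarrow> xrat). (\<Prod>i<n. eval_xrat (f_poly A (lam' i)) (x i)) *
                     (\<Prod>i<m. \<Prod>j\<in>{i<..<n}. (x i + x j) / (x i - x j)));
              symm = (\<lambda>F :: (nat \<Rightarrow> xrat) \<Rightarrow> xrat.
                     \<Sum>\<sigma> | \<sigma> permutes {..<n}. F (\<lambda>i. to_xrat (var (\<sigma> i))))
          in to_xrat (lam_spec n (Q_tilde A lam)) = 2 ^ l / of_nat (fact (n - l)) * symm (R l) \<and>
             (n \<le> l + 1 \<longrightarrow> to_xrat (lam_spec n (Q_tilde A lam)) = 2 ^ l * symm (R n)))))"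
proof -
  interpret row_finite A by standard (rule rows)
  show ?thesis
  proof (intro conjI)
    show "\<forall>l. \<forall>lam\<in>Zvec l.
       has_finite_sum (\<lambda>\<alpha>. cst (\<Prod>i<l. A (- lam ! i) (- \<alpha> ! i)) * calQ \<alpha>) (Zvec l)
         (Q_tilde A lam)"
      using Q_tilde_has_finite_sum by (auto simp: Zvec_def)
    show "\<forall>B. is_left_inverse B A \<longrightarrow> (\<forall>l. \<forall>\<alpha>\<in>Zvec l.
       has_formal_sum l (\<lambda>lam. cst (\<Prod>i<l. B (- \<alpha> ! i) (- lam ! i)) * Q_tilde A lam) (calQ \<alpha>))"
      using Q_tilde_has_formal_sum by (simp add: Zvec_def)
    show "\<forall>a b. finite {(k, r). cst (A (- a) (- k) * A (- b) (- r)) * qsym2 k r \<noteq> 0}"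
      using Q_tilde_pair(1) by blast
    show "\<forall>l. \<forall>lam\<in>Zvec (2 * l). Q_tilde A lam = Pfaffian l (\<lambda>i j.
         \<Sum>(k, r). cst (A (- lam ! i) (- k) * A (- lam ! j) (- r)) * qsym2 k r)"
      using Q_tilde_Pfaffian by (simp add: Zvec_def)
    show "\<forall>l. \<forall>lam\<in>Zvec l. \<forall>n.
       psubst (\<lambda>i. if i = n then 0 else var i) (lam_spec (Suc n) (Q_tilde A lam))
         = lam_spec n (Q_tilde A lam)"
      using lam_spec_stable by blast
    show "\<forall>B. is_left_inverse B A \<longrightarrow> (\<forall>l. \<forall>\<alpha>\<in>Zvec l.
       has_formal_sum l (\<lambda>lam. cst (g_prod B lam \<alpha>) * Q_tilde A lam) (calQ \<alpha>))"
      using Q_tilde_has_formal_sum_g_prod by (simp add: Zvec_def)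
  next
    show "(\<forall>i<0. \<forall>j\<ge>0. A i j = 0) \<longrightarrow> (\<forall>j. A 0 j = (if j = 0 then 1 else 0)) \<longrightarrow>
       (\<forall>l. \<forall>lam\<in>Zvec l. (\<forall>i<l. lam ! i \<ge> 1) \<longrightarrow> (\<forall>n\<ge>l.
          let lam' = (\<lambda>i. if i < l then lam ! i else 0);
              R = (\<lambda>m (x :: nat \<Rightarrow> xrat). (\<Prod>i<n. eval_xrat (f_poly A (lam' i)) (x i)) *
                     (\<Prod>i<m. \<Prod>j\<in>{i<..<n}. (x i + x j) / (x i - x j)));
              symm = (\<lambda>F :: (nat \<Rightarrow> xrat) \<Rightarrow> xrat.
                     \<Sum>\<sigma> | \<sigma> permutes {..<n}. F (\<lambda>i. to_xrat (var (\<sigma> i))))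
          in to_xrat (lam_spec n (Q_tilde A lam)) = 2 ^ l / of_nat (fact (n - l)) * symm (R l) \<and>
             (n \<le> l + 1 \<longrightarrow> to_xrat (lam_spec n (Q_tilde A lam)) = 2 ^ l * symm (R n))))"
    proof (intro impI allI ballI)
      fix l lam n
      assume neg: "\<forall>i<0. \<forall>j\<ge>0. A i j = 0" and "lam \<in> Zvec l" "\<forall>i<l. lam ! i \<ge> 1" "n \<ge> l"
      moreover from this have "l = length lam" by (simp add: Zvec_def)
      ultimately show "let lam' = (\<lambda>i. if i < l then lam ! i else 0);
              R = (\<lambda>m (x :: nat \<Rightarrow> xrat). (\<Prod>i<n. eval_xrat (f_poly A (lam' i)) (x i)) *
                     (\<Prod>i<m. \<Prod>j\<in>{i<..<n}. (x i + x j) / (x i - x j)));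
              symm = (\<lambda>F :: (nat \<Rightarrow> xrat) \<Rightarrow> xrat.
                     \<Sum>\<sigma> | \<sigma> permutes {..<n}. F (\<lambda>i. to_xrat (var (\<sigma> i))))
          in to_xrat (lam_spec n (Q_tilde A lam)) = 2 ^ l / of_nat (fact (n - l)) * symm (R l) \<and>
             (n \<le> l + 1 \<longrightarrow> to_xrat (lam_spec n (Q_tilde A lam)) = 2 ^ l * symm (R n))"
        unfolding Let_def using Q_tilde_symmetrization[of lam n] by blast
    qed
  qed
qed

end
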